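(* Let $\Omega\subset\mathbb{R}^n$ be open and bounded, let $\mathbb{A}$ be a $k$-th order $\mathbb{C}$-elliptic differential operator from $V$ to $W$, and let $(X(\Omega),\|\cdot\|_{X(\Omega)})$ and $(Y(\Omega),\|\cdot\|_{Y(\Omega)})$ be two infinite-dimensional Banach function spaces (used for $V$-valued maps) with $X(\Omega),Y(\Omega)\subset L^1_{\mathrm{loc}}(\Omega;V)$. Suppose that there is a constant $C>0$ such that for all $\mathbf{u}\in W^kX(\Omega;V)$ $$\|\mathbf{u}\|_{W^kY(\Omega)}\le C\big(\|\mathbf{u}\|_{X(\Omega)}+\|\mathbb{A}\mathbf{u}\|_{X(\Omega)}\big)\quad\text{and}\quad \inf_{\boldsymbol{\rho}\in\ker(\mathbb{A};\mathbb{R}^n)}\|\mathbf{u}-\boldsymbol{\rho}\|_{X(\Omega)}\le C\,\|\mathbb{A}\mathbf{u}\|_{X(\Omega)}.$$ Then the following are equivalent for a seminorm $|||\cdot|||$ on $W^kX(\Omega;V)$: (a) $|||\cdot|||$ is a norm on $\ker(\mathbb{A};\mathbb{R}^n)|_\Omega$ (the space of restrictions to $\Omega$ of elements of $\ker(\mathbb{A};\mathbb{R}^n)$). (b) There is a constant $c>0$ such that $\|\mathbf{u}\|_{W^kY(\Omega)}\le c\big(|||\mathbf{u}|||+\|\mathbb{A}\mathbf{u}\|_{X(\Omega)}\big)$ for all $\mathbf{u}\in W^kX(\Omega;V)$. (c) There is a constant $c>0$ such that $\|\mathbf{u}\|_{W^kY(\Omega)}\le c\,\|\mathbb{A}\mathbf{u}\|_{X(\Omega)}$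 for all $\mathbf{u}\in W^kX(\Omega;V)$ with $|||\mathbf{u}|||=0$.
   Context: Throughout $n\ge 2$ and $k\in\mathbb{N}$, $k\geq 1$. $V,W$ are finite-dimensional inner product spaces. A $k$-th order differential operator is a linear, homogeneous, constant-coefficient operator $\mathbb{A}=\sum_{|\alpha|=k}\mathbb{A}_\alpha\partial^\alpha$ on $\mathbb{R}^n$ with fixed linear maps $\mathbb{A}_\alpha:V\to W$; its Fourier symbol is $\mathbb{A}[\xi]=\sum_{|\alpha|=k}\xi^\alpha\mathbb{A}_\alpha$. $\mathbb{A}$ is $\mathbb{C}$-elliptic if $\mathbb{A}[\xi]:V+\mathrm{i}V\to W+\mathrm{i}W$ is injective for every $\xi\in\mathbb{C}^n\setminus\{0\}$. Put $\ker(\mathbb{A};\mathbb{R}^n)=\{\mathbf{v}\in\mathscr{D}'(\mathbb{R}^n;V):\mathbb{A}\mathbf{v}=0\}$; for $\mathbb{C}$-elliptic $\mathbb{A}$ this is a finite-dimensional space of $V$-valued polynomials and equals $\{\mathbf{v}:\mathbb{R}^n\to V\text{ polynomial}:\mathbb{A}\mathbf{v}=0\}$. Banach function spaces (Bennett–Sharpley): a Banach function norm is a map $\rho$ from the $[0,\infty]$-valued measurable functions on $\Omega$ to $[0,\infty]$ such that for all such $u,v,u_i$ and $\lambda\ge0$: (B1) $\rho(u)=0$ implies $u=0$ a.e., $\rho(\lambda u)=\lambda\rho(u)$, $\rho(u+v)\le\rho(u)+\rho(v)$; (B2) $u\le v$ a.e. implies $\rho(u)\le\rho(v)$; (B3)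 $u_i\nearrow u$ a.e. implies $\rho(u_i)\nearrow\rho(u)$; (B4) $\rho(\mathbf{1}_A)<\infty$ for measurable $A\subset\Omega$ with $\mathscr{L}^n(A)<\infty$; (B5) for measurable $A\subset\Omega$ with $\mathscr{L}^n(A)<\infty$ there is $c=c(A,\rho)$ with $\|u\|_{L^1(A)}\le c\rho(u)$. Here $\mathscr{L}^n$ is Lebesgue measure. The Banach function space is $X(\Omega)=\{u\text{ measurable}:\|u\|_{X(\Omega)}:=\rho(|u|)<\infty\}$; for maps with values in a finite-dimensional inner product space, $\|\mathbf{u}\|_{X(\Omega)}:=\rho(|\mathbf{u}|)$. The Sobolev space $W^kX(\Omega;V)$ consists of the $k$-times weakly differentiable $\mathbf{u}:\Omega\to V$ with $\|\mathbf{u}\|_{W^kX(\Omega)}:=\sum_{|\alpha|\le k}\|\partial^\alpha\mathbf{u}\|_{X(\Omega)}<\infty$; analogously for $Y$.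
   Formalization: The seminorm is additionally assumed continuous: |||u||| ≤ M(‖u‖_X + ‖Au‖_X) on W^kX for some M; without this, (a) does not imply (b) or (c), e.g. |||u||| = |∫u + f(u)| with f a discontinuous linear functional on W^{1,2}, f(1)=0, and A the gradient. *)

theory Defs
  imports "HOL-Analysis.Analysis"
begin

section \<open>Multi-indices, partial derivatives and test functions\<close>

definition mi_order :: "('n::finite \<Rightarrow> nat) \<Rightarrow> nat" where
  "mi_order \<alpha> = (\<Sum>i\<in>UNIV. \<alpha> i)"

definition partial :: "'n::finite \<Rightarrow> (real^'n \<Rightarrow> real) \<Rightarrow> real^'n \<Rightarrow> real" where
  "partial i \<phi> x = frechet_derivative \<phi> (at x) (axis i 1)"

definition smooth_fun :: "(real^'n \<Rightarrow> real) \<Rightarrow> bool" where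
  "smooth_fun \<phi> \<longleftrightarrow> (\<forall>is. (foldr partial is \<phi>) differentiable_on UNIV)"

text \<open>The index type carries no order, so one enumeration of the coordinates is fixed; on smooth
  functions the choice does not matter, since partial derivatives commute.\<close>

definition coord_list :: "'n::finite list" where
  "coord_list = (SOME is. distinct is \<and> set is = UNIV)"

definition mi_partial :: "('n::finite \<Rightarrow> nat) \<Rightarrow> (real^'n \<Rightarrow> real) \<Rightarrow> real^'n \<Rightarrow> real" where
  "mi_partial \<alpha> \<phi> = foldr (\<lambda>i. partial i ^^ \<alpha> i) coord_list \<phi>"

definition supp :: "(real^'n \<Rightarrow> real) \<Rightarrow> (real^'n) set" where
  "supp \<phi> = closure {x. \<phi> x \<noteq> 0}"

definition test_functions :: "(real^'n) set \<Rightarrow> (real^'n \<Rightarrow> real) set" where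
  "test_functions \<Omega> = {\<phi>. smooth_fun \<phi> \<and> compact (supp \<phi>) \<and> supp \<phi> \<subseteq> \<Omega>}"

section \<open>Weak derivatives\<close>

text \<open>Functions on \<open>\<Omega>\<close> are represented by total functions whose values outside \<open>\<Omega>\<close> are
  irrelevant; functions that agree almost everywhere on \<open>\<Omega>\<close> represent the same element.\<close>

definition L1_loc :: "(real^'n) set \<Rightarrow> (real^'n \<Rightarrow> 'v::euclidean_space) set" where
  "L1_loc \<Omega> = {u. \<forall>K. compact K \<and> K \<subseteq> \<Omega> \<longrightarrow> set_integrable lebesgue K u}"

definition has_weak_deriv ::
  "(real^'n) set \<Rightarrow> ('n::finite \<Rightarrow> nat) \<Rightarrow> (real^'n \<Rightarrow> 'v::euclidean_space) \<Rightarrow> (real^'n \<Rightarrow> 'v) \<Rightarrow> bool" where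
  "has_weak_deriv \<Omega> \<alpha> u v \<longleftrightarrow> u \<in> L1_loc \<Omega> \<and> v \<in> L1_loc \<Omega> \<and>
     (\<forall>\<phi>\<in>test_functions \<Omega>.
        (LINT x:\<Omega>|lebesgue. mi_partial \<alpha> \<phi> x *\<^sub>R u x)
          = (-1) ^ mi_order \<alpha> *\<^sub>R (LINT x:\<Omega>|lebesgue. \<phi> x *\<^sub>R v x))"

definition weak_deriv ::
  "(real^'n) set \<Rightarrow> ('n::finite \<Rightarrow> nat) \<Rightarrow> (real^'n \<Rightarrow> 'v::euclidean_space) \<Rightarrow> real^'n \<Rightarrow> 'v" where
  "weak_deriv \<Omega> \<alpha> u = (SOME v. has_weak_deriv \<Omega> \<alpha> u v)"

section \<open>Differential operators\<close>

text \<open>A homogeneous operator of order \<open>k\<close> is given by its coefficients \<open>A \<alpha>\<close>; only those with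
  \<open>mi_order \<alpha> = k\<close> matter.\<close>

definition diff_operator ::
  "nat \<Rightarrow> (('n::finite \<Rightarrow> nat) \<Rightarrow> 'v::euclidean_space \<Rightarrow> 'w::euclidean_space) \<Rightarrow> bool" where
  "diff_operator k A \<longleftrightarrow> (\<forall>\<alpha>. mi_order \<alpha> = k \<longrightarrow> linear (A \<alpha>))"

text \<open>The pair \<open>(a, b)\<close> stands for the element \<open>a + \<i> b\<close> of the complexification.\<close>

definition cscale :: "complex \<Rightarrow> 'w \<times> 'w \<Rightarrow> ('w::real_vector) \<times> 'w" where
  "cscale z p = (Re z *\<^sub>R fst p - Im z *\<^sub>R snd p, Re z *\<^sub>R snd p + Im z *\<^sub>R fst p)"

definition symbol ::
  "nat \<Rightarrow> (('n::finite \<Rightarrow> nat) \<Rightarrow> 'v::euclidean_space \<Rightarrow> 'w::euclidean_space)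
    \<Rightarrow> complex^'n \<Rightarrow> 'v \<times> 'v \<Rightarrow> 'w \<times> 'w" where
  "symbol k A \<xi> p =
     (\<Sum>\<alpha> | mi_order \<alpha> = k. cscale (\<Prod>i\<in>UNIV. (\<xi> $ i) ^ \<alpha> i) (A \<alpha> (fst p), A \<alpha> (snd p)))"

definition C_elliptic ::
  "nat \<Rightarrow> (('n::finite \<Rightarrow> nat) \<Rightarrow> 'v::euclidean_space \<Rightarrow> 'w::euclidean_space) \<Rightarrow> bool" where
  "C_elliptic k A \<longleftrightarrow> (\<forall>\<xi>. \<xi> \<noteq> 0 \<longrightarrow> inj (symbol k A \<xi>))"

definition op_apply ::
  "(real^'n) set \<Rightarrow> nat \<Rightarrow> (('n::finite \<Rightarrow> nat) \<Rightarrow> 'v::euclidean_space \<Rightarrow> 'w::euclidean_space)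
    \<Rightarrow> (real^'n \<Rightarrow> 'v) \<Rightarrow> real^'n \<Rightarrow> 'w" where
  "op_apply \<Omega> k A u x = (\<Sum>\<alpha> | mi_order \<alpha> = k. A \<alpha> (weak_deriv \<Omega> \<alpha> u x))"

section \<open>The distributional kernel\<close>

text \<open>Continuity is expressed by the usual seminorm estimates on compact sets. A distribution is only
  meaningful on test functions; its values elsewhere are ignored.\<close>

definition distribution :: "((real^'n \<Rightarrow> real) \<Rightarrow> 'v::euclidean_space) \<Rightarrow> bool" where
  "distribution T \<longleftrightarrow>
     (\<forall>\<phi>\<in>test_functions UNIV. \<forall>\<psi>\<in>test_functions UNIV. T (\<lambda>x. \<phi> x + \<psi> x) = T \<phi> + T \<psi>) \<and>
     (\<forall>c. \<forall>\<phi>\<in>test_functions UNIV. T (\<lambda>x. c * \<phi> x) = c *\<^sub>R T \<phi>) \<and>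
     (\<forall>K. compact K \<longrightarrow> (\<exists>C m. \<forall>\<phi>\<in>test_functions UNIV. supp \<phi> \<subseteq> K \<longrightarrow>
        norm (T \<phi>) \<le> C * (\<Sum>\<alpha> | mi_order \<alpha> \<le> m. SUP x. \<bar>mi_partial \<alpha> \<phi> x\<bar>)))"

definition dist_deriv ::
  "('n::finite \<Rightarrow> nat) \<Rightarrow> ((real^'n \<Rightarrow> real) \<Rightarrow> 'v::euclidean_space) \<Rightarrow> (real^'n \<Rightarrow> real) \<Rightarrow> 'v" where
  "dist_deriv \<alpha> T \<phi> = (-1) ^ mi_order \<alpha> *\<^sub>R T (mi_partial \<alpha> \<phi>)"

definition dist_kernel ::
  "nat \<Rightarrow> (('n::finite \<Rightarrow> nat) \<Rightarrow> 'v::euclidean_space \<Rightarrow> 'w::euclidean_space)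
    \<Rightarrow> ((real^'n \<Rightarrow> real) \<Rightarrow> 'v) set" where
  "dist_kernel k A = {T. distribution T \<and>
     (\<forall>\<phi>\<in>test_functions UNIV. (\<Sum>\<alpha> | mi_order \<alpha> = k. A \<alpha> (dist_deriv \<alpha> T \<phi>)) = 0)}"

text \<open>The functions on \<open>\<Omega>\<close> that represent the restriction to \<open>\<Omega>\<close> of an element of the
  kernel on the whole space.\<close>

definition kernel_on ::
  "(real^'n) set \<Rightarrow> nat \<Rightarrow> (('n::finite \<Rightarrow> nat) \<Rightarrow> 'v::euclidean_space \<Rightarrow> 'w::euclidean_space)
    \<Rightarrow> (real^'n \<Rightarrow> 'v) set" where
  "kernel_on \<Omega> k A = {r \<in> L1_loc \<Omega>. \<exists>T\<in>dist_kernel k A.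
     \<forall>\<phi>\<in>test_functions \<Omega>. T \<phi> = (LINT x:\<Omega>|lebesgue. \<phi> x *\<^sub>R r x)}"

section \<open>Banach function spaces and Sobolev spaces\<close>

definition banach_function_norm ::
  "(real^'n) set \<Rightarrow> ((real^'n \<Rightarrow> ennreal) \<Rightarrow> ennreal) \<Rightarrow> bool" where
  "banach_function_norm \<Omega> \<rho> \<longleftrightarrow>
     (\<forall>u\<in>borel_measurable (lebesgue_on \<Omega>). \<rho> u = 0 \<longrightarrow> (AE x in lebesgue_on \<Omega>. u x = 0)) \<and>
     (\<forall>u\<in>borel_measurable (lebesgue_on \<Omega>). \<forall>c::real. 0 \<le> c \<longrightarrow>
        \<rho> (\<lambda>x. ennreal c * u x) = ennreal c * \<rho> u) \<and>
     (\<forall>u\<in>borel_measurable (lebesgue_on \<Omega>). \<forall>v\<in>borel_measurable (lebesgue_on \<Omega>).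
        \<rho> (\<lambda>x. u x + v x) \<le> \<rho> u + \<rho> v) \<and>
     (\<forall>u\<in>borel_measurable (lebesgue_on \<Omega>). \<forall>v\<in>borel_measurable (lebesgue_on \<Omega>).
        (AE x in lebesgue_on \<Omega>. u x \<le> v x) \<longrightarrow> \<rho> u \<le> \<rho> v) \<and>
     (\<forall>U. \<forall>u\<in>borel_measurable (lebesgue_on \<Omega>).
        (\<forall>i. U i \<in> borel_measurable (lebesgue_on \<Omega>)) \<longrightarrow>
        (AE x in lebesgue_on \<Omega>. incseq (\<lambda>i::nat. U i x) \<and> (\<lambda>i. U i x) \<longlonglongrightarrow> u x) \<longrightarrow>
        incseq (\<lambda>i. \<rho> (U i)) \<and> (\<lambda>i. \<rho> (U i)) \<longlonglongrightarrow> \<rho> u) \<and>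
     (\<forall>S\<in>sets lebesgue. S \<subseteq> \<Omega> \<longrightarrow> emeasure lebesgue S < \<infinity> \<longrightarrow> \<rho> (indicator S) < \<infinity>) \<and>
     (\<forall>S\<in>sets lebesgue. S \<subseteq> \<Omega> \<longrightarrow> emeasure lebesgue S < \<infinity> \<longrightarrow>
        (\<exists>c::real. \<forall>u\<in>borel_measurable (lebesgue_on \<Omega>).
           (\<integral>\<^sup>+x\<in>S. u x \<partial>lebesgue) \<le> ennreal c * \<rho> u))"

definition vnorm ::
  "((real^'n \<Rightarrow> ennreal) \<Rightarrow> ennreal) \<Rightarrow> (real^'n \<Rightarrow> 'v::euclidean_space) \<Rightarrow> ennreal" where
  "vnorm \<rho> u = \<rho> (\<lambda>x. ennreal (norm (u x)))"

definition bf_space ::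
  "(real^'n) set \<Rightarrow> ((real^'n \<Rightarrow> ennreal) \<Rightarrow> ennreal) \<Rightarrow> (real^'n \<Rightarrow> 'v::euclidean_space) set" where
  "bf_space \<Omega> \<rho> = {u \<in> borel_measurable (lebesgue_on \<Omega>). vnorm \<rho> u < \<infinity>}"

text \<open>Dimension is that of the space of almost-everywhere classes.\<close>

definition infinite_dimensional ::
  "(real^'n) set \<Rightarrow> (real^'n \<Rightarrow> 'v::euclidean_space) set \<Rightarrow> bool" where
  "infinite_dimensional \<Omega> S \<longleftrightarrow>
     (\<forall>B. finite B \<and> B \<subseteq> S \<longrightarrow>
        (\<exists>u\<in>S. \<forall>c. \<not> (AE x in lebesgue_on \<Omega>. u x = (\<Sum>b\<in>B. c b *\<^sub>R b x))))"

definition sob_norm ::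
  "(real^'n) set \<Rightarrow> nat \<Rightarrow> ((real^'n \<Rightarrow> ennreal) \<Rightarrow> ennreal) \<Rightarrow> (real^'n \<Rightarrow> 'v::euclidean_space)
    \<Rightarrow> ennreal" where
  "sob_norm \<Omega> k \<rho> u = (\<Sum>\<alpha> | mi_order \<alpha> \<le> k. vnorm \<rho> (weak_deriv \<Omega> \<alpha> u))"

definition sob_space ::
  "(real^'n) set \<Rightarrow> nat \<Rightarrow> ((real^'n \<Rightarrow> ennreal) \<Rightarrow> ennreal) \<Rightarrow> (real^'n \<Rightarrow> 'v::euclidean_space) set" where
  "sob_space \<Omega> k \<rho> =
     {u. (\<forall>\<alpha>. mi_order \<alpha> \<le> k \<longrightarrow> (\<exists>v. has_weak_deriv \<Omega> \<alpha> u v)) \<and> sob_norm \<Omega> k \<rho> u < \<infinity>}"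

section \<open>Seminorms and norms on spaces of almost-everywhere classes\<close>

text \<open>Non-negativity of a seminorm follows from homogeneity and the triangle inequality.\<close>

definition seminorm_on ::
  "(real^'n) set \<Rightarrow> (real^'n \<Rightarrow> 'v::euclidean_space) set \<Rightarrow> ((real^'n \<Rightarrow> 'v) \<Rightarrow> real) \<Rightarrow> bool" where
  "seminorm_on \<Omega> S p \<longleftrightarrow>
     (\<forall>u\<in>S. \<forall>v\<in>S. (AE x in lebesgue_on \<Omega>. u x = v x) \<longrightarrow> p u = p v) \<and>
     (\<forall>u\<in>S. \<forall>v\<in>S. p (\<lambda>x. u x + v x) \<le> p u + p v) \<and>
     (\<forall>c. \<forall>u\<in>S. p (\<lambda>x. c *\<^sub>R u x) = \<bar>c\<bar> * p u)"

definition norm_on ::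
  "(real^'n) set \<Rightarrow> (real^'n \<Rightarrow> 'v::euclidean_space) set \<Rightarrow> ((real^'n \<Rightarrow> 'v) \<Rightarrow> real) \<Rightarrow> bool" where
  "norm_on \<Omega> S p \<longleftrightarrow> seminorm_on \<Omega> S p \<and>
     (\<forall>u\<in>S. p u = 0 \<longrightarrow> (AE x in lebesgue_on \<Omega>. u x = 0))"

end

(*
  Every kernel element is a polynomial of bounded degree.  By C-ellipticity the symbol has no nonzero
  complex zero, so a Nullstellensatz for the module of the functionals T composed with differential
  operators yields one m with (d_i)^m T = 0 for all i and all T in the kernel.  Then T(phi(. - x)) is
  a polynomial in x of degree < m in each variable; letting phi approach indicators of small cubes,
  the Lebesgue differentiation theorem identifies a function representing T with such a polynomial
  almost everywhere.  Hence the kernel is finite-dimensional and contained in W^kX.  If the seminorm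
  is a norm on it, it controls the X-norm there, and (b) follows by splitting u = (u - r) + r with r
  a nearly optimal kernel element; (b) trivially gives (c), and (c) gives (a) because A r = 0.
*)

theory Submission
  imports Defs "HOL-Computational_Algebra.Fundamental_Theorem_Algebra" "HOL-Library.Function_Algebras"
begin

section \<open>The Nullstellensatz for commuting operators\<close>

text \<open>A distribution T with A T = 0 has no known growth at infinity, so the Fourier transform
  is out of reach and the complex zeros of the symbol have to be exploited algebraically. The module
  is countably spanned over an uncountable field, which replaces the Noetherian theory behind the
  usual Nullstellensatz; all T enter one module at once, and this makes m uniform.

  The domain may have infinitely many components, and polynomials found on each of them need not fit
  together. The translates of test functions therefore run through the whole space, where T lives,
  and the resulting polynomial is compared with the function on the domain only afterwards.

  Kernel elements are identified almost everywhere, whereas bases and independence need genuine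
  functions; representatives that are polynomial on the domain and 0 outside provide them.

  In the splitting u = (u - r) + r, the norm of r is controlled by p(r), and p(r) by p(u) + p(u -
  r). The seminorm axioms give no hold on the last term; here a continuity bound for
  \<open>p\<close> enters. The infimum over r need not be attained, hence the nearly optimal
  r.\<close>

locale commuting_operators = vector_space scale
  for scale :: "complex \<Rightarrow> 'p::ab_group_add \<Rightarrow> 'p" (infixr "*c" 75) +
  fixes X :: "'n::finite \<Rightarrow> 'p \<Rightarrow> 'p"
  assumes X_add: "X i (u + v) = X i u + X i v"
    and X_scale: "X i (a *c u) = a *c X i u"
    and X_commute: "X i (X j u) = X j (X i u)"
begin

definition submodule :: "'p set \<Rightarrow> bool" where
  "submodule S \<longleftrightarrow> subspace S \<and> (\<forall>i. \<forall>u\<in>S. X i u \<in> S)"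

text \<open>The span of all words in the operators, applied to \<open>E\<close>, instead of the
  intersection of all submodules containing \<open>E\<close>: for finite \<open>E\<close> this
  exhibits a countable spanning set, on which the cardinality argument rests.\<close>

definition generated :: "'p set \<Rightarrow> 'p set" where
  "generated E = span {foldr X is e |is e. e \<in> E}"

text \<open>The operator p(\<open>X i\<close>) in Horner form. It makes the space a module over the
  polynomials in one variable, so that a factorisation of \<open>p\<close> factorises the
  operator.\<close>

definition act :: "'n \<Rightarrow> complex poly \<Rightarrow> 'p \<Rightarrow> 'p" where
  "act i p u = fold_coeffs (\<lambda>a v. a *c u + X i v) p 0"

lemma X_0 [simp]: "X i 0 = 0"
  using X_scale[of i 0 0] by simp

lemma X_diff: "X i (u - v) = X i u - X i v"
  using X_add[of i "u - v" v] by (simp add: algebra_simps)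

lemma funpow_X_scale: "(X i ^^ m) (a *c u) = a *c (X i ^^ m) u"
  by (induction m) (auto simp: X_scale)

lemma funpow_X_diff: "(X i ^^ m) (u - v) = (X i ^^ m) u - (X i ^^ m) v"
  by (induction m) (auto simp: X_diff)

lemma X_funpow_X: "X j ((X i ^^ m) u) = (X i ^^ m) (X j u)"
  by (induction m) (auto simp: X_commute)

lemma act_0 [simp]: "act i 0 u = 0"
  by (simp add: act_def)

lemma act_pCons [simp]: "act i (pCons a p) u = a *c u + X i (act i p u)"
  by (cases "a = 0 \<and> p = 0") (auto simp: act_def)

lemma act_add: "act i (p + q) u = act i p u + act i q u"
  by (induction p q rule: poly_induct2) (auto simp: X_add algebra_simps)

lemma act_smult: "act i (smult a p) u = a *c act i p u"
  by (induction p) (auto simp: X_scale algebra_simps)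

lemma act_sum: "act i (\<Sum>c\<in>I. f c) u = (\<Sum>c\<in>I. act i (f c) u)"
  by (induction I rule: infinite_finite_induct) (auto simp: act_add)

lemma act_arg_0 [simp]: "act i p 0 = 0"
  by (induction p) auto

lemma act_arg_add: "act i p (u + v) = act i p u + act i p v"
  by (induction p) (auto simp: X_add algebra_simps)

lemma act_arg_scale: "act i p (a *c u) = a *c act i p u"
  by (induction p) (auto simp: X_scale algebra_simps)

lemma act_arg_diff: "act i p (u - v) = act i p u - act i p v"
  using act_arg_add[of i p "u - v" v] by (simp add: algebra_simps)

lemma act_arg_sum: "act i p (\<Sum>c\<in>I. f c) = (\<Sum>c\<in>I. act i p (f c))"
  by (induction I rule: infinite_finite_induct) (auto simp: act_arg_add)

lemma act_mult: "act i (p * q) u = act i p (act i q u)"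
  by (induction p) (auto simp: act_add act_smult)

lemma submoduleD:
  assumes "submodule S"
  shows "0 \<in> S" "u \<in> S \<Longrightarrow> v \<in> S \<Longrightarrow> u + v \<in> S" "u \<in> S \<Longrightarrow> v \<in> S \<Longrightarrow> u - v \<in> S"
    "u \<in> S \<Longrightarrow> a *c u \<in> S" "u \<in> S \<Longrightarrow> X i u \<in> S" "u \<in> S \<Longrightarrow> (X i ^^ m) u \<in> S"
    "u \<in> S \<Longrightarrow> act i p u \<in> S"
proof -
  have s: "subspace S" and X: "\<And>i u. u \<in> S \<Longrightarrow> X i u \<in> S"
    using assms by (auto simp: submodule_def)
  show "0 \<in> S" "u \<in> S \<Longrightarrow> v \<in> S \<Longrightarrow> u + v \<in> S" "u \<in> S \<Longrightarrow> v \<in> S \<Longrightarrow> u - v \<in> S"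
    "u \<in> S \<Longrightarrow> a *c u \<in> S" "u \<in> S \<Longrightarrow> X i u \<in> S"
    using s X by (auto simp: subspace_add subspace_0 subspace_scale subspace_diff)
  show "u \<in> S \<Longrightarrow> (X i ^^ m) u \<in> S" by (induction m) (use X in auto)
  show "u \<in> S \<Longrightarrow> act i p u \<in> S"
    by (induction p) (use s X in \<open>auto intro!: subspace_add simp: subspace_0 subspace_scale\<close>)
qed

lemma subspace_vimage_X:
  assumes "subspace S" shows "subspace {u. X i u - c *c u \<in> S}"
proof (rule subspaceI)
  show "0 \<in> {u. X i u - c *c u \<in> S}" using assms by (simp add: subspace_0)
next
  fix u v assume "u \<in> {u. X i u - c *c u \<in> S}" "v \<in> {u. X i u - c *c u \<in> S}"
  then have "(X i u - c *c u) + (X i v - c *c v) \<in> S" using assms by (auto intro: subspace_add)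
  moreover have "(X i u - c *c u) + (X i v - c *c v) = X i (u + v) - c *c (u + v)"
    by (simp add: X_add algebra_simps)
  ultimately show "u + v \<in> {u. X i u - c *c u \<in> S}" by simp
next
  fix a u assume "u \<in> {u. X i u - c *c u \<in> S}"
  then have "a *c (X i u - c *c u) \<in> S" using assms by (auto intro: subspace_scale)
  moreover have "a *c (X i u - c *c u) = X i (a *c u) - c *c (a *c u)"
    by (simp add: X_scale algebra_simps)
  ultimately show "a *c u \<in> {u. X i u - c *c u \<in> S}" by simp
qed

text \<open>As the operators commute, \<open>X i\<close> minus a scalar is a module endomorphism,
  and preimages of submodules under it are submodules. Such a preimage is one of the two
  enlargements of a maximal \<open>S\<close> to which maximality is applied later.\<close>

lemma submodule_eigen:
  assumes "submodule S" shows "submodule {u. X i u - c *c u \<in> S}"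
  unfolding submodule_def
proof (intro conjI allI ballI)
  show "subspace {u. X i u - c *c u \<in> S}" using assms subspace_vimage_X by (auto simp: submodule_def)
  fix j u assume "u \<in> {u. X i u - c *c u \<in> S}"
  then have "X j (X i u - c *c u) \<in> S" using submoduleD(5)[OF assms] by auto
  then show "X j u \<in> {u. X i u - c *c u \<in> S}"
    by (simp add: X_diff X_scale X_commute[of j i])
qed

lemma submodule_generated: "submodule (generated E)"
  unfolding submodule_def
proof (intro conjI allI ballI)
  show "subspace (generated E)" by (simp add: generated_def)
  fix i u assume "u \<in> generated E"
  then have u: "u \<in> span {foldr X is e |is e. e \<in> E}" by (simp add: generated_def)
  show "X i u \<in> generated E"
    using u
  proof (induction rule: span_induct_alt)
    case base show ?case using span_zero by (simp add: generated_def)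
  next
    case (step c x y)
    then obtain "is" e where "x = foldr X is e" "e \<in> E" by auto
    then have "X i x = foldr X (i # is) e" by simp
    then have "X i x \<in> generated E" unfolding generated_def using \<open>e \<in> E\<close> by (intro span_base) blast
    then show ?case using step by (simp add: X_add X_scale generated_def span_add span_scale)
  qed
qed

lemma generated_superset: "E \<subseteq> generated E"
proof
  fix e assume "e \<in> E"
  then have "foldr X [] e \<in> generated E" unfolding generated_def by (intro span_base) blast
  then show "e \<in> generated E" by simp
qed

lemma generated_minimal:
  assumes "submodule S" "E \<subseteq> S" shows "generated E \<subseteq> S"
proof -
  have "foldr X is e \<in> S" if "e \<in> E" for "is" e
    by (induction "is") (use assms that submoduleD(5) in auto)
  then show ?thesis unfolding generated_def
    using assms by (intro span_minimal) (auto simp: submodule_def)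
qed

text \<open>Every element of \<open>span B\<close> lies in the span of an initial piece of an
  enumeration of \<open>B\<close>, and an independent set meets each such finite-dimensional span in
  a finite set.\<close>

lemma independent_in_countable_span:
  assumes "countable B" "independent Q" "Q \<subseteq> span B" shows "countable Q"
proof (cases "B = {}")
  case True
  then show ?thesis using assms by (metis countable_subset countable_finite finite.emptyI finite.insertI span_empty)
next
  case False
  define b where "b = from_nat_into B"
  have rb: "B = range b" unfolding b_def using assms(1) False by (simp add: range_from_nat_into)
  have "Q \<subseteq> (\<Union>k. Q \<inter> span (b ` {..<k::nat}))"
  proof
    fix q assume q: "q \<in> Q"
    then have "q \<in> span B" using assms by auto
    then obtain t r where t: "finite t" "t \<subseteq> B" "q = (\<Sum>a\<in>t. r a *c a)" unfolding span_explicit by auto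
    obtain J where J: "finite J" "t = b ` J" using t rb by (metis finite_subset_image)
    obtain k where "J \<subseteq> {..<k}" using J(1) by (metis finite_nat_iff_bounded)
    then have "q \<in> span (b ` {..<k})" unfolding t(3) J(2)
      by (intro span_sum span_scale span_base) auto
    then show "q \<in> (\<Union>k. Q \<inter> span (b ` {..<k::nat}))" using q by auto
  qed
  moreover have "finite (Q \<inter> span (b ` {..<k}))" for k
  proof -
    have "independent (Q \<inter> span (b ` {..<k}))" using assms(2) independent_mono by blast
    then show ?thesis using independent_span_bound[of "b ` {..<k}" "Q \<inter> span (b ` {..<k})"] by simp
  qed
  then have "countable (\<Union>k. Q \<inter> span (b ` {..<k::nat}))" by (intro countable_UN) (auto intro: countable_finite)
  ultimately show ?thesis using countable_subset by blast
qed

text \<open>A basis of \<open>S\<close> stays independent after adding \<open>e\<close>; the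
  functional is prescribed there, as 0 on the basis and 1 at \<open>e\<close>, and extended. It will
  turn congruences modulo a submodule into equations between complex numbers.\<close>

lemma exists_functional:
  assumes "subspace S" "e \<notin> S"
  obtains l :: "'p \<Rightarrow> complex" where "\<And>u v. l (u + v) = l u + l v" "\<And>a u. l (a *c u) = a * l u"
    "\<And>u. u \<in> S \<Longrightarrow> l u = 0" "l e = 1"
proof -
  interpret c: vector_space "(*) :: complex \<Rightarrow> complex \<Rightarrow> complex"
    by unfold_locales (auto simp: algebra_simps)
  interpret vp: vector_space_pair scale "(*) :: complex \<Rightarrow> complex \<Rightarrow> complex" ..
  obtain B where B: "B \<subseteq> S" "independent B" "S \<subseteq> span B"
    using maximal_independent_subset by blast
  have sp: "span B = S" using B assms(1) by (simp add: span_subspace)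
  have "independent (insert e B)" using independent_insertI[OF _ B(2), of e] assms(2) sp by simp
  then obtain l where l: "Vector_Spaces.linear scale (*) l" "\<And>x. x \<in> insert e B \<Longrightarrow> l x = (if x = e then 1 else 0 :: complex)"
    using vp.linear_independent_extend[of "insert e B" "\<lambda>x. if x = e then 1 else 0"] by blast
  have ladd: "\<And>u v. l (u + v) = l u + l v" and lsc: "\<And>a u. l (a *c u) = a * l u"
    using l(1) by (auto simp: vp.linear_add vp.linear_scale)
  have "l u = 0" if "u \<in> S" for u
  proof -
    have "u \<in> span B" using that sp by simp
    then show ?thesis
    proof (induction rule: span_induct_alt)
      case base show ?case using lsc[of 0 0] by simp
    next
      case (step c x y)
      have "e \<notin> B" using sp assms(2) span_base by blast
      then have "l x = 0" using l(2)[of x] step by auto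
      then show ?case using step by (simp add: ladd lsc)
    qed
  qed
  with ladd lsc l(2)[of e] show thesis by (intro that[of l]) auto
qed

lemma chain_Union_submodule:
  assumes "subset.chain {S. submodule S \<and> P S} C" "C \<noteq> {}" shows "submodule (\<Union>C)"
proof -
  have C: "\<And>S. S \<in> C \<Longrightarrow> submodule S" "\<And>S T. S \<in> C \<Longrightarrow> T \<in> C \<Longrightarrow> S \<subseteq> T \<or> T \<subseteq> S"
    using assms by (auto simp: subset_chain_def)
  show ?thesis unfolding submodule_def
  proof (intro conjI subspaceI allI ballI)
    show "0 \<in> \<Union>C" using C assms(2) submoduleD(1) by fastforce
  next
    fix u v assume "u \<in> \<Union>C" "v \<in> \<Union>C"
    then obtain U V where UV: "U \<in> C" "V \<in> C" "u \<in> U" "v \<in> V" by blast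
    then obtain T where "T \<in> C" "u \<in> T" "v \<in> T" using C(2)[OF UV(1,2)] by blast
    then show "u + v \<in> \<Union>C" using submoduleD(2)[OF C(1)] by blast
  next
    fix a u assume "u \<in> \<Union>C"
    then show "a *c u \<in> \<Union>C" using submoduleD(4)[OF C(1)] by blast
  next
    fix i u assume "u \<in> \<Union>C"
    then show "X i u \<in> \<Union>C" using submoduleD(5)[OF C(1)] by blast
  qed
qed

text \<open>Dixmier's argument. Take a submodule \<open>S\<close> maximal among those that contain \<open>S0\<close> and no
  \<open>X j ^^ m ` E\<close>. If \<open>X i\<close> has no eigenvalue modulo \<open>S\<close>, then every \<open>X i - c\<close> is injective
  modulo \<open>S\<close>, and its image contains some \<open>(X j ^^ m) e0\<close>; the preimages, for uncountably
  many \<open>c\<close> and one \<open>m\<close>, would be linearly independent in a space of countable dimension.\<close>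

theorem nilpotent_or_character:
  assumes fin: "finite E" and S0: "submodule S0"
  obtains (nilpotent) m where "\<And>e. e \<in> E \<Longrightarrow> (X j ^^ m) e \<in> S0"
  | (character) c l where "c j \<noteq> 0" "\<And>u v. l (u + v) = l u + l v" "\<And>a u. l (a *c u) = a * l u"
      "\<And>i u. u \<in> generated E \<Longrightarrow> l (X i u) = c i * (l u :: complex)" "\<exists>e\<in>E. l e \<noteq> 0"
      "\<And>u. u \<in> S0 \<Longrightarrow> l u = 0"
proof (cases "\<exists>m. \<forall>e\<in>E. (X j ^^ m) e \<in> S0")
  case True
  then show thesis using nilpotent by blast
next
  case False
  let ?P = "\<lambda>S. S0 \<subseteq> S \<and> (\<forall>m. \<exists>e\<in>E. (X j ^^ m) e \<notin> S)"
  let ?F = "{S. submodule S \<and> ?P S}"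
  have zorn: "\<exists>M\<in>?F. \<forall>S\<in>?F. M \<subseteq> S \<longrightarrow> S = M"
  proof (rule subset_Zorn_nonempty)
    show "?F \<noteq> {}" using False S0 by auto
  next
    fix C assume C: "C \<noteq> {}" "subset.chain ?F C"
    have sub: "submodule (\<Union>C)" using chain_Union_submodule[OF C(2,1)] .
    have C': "\<And>S T. S \<in> C \<Longrightarrow> T \<in> C \<Longrightarrow> S \<subseteq> T \<or> T \<subseteq> S" "\<And>S. S \<in> C \<Longrightarrow> submodule S" "\<And>S. S \<in> C \<Longrightarrow> ?P S"
      using C by (auto simp: subset_chain_def)
    have "\<exists>e\<in>E. (X j ^^ m) e \<notin> \<Union>C" for m
    proof (rule ccontr)
      assume "\<not> (\<exists>e\<in>E. (X j ^^ m) e \<notin> \<Union>C)"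
      \<comment> \<open>A finite set inside the union of a chain lies in one of its members. The
        finiteness of \<open>E\<close> enters here, and again in the countable dimension
        below.\<close>
      then have "(X j ^^ m) ` E \<subseteq> \<Union>C" by auto
      then obtain S where "S \<in> C" "(X j ^^ m) ` E \<subseteq> S"
        using finite_subset_Union_chain[of "(X j ^^ m) ` E" C ?F] C fin by blast
      then show False using C'(3) by blast
    qed
    then show "\<Union>C \<in> ?F" using sub C(1) C'(3) by blast
  qed
  obtain S where SF: "S \<in> ?F" and Smax: "\<forall>T\<in>?F. S \<subseteq> T \<longrightarrow> T = S"
    using zorn by (rule bexE)
  have S: "submodule S" "S0 \<subseteq> S" "\<And>m. \<exists>e\<in>E. (X j ^^ m) e \<notin> S"
    using SF by auto
  have max: "\<exists>m. \<forall>e\<in>E. (X j ^^ m) e \<in> T" if T: "submodule T" "S \<subseteq> T" "T \<noteq> S" for T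
  proof (rule ccontr)
    assume "\<nexists>m. \<forall>e\<in>E. (X j ^^ m) e \<in> T"
    then have "T \<in> ?F" using T S(2) by auto
    then show False using bspec[OF Smax] T by blast
  qed
  \<comment> \<open>Otherwise the preimage of \<open>S\<close> under \<open>X j\<close>, the case of
    eigenvalue 0, would be strictly larger than \<open>S\<close>; some power of \<open>X j\<close>
    would map \<open>E\<close> into it, and the next power would map \<open>E\<close> into
    \<open>S\<close>.\<close>
  have inj_j: "u \<in> S" if "X j u \<in> S" for u
  proof (rule ccontr)
    assume "u \<notin> S"
    then have "{u. X j u - 0 *c u \<in> S} \<noteq> S" using that by auto
    moreover have "S \<subseteq> {u. X j u - 0 *c u \<in> S}" using submoduleD(5)[OF S(1)] by auto
    ultimately obtain m where "\<forall>e\<in>E. (X j ^^ m) e \<in> {u. X j u - 0 *c u \<in> S}"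
      using max[OF submodule_eigen[OF S(1)]] by blast
    then have "\<forall>e\<in>E. (X j ^^ Suc m) e \<in> S" by auto
    then show False using S(3) by blast
  qed
  have inj_jm: "u \<in> S" if "(X j ^^ m) u \<in> S" for u m
    using that by (induction m) (auto dest: inj_j)
  obtain e0 where e0: "e0 \<in> E" "e0 \<notin> S" using S(3)[of 0] by auto
  have eigen: "\<exists>c. \<forall>e\<in>E. X i e - c *c e \<in> S" for i
  proof (rule ccontr)
    assume no: "\<not> (\<exists>c. \<forall>e\<in>E. X i e - c *c e \<in> S)"
    \<comment> \<open>If \<open>X i - c\<close> were not injective modulo \<open>S\<close>,
      maximality would put the image of \<open>E\<close> under some power of \<open>X j\<close> into
      the preimage. Injectivity of \<open>X j\<close> modulo \<open>S\<close> cancels the power, and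
      \<open>c\<close> would be a common eigenvalue on \<open>E\<close> after all.\<close>
    have inj: "u \<in> S" if "X i u - c *c u \<in> S" for u c
    proof (rule ccontr)
      assume "u \<notin> S"
      then have ne: "{u. X i u - c *c u \<in> S} \<noteq> S" using that by auto
      have sub: "S \<subseteq> {u. X i u - c *c u \<in> S}" using submoduleD[OF S(1)] by auto
      obtain m where m: "\<forall>e\<in>E. (X j ^^ m) e \<in> {u. X i u - c *c u \<in> S}"
        using max[OF submodule_eigen[OF S(1)] sub ne] by blast
      have "X i e - c *c e \<in> S" if "e \<in> E" for e
      proof (rule inj_jm[of m])
        show "(X j ^^ m) (X i e - c *c e) \<in> S"
          using bspec[OF m that] by (simp add: funpow_X_diff funpow_X_scale X_funpow_X)
      qed
      then show False using no by blast
    qed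
    \<comment> \<open>Over the complex numbers a nonzero polynomial splits into linear factors, each
      of which is injective modulo \<open>S\<close>.\<close>
    have act_inj: "u \<in> S" if "h \<noteq> 0" "act i h u \<in> S" for h u
      using that
    proof (induction "degree h" arbitrary: h u)
      case 0
      then obtain a where "h = [:a:]" by (metis degree_eq_zeroE)
      with 0 have "a \<noteq> 0" "a *c u \<in> S" by auto
      then have "inverse a *c (a *c u) \<in> S" using submoduleD(4)[OF S(1)] by blast
      then show ?case using \<open>a \<noteq> 0\<close> by simp
    next
      case (Suc d)
      have "\<not> constant (poly h)" using Suc.hyps(2) by (simp add: constant_degree)
      then obtain z where "poly h z = 0" using fundamental_theorem_of_algebra by blast
      then obtain g where g: "h = [:-z, 1:] * g" by (metis poly_eq_0_iff_dvd dvdE)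
      have "g \<noteq> 0" using g Suc.prems by auto
      then have "degree g = d" using Suc.hyps(2) unfolding g by (subst (asm) degree_mult_eq) auto
      moreover have "act i g u \<in> S"
      proof (rule inj[of _ z])
        show "X i (act i g u) - z *c act i g u \<in> S"
          using Suc.prems(2) unfolding g act_mult by (simp add: algebra_simps)
      qed
      ultimately show ?case using Suc.hyps(1) \<open>g \<noteq> 0\<close> by blast
    qed
    let ?M = "generated E"
    \<comment> \<open>The other enlargement of \<open>S\<close>: the image of
      \<open>generated E\<close> under \<open>X i - c\<close>, plus \<open>S\<close>. It is strictly
      larger because \<open>c\<close> is not a common eigenvalue on \<open>E\<close>, so it contains
      some power of \<open>X j\<close> applied to \<open>e0\<close>.\<close>
    have ex: "\<exists>m q. q \<in> ?M \<and> X i q - c *c q - (X j ^^ m) e0 \<in> S" for c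
    proof -
      let ?T = "{X i q - c *c q + s |q s. q \<in> ?M \<and> s \<in> S}"
      note M = submoduleD[OF submodule_generated[of E]] and D = submoduleD[OF S(1)]
      have "submodule ?T" unfolding submodule_def
      proof (intro conjI subspaceI allI ballI)
        have "0 = X i 0 - c *c 0 + 0" by simp
        then show "0 \<in> ?T" using M(1) D(1) by blast
      next
        fix x y assume "x \<in> ?T" "y \<in> ?T"
        then obtain q s q' s' where *: "x = X i q - c *c q + s" "y = X i q' - c *c q' + s'"
          "q \<in> ?M" "q' \<in> ?M" "s \<in> S" "s' \<in> S" by blast
        have "x + y = X i (q + q') - c *c (q + q') + (s + s')"
          unfolding *(1,2) by (simp add: X_add scale_right_distrib)
        then show "x + y \<in> ?T" using * M(2) D(2) by blast
      next
        fix a x assume "x \<in> ?T"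
        then obtain q s where *: "x = X i q - c *c q + s" "q \<in> ?M" "s \<in> S" by blast
        have "a *c x = X i (a *c q) - c *c (a *c q) + (a *c s)"
          unfolding *(1) by (simp add: X_scale scale_right_distrib scale_right_diff_distrib mult.commute)
        then show "a *c x \<in> ?T" using * M(4) D(4) by blast
      next
        fix i' x assume "x \<in> ?T"
        then obtain q s where *: "x = X i q - c *c q + s" "q \<in> ?M" "s \<in> S" by blast
        have "X i' x = X i (X i' q) - c *c (X i' q) + X i' s"
          unfolding *(1) by (simp add: X_add X_diff X_scale X_commute[of i' i])
        then show "X i' x \<in> ?T" using * M(5) D(5) by blast
      qed
      moreover have "S \<subseteq> ?T"
      proof
        fix s assume "s \<in> S"
        moreover have "s = X i 0 - c *c 0 + s" by simp
        ultimately show "s \<in> ?T" using M(1) by blast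
      qed
      moreover obtain e where e: "e \<in> E" "X i e - c *c e \<notin> S" using no by blast
      have "X i e - c *c e + 0 \<in> ?T" using e(1) generated_superset D(1) by blast
      then have "?T \<noteq> S" using e(2) by auto
      ultimately obtain m where "(X j ^^ m) e0 \<in> ?T" using max[of ?T] e0 by blast
      then obtain q s where "(X j ^^ m) e0 = X i q - c *c q + s" "q \<in> ?M" "s \<in> S" by blast
      then have "q \<in> ?M \<and> X i q - c *c q - (X j ^^ m) e0 \<in> S" using D(4)[of s "-1"] by simp
      then show ?thesis by blast
    qed
    then obtain m q where q: "\<And>c. q c \<in> ?M" "\<And>c. X i (q c) - c *c q c - (X j ^^ m c) e0 \<in> S"
      by metis
    \<comment> \<open>The exponent \<open>m c\<close> takes only countably many values, so one value
      \<open>k\<close> is shared by uncountably many \<open>c\<close>; all their \<open>q c\<close>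
      are then preimages of the same vector \<open>?x\<close>.\<close>
    have "uncountable (UNIV :: complex set)"
      using uncountable_UNIV_complex by blast
    moreover have "(UNIV :: complex set) = (\<Union>k. {c. m c = k})" by auto
    ultimately obtain k where k: "uncountable {c. m c = k}"
      by (metis countable_UN countableI_type)
    let ?C = "{c. m c = k}"
    let ?x = "(X j ^^ k) e0"
    have x: "?x \<notin> S" using inj_jm e0 by blast
    have q2: "X i (q c) - c *c q c - ?x \<in> S" if "c \<in> ?C" for c using q(2)[of c] that by auto
    \<comment> \<open>Equal preimages for two different scalars would, after subtraction of the two
      congruences, put \<open>q c\<close> and with it \<open>?x\<close> into
      \<open>S\<close>.\<close>
    have injq: "inj_on q ?C"
    proof (rule inj_onI, rule ccontr)
      fix c c' assume *: "c \<in> ?C" "c' \<in> ?C" "q c = q c'" "c \<noteq> c'"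
      have "(X i (q c) - c *c q c - ?x) - (X i (q c') - c' *c q c' - ?x) \<in> S"
        using q2 * submoduleD(3)[OF S(1)] by blast
      then have "(c' - c) *c q c \<in> S" using *(3) by (simp add: algebra_simps)
      then have "inverse (c' - c) *c ((c' - c) *c q c) \<in> S" using submoduleD(4)[OF S(1)] by blast
      then have "q c \<in> S" using *(4) by simp
      then have "X i (q c) - c *c q c \<in> S" using submoduleD(3,4,5)[OF S(1)] by simp
      then have "(X i (q c) - c *c q c) - (X i (q c) - c *c q c - ?x) \<in> S"
        using q2[OF *(1)] submoduleD(3)[OF S(1)] by blast
      then show False using x by simp
    qed
    have "countable {foldr X is e |is e. e \<in> E}"
    proof -
      have "{foldr X is e |is e. e \<in> E} = (\<lambda>(is, e). foldr X is e) ` (UNIV \<times> E)" by auto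
      then show ?thesis using fin by (simp add: countable_finite)
    qed
    then have "dependent (q ` ?C)"
      using independent_in_countable_span[of _ "q ` ?C"] q(1) k injq countable_image_inj_on
      unfolding generated_def by blast
    then obtain t r where t: "finite t" "t \<subseteq> q ` ?C" "(\<Sum>v\<in>t. r v *c v) = 0" "\<exists>v\<in>t. r v \<noteq> 0"
      unfolding dependent_explicit by blast
    obtain D where D: "finite D" "D \<subseteq> ?C" "t = q ` D"
      using t(1,2) by (metis finite_subset_image)
    have injD: "inj_on q D" using injq D(2) inj_on_subset by blast
    define a where "a c = r (q c)" for c
    have a0: "(\<Sum>c\<in>D. a c *c q c) = 0"
      using t(3) unfolding D(3) sum.reindex[OF injD] by (simp add: a_def)
    obtain c0 where c0: "c0 \<in> D" "a c0 \<noteq> 0" using t(4) D(3) by (auto simp: a_def)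
    \<comment> \<open>Apply the product of all \<open>X i - c\<close> over \<open>D\<close> to the
      dependence relation. Since \<open>X i - c\<close> sends \<open>q c\<close> to
      \<open>?x\<close> modulo \<open>S\<close>, the result says that h(\<open>X i\<close>) maps
      \<open>?x\<close> into \<open>S\<close>. The polynomial \<open>h\<close> has the shape of a
      Lagrange interpolation sum: at \<open>c0\<close> only the summand of \<open>c0\<close>
      survives, and it is not 0.\<close>
    define P where "P I = (\<Prod>c\<in>I. [:-c, 1::complex:])" for I
    define h where "h = (\<Sum>c\<in>D. smult (a c) (P (D - {c})))"
    have Pz: "poly (P (D - {c})) c0 = 0" if "c \<in> D - {c0}" for c
      unfolding P_def poly_prod using that c0(1) D(1) by (intro prod_zero) auto
    have "poly h c0 = a c0 * poly (P (D - {c0})) c0"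
      unfolding h_def poly_sum using Pz c0(1) D(1) by (simp add: sum.remove[of D c0])
    also have "\<dots> \<noteq> 0" using c0 D(1) by (auto simp: P_def poly_prod)
    finally have "h \<noteq> 0" by auto
    have "act i h ?x \<in> S"
    proof -
      have "0 = act i (P D) (\<Sum>c\<in>D. a c *c q c)" by (simp add: a0)
      also have "\<dots> = (\<Sum>c\<in>D. a c *c act i (P D) (q c))"
        by (simp add: act_arg_sum act_arg_scale)
      also have "\<dots> = (\<Sum>c\<in>D. a c *c act i (P (D - {c})) (X i (q c) - c *c q c))"
      proof (rule sum.cong)
        fix c assume "c \<in> D"
        then have "P D = P (D - {c}) * [:-c, 1:]"
          using D(1) by (simp add: P_def prod.remove[of D c] mult.commute)
        then show "a c *c act i (P D) (q c) = a c *c act i (P (D - {c})) (X i (q c) - c *c q c)"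
          by (simp only: act_mult) simp
      qed simp
      finally have z: "(\<Sum>c\<in>D. a c *c act i (P (D - {c})) (X i (q c) - c *c q c)) = 0" ..
      have "act i h ?x = (\<Sum>c\<in>D. a c *c act i (P (D - {c})) ?x)"
        by (simp add: h_def act_sum act_smult)
      also have "\<dots> = - (\<Sum>c\<in>D. a c *c act i (P (D - {c})) (X i (q c) - c *c q c - ?x))"
        using z by (simp add: act_arg_diff[of _ _ _ ?x] scale_right_diff_distrib sum_subtractf)
      also have "\<dots> = -1 *c (\<Sum>c\<in>D. a c *c act i (P (D - {c})) (X i (q c) - c *c q c - ?x))" by simp
      also have "\<dots> \<in> S"
      proof -
        have sub: "subspace S" using S(1) by (simp add: submodule_def)
        show ?thesis
          using q2 D(2) submoduleD(4,7)[OF S(1)]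
          by (intro submoduleD(4)[OF S(1)] subspace_sum[OF sub]) blast
      qed
      finally show ?thesis .
    qed
    then show False using act_inj[OF \<open>h \<noteq> 0\<close>] x by blast
  qed
  then obtain c where c: "\<And>i e. e \<in> E \<Longrightarrow> X i e - c i *c e \<in> S" by metis
  have c2: "X i u - c i *c u \<in> S" if "u \<in> generated E" for i u
    using generated_minimal[OF submodule_eigen[OF S(1)], of E i "c i"] c that by blast
  have "c j \<noteq> 0"
  proof
    assume "c j = 0"
    then have "X j e0 \<in> S" using c[OF e0(1), of j] by simp
    then show False using inj_j e0 by blast
  qed
  have sub: "subspace S" using S(1) by (simp add: submodule_def)
  \<comment> \<open>As \<open>l\<close> vanishes on \<open>S\<close>, the eigenvalue relations
    modulo \<open>S\<close> become the exact relations required of a character; \<open>e0\<close>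
    outside \<open>S\<close> keeps \<open>l\<close> from vanishing on \<open>E\<close>.\<close>
  obtain l where l: "\<And>u v. l (u + v) = l u + l v" "\<And>a u. l (a *c u) = a * l u"
    "\<And>u. u \<in> S \<Longrightarrow> l u = (0::complex)" "l e0 = 1"
    using exists_functional[OF sub e0(2)] by blast
  have leig: "l (X i u) = c i * l u" if "u \<in> generated E" for i u
  proof -
    have "l (X i u) = l ((X i u - c i *c u) + c i *c u)" by simp
    also have "\<dots> = c i * l u" unfolding l(1,2) using l(3)[OF c2[OF that]] by simp
    finally show ?thesis .
  qed
  have "\<exists>e\<in>E. l e \<noteq> 0" using e0(1) l(4) by (intro bexI[of _ e0]) auto
  with \<open>c j \<noteq> 0\<close> l(1,2) leig show thesis
    by (rule character) (use l(3) S(2) in auto)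
qed

end

section \<open>Smooth functions and test functions\<close>

lemma partialI: "(\<phi> has_derivative D) (at x) \<Longrightarrow> partial i \<phi> x = D (axis i 1)"
  using frechet_derivative_at[of \<phi> D x] by (simp add: partial_def)

lemma partial_DERIV:
  assumes "\<phi> differentiable (at (x + t *\<^sub>R axis i 1))"
  shows "((\<lambda>s. \<phi> (x + s *\<^sub>R axis i 1)) has_real_derivative partial i \<phi> (x + t *\<^sub>R axis i 1)) (at t)"
proof -
  have d: "(\<phi> has_derivative frechet_derivative \<phi> (at (x + t *\<^sub>R axis i 1))) (at (x + t *\<^sub>R axis i 1))"
    using assms by (simp add: frechet_derivative_works)
  have "((\<lambda>s. x + s *\<^sub>R axis i 1) has_derivative (\<lambda>s. s *\<^sub>R axis i 1)) (at t)"
    by (auto intro!: derivative_eq_intros)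
  from diff_chain_at[OF this d] have
    "((\<lambda>s. \<phi> (x + s *\<^sub>R axis i 1)) has_derivative (\<lambda>s. frechet_derivative \<phi> (at (x + t *\<^sub>R axis i 1)) (s *\<^sub>R axis i 1))) (at t)"
    by (simp add: o_def)
  moreover have "linear (frechet_derivative \<phi> (at (x + t *\<^sub>R axis i 1)))"
    using d has_derivative_linear by blast
  ultimately show ?thesis
    by (simp add: has_field_derivative_def partial_def linear_cmul mult.commute[of "frechet_derivative _ _ _"])
      (simp add: mult_commute_abs)
qed

lemma partial_add:
  assumes "f differentiable_on UNIV" "g differentiable_on UNIV"
  shows "partial i (\<lambda>x. f x + g x) = (\<lambda>x. partial i f x + partial i g x)"
proof
  fix x
  have "(f has_derivative frechet_derivative f (at x)) (at x)" "(g has_derivative frechet_derivative g (at x)) (at x)"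
    using assms by (auto simp: frechet_derivative_works[symmetric] differentiable_on_def)
  from has_derivative_add[OF this] show "partial i (\<lambda>x. f x + g x) x = partial i f x + partial i g x"
    by (subst partialI) (auto simp: partial_def)
qed

lemma partial_mult:
  assumes "f differentiable_on UNIV" "g differentiable_on UNIV"
  shows "partial i (\<lambda>x. f x * g x) = (\<lambda>x. f x * partial i g x + partial i f x * g x)"
proof
  fix x
  have "(f has_derivative frechet_derivative f (at x)) (at x)" "(g has_derivative frechet_derivative g (at x)) (at x)"
    using assms by (auto simp: frechet_derivative_works[symmetric] differentiable_on_def)
  from has_derivative_mult[OF this] show "partial i (\<lambda>x. f x * g x) x = f x * partial i g x + partial i f x * g x"
    by (subst partialI) (auto simp: partial_def)
qed

lemma partial_const: "partial i (\<lambda>x. c) = (\<lambda>x. 0)"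
  by (rule ext, subst partialI[OF has_derivative_const]) simp

lemma partial_cmult:
  assumes "f differentiable_on UNIV"
  shows "partial i (\<lambda>x. c * f x) = (\<lambda>x. c * partial i f x)"
  using partial_mult[of "\<lambda>x. c" f i] assms by (simp add: partial_const)

lemma partial_translate:
  assumes "f differentiable_on UNIV"
  shows "partial i (\<lambda>x. f (x - a)) = (\<lambda>x. partial i f (x - a))"
proof
  fix x
  have "(f has_derivative frechet_derivative f (at (x - a))) (at (x - a))"
    using assms by (auto simp: frechet_derivative_works[symmetric] differentiable_on_def)
  moreover have "((\<lambda>x. x - a) has_derivative (\<lambda>h. h)) (at x)" by (auto intro!: derivative_eq_intros)
  ultimately have "((\<lambda>x. f (x - a)) has_derivative frechet_derivative f (at (x - a))) (at x)"
    using diff_chain_at[of "\<lambda>x. x - a" "\<lambda>h. h" x f] by (simp add: o_def)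
  then show "partial i (\<lambda>x. f (x - a)) x = partial i f (x - a)"
    by (subst partialI) (auto simp: partial_def)
qed

text \<open>\<open>smooth_fun\<close> speaks about all iterated partial derivatives. A family of
  differentiable functions closed under \<open>partial\<close> avoids any formula for them; the
  basic closure properties below amount to the choice of such a family.\<close>

lemma smooth_coinduct:
  assumes "\<phi> \<in> F" "\<And>f. f \<in> F \<Longrightarrow> f differentiable_on UNIV" "\<And>f i. f \<in> F \<Longrightarrow> partial i f \<in> F"
  shows "smooth_fun \<phi>"
proof -
  have "foldr partial is \<phi> \<in> F" for "is"
    by (induction "is") (use assms in auto)
  then show ?thesis using assms(2) by (auto simp: smooth_fun_def)
qed

lemma smooth_differentiable: "smooth_fun \<phi> \<Longrightarrow> \<phi> differentiable_on UNIV"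
  unfolding smooth_fun_def by (metis foldr.simps(1) id_apply)

lemma smooth_partial: "smooth_fun \<phi> \<Longrightarrow> smooth_fun (partial i \<phi>)"
  unfolding smooth_fun_def
proof
  fix "is" assume "\<forall>is. foldr partial is \<phi> differentiable_on UNIV"
  then have "foldr partial (is @ [i]) \<phi> differentiable_on UNIV" by blast
  then show "foldr partial is (partial i \<phi>) differentiable_on UNIV" by simp
qed

lemma smooth_foldr_partial: "smooth_fun \<phi> \<Longrightarrow> smooth_fun (foldr partial is \<phi>)"
  by (induction "is") (auto intro: smooth_partial)

lemma smooth_continuous: "smooth_fun \<phi> \<Longrightarrow> continuous_on S \<phi>"
  using smooth_differentiable differentiable_imp_continuous_on continuous_on_subset by blast

lemma smooth_DERIV:
  assumes "smooth_fun \<phi>"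
  shows "((\<lambda>s. \<phi> (x + s *\<^sub>R axis i 1)) has_real_derivative partial i \<phi> (x + t *\<^sub>R axis i 1)) (at t)"
  using smooth_differentiable[OF assms] by (intro partial_DERIV) (auto simp: differentiable_on_def)

lemma smooth_const: "smooth_fun (\<lambda>x. c)"
  by (rule smooth_coinduct[of _ "range (\<lambda>c x. c)"]) (auto simp: partial_const)

lemma smooth_coord: "smooth_fun (\<lambda>x. x $ j)"
proof (rule smooth_coinduct[of _ "insert (\<lambda>x. x $ j) (range (\<lambda>c x. c))"])
  have d: "((\<lambda>x::real^'a. x $ j) has_derivative (\<lambda>h. h $ j)) (at x)" for x
    by (rule bounded_linear_imp_has_derivative) (rule bounded_linear_vec_nth)
  fix f :: "real^'a \<Rightarrow> real" and i assume f: "f \<in> insert (\<lambda>x. x $ j) (range (\<lambda>c x. c))"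
  show "f differentiable_on UNIV"
    using f d by (auto simp: differentiable_on_def differentiable_def intro: has_derivative_const)
  have "partial i (\<lambda>x::real^'a. x $ j) = (\<lambda>x. axis i 1 $ j)"
    by (rule ext, subst partialI[OF d]) simp
  then show "partial i f \<in> insert (\<lambda>x. x $ j) (range (\<lambda>c x. c))"
    using f by (auto simp: partial_const)
qed auto

lemma smooth_add: "smooth_fun f \<Longrightarrow> smooth_fun g \<Longrightarrow> smooth_fun (\<lambda>x. f x + g x)"
proof (rule smooth_coinduct[of _ "{\<lambda>x. f x + g x |f g. smooth_fun f \<and> smooth_fun g}"])
  fix h :: "real^'a \<Rightarrow> real" and i
  assume h: "h \<in> {\<lambda>x. f x + g x |f g. smooth_fun f \<and> smooth_fun g}"
  then obtain f g where fg: "h = (\<lambda>x. f x + g x)" "smooth_fun f" "smooth_fun g" by blast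
  note d = smooth_differentiable[OF fg(2)] smooth_differentiable[OF fg(3)]
  show "h differentiable_on UNIV" unfolding fg(1) using d by auto
  show "partial i h \<in> {\<lambda>x. f x + g x |f g. smooth_fun f \<and> smooth_fun g}"
    unfolding fg(1) partial_add[OF d] using fg smooth_partial by blast
qed blast

text \<open>Leibniz' rule turns a product into a sum of two products, so products alone are not
  closed under \<open>partial\<close>; sums have to be included.\<close>

inductive_set prod_algebra :: "(real^'n \<Rightarrow> real) set" where
  mult: "smooth_fun f \<Longrightarrow> smooth_fun g \<Longrightarrow> (\<lambda>x. f x * g x) \<in> prod_algebra"
| add: "f \<in> prod_algebra \<Longrightarrow> g \<in> prod_algebra \<Longrightarrow> (\<lambda>x. f x + g x) \<in> prod_algebra"

lemma smooth_mult:
  fixes f g :: "real^'n \<Rightarrow> real"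
  assumes "smooth_fun f" "smooth_fun g" shows "smooth_fun (\<lambda>x. f x * g x)"
proof (rule smooth_coinduct[of _ prod_algebra])
  show "(\<lambda>x. f x * g x) \<in> prod_algebra" using assms by (rule prod_algebra.mult)
  fix h :: "real^'n \<Rightarrow> real"
  assume h: "h \<in> prod_algebra"
  show d: "h differentiable_on UNIV"
    using h by induction (auto dest!: smooth_differentiable simp: differentiable_on_def intro: differentiable_mult)
  fix i
  have "h differentiable_on UNIV \<and> partial i h \<in> prod_algebra"
    using h
  proof induction
    case (mult f g)
    note d = smooth_differentiable[OF mult(1)] smooth_differentiable[OF mult(2)]
    show ?case unfolding partial_mult[OF d]
      using d by (auto intro!: prod_algebra.intros mult smooth_partial)
  next
    case (add f g)
    then show ?case using partial_add[of f g i] by (auto intro: prod_algebra.add)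
  qed
  then show "partial i h \<in> prod_algebra" by blast
qed

lemma smooth_cmult: "smooth_fun f \<Longrightarrow> smooth_fun (\<lambda>x. c * f x)"
  by (rule smooth_mult[OF smooth_const])

lemma smooth_prod: "(\<And>i. i \<in> I \<Longrightarrow> smooth_fun (f i)) \<Longrightarrow> smooth_fun (\<lambda>x. \<Prod>i\<in>I. f i x)"
  by (induction I rule: infinite_finite_induct) (auto intro: smooth_const smooth_mult)

lemma smooth_power: "smooth_fun f \<Longrightarrow> smooth_fun (\<lambda>x. f x ^ m)"
  by (induction m) (auto intro: smooth_const smooth_mult)

lemma smooth_translate: "smooth_fun f \<Longrightarrow> smooth_fun (\<lambda>x. f (x - a))"
proof (rule smooth_coinduct[of _ "{\<lambda>x. f (x - a) |f. smooth_fun f}"])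
  fix h :: "real^'a \<Rightarrow> real" and i
  assume "h \<in> {\<lambda>x. f (x - a) |f. smooth_fun f}"
  then obtain f where f: "h = (\<lambda>x. f (x - a))" "smooth_fun f" by blast
  have d: "f differentiable_on UNIV" using f(2) by (rule smooth_differentiable)
  show "h differentiable_on UNIV" unfolding f(1)
    by (rule differentiable_on_compose[of "\<lambda>x. x - a" UNIV f])
      (use d in \<open>auto intro: differentiable_on_subset\<close>)
  show "partial i h \<in> {\<lambda>x. f (x - a) |f. smooth_fun f}"
    unfolding f(1) partial_translate[OF d] using f smooth_partial by blast
qed blast

lemma foldr_partial_translate:
  "smooth_fun f \<Longrightarrow> foldr partial is (\<lambda>x. f (x - a)) = (\<lambda>x. foldr partial is f (x - a))"
  by (induction "is") (auto simp: partial_translate smooth_differentiable smooth_foldr_partial)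

lemma foldr_partial_cmult:
  "smooth_fun f \<Longrightarrow> foldr partial is (\<lambda>x. c * f x) = (\<lambda>x. c * foldr partial is f x)"
  by (induction "is") (auto simp: partial_cmult smooth_differentiable smooth_foldr_partial)

lemma foldr_partial_add:
  "smooth_fun f \<Longrightarrow> smooth_fun g \<Longrightarrow>
    foldr partial is (\<lambda>x. f x + g x) = (\<lambda>x. foldr partial is f x + foldr partial is g x)"
  by (induction "is") (auto simp: partial_add smooth_differentiable smooth_foldr_partial)

text \<open>Both sides are the limit of the same second difference quotient.\<close>

lemma partial_commute:
  fixes \<phi> :: "real^'n \<Rightarrow> real"
  assumes "smooth_fun \<phi>"
  shows "partial i (partial j \<phi>) = partial j (partial i \<phi>)"
proof
  fix x :: "real^'n"
  let ?e = "\<lambda>i. axis i 1 :: real^'n"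
  define \<Delta> where "\<Delta> s = \<phi> (x + s *\<^sub>R ?e i + s *\<^sub>R ?e j) - \<phi> (x + s *\<^sub>R ?e i) - \<phi> (x + s *\<^sub>R ?e j) + \<phi> x" for s
  \<comment> \<open>The directions \<open>i\<close> and \<open>j\<close> are quantified anew, and
    the formula for \<open>\<Delta>\<close> becomes a premise. As the second difference is symmetric
    in the two directions, the claim can be used in both orders; it is the mean value theorem,
    applied once in each direction.\<close>
  have key: "\<exists>\<sigma> \<tau>. 0 < \<sigma> \<and> \<sigma> < s \<and> 0 < \<tau> \<and> \<tau> < s \<and>
      \<Delta> s = s * s * partial j (partial i \<phi>) (x + \<sigma> *\<^sub>R ?e i + \<tau> *\<^sub>R ?e j)"
    if "s > 0" and \<Delta>: "\<And>s. \<Delta> s = \<phi> (x + s *\<^sub>R ?e i + s *\<^sub>R ?e j) - \<phi> (x + s *\<^sub>R ?e i) - \<phi> (x + s *\<^sub>R ?e j) + \<phi> x"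
    for s i j
  proof -
    let ?g = "\<lambda>r. \<phi> ((x + s *\<^sub>R ?e j) + r *\<^sub>R ?e i) - \<phi> (x + r *\<^sub>R ?e i)"
    let ?g' = "\<lambda>r. partial i \<phi> ((x + s *\<^sub>R ?e j) + r *\<^sub>R ?e i) - partial i \<phi> (x + r *\<^sub>R ?e i)"
    have "(?g has_real_derivative ?g' r) (at r)" for r
      by (intro DERIV_diff smooth_DERIV assms)
    from MVT2[of 0 s ?g ?g', OF that(1) this] obtain \<sigma> where
      \<sigma>: "0 < \<sigma>" "\<sigma> < s" "?g s - ?g 0 = s * ?g' \<sigma>" by auto
    let ?k = "\<lambda>r. partial i \<phi> ((x + \<sigma> *\<^sub>R ?e i) + r *\<^sub>R ?e j)"
    have "(?k has_real_derivative partial j (partial i \<phi>) ((x + \<sigma> *\<^sub>R ?e i) + r *\<^sub>R ?e j)) (at r)" for r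
      by (intro smooth_DERIV smooth_partial assms)
    from MVT2[of 0 s ?k, OF that(1) this] obtain \<tau> where
      \<tau>: "0 < \<tau>" "\<tau> < s" "?k s - ?k 0 = s * partial j (partial i \<phi>) ((x + \<sigma> *\<^sub>R ?e i) + \<tau> *\<^sub>R ?e j)"
      by auto
    have "\<Delta> s = ?g s - ?g 0" unfolding \<Delta> by (simp add: algebra_simps)
    also have "\<dots> = s * (?k s - ?k 0)" unfolding \<sigma>(3) by (simp add: algebra_simps)
    also have "\<dots> = s * s * partial j (partial i \<phi>) (x + \<sigma> *\<^sub>R ?e i + \<tau> *\<^sub>R ?e j)"
      unfolding \<tau>(3) by simp
    finally show ?thesis using \<sigma> \<tau> by blast
  qed
  have lim: "(\<lambda>n. \<Delta> (1 / Suc n) / (1 / Suc n)\<^sup>2) \<longlonglongrightarrow> partial j (partial i \<phi>) x"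
    if \<Delta>: "\<And>s. \<Delta> s = \<phi> (x + s *\<^sub>R ?e i + s *\<^sub>R ?e j) - \<phi> (x + s *\<^sub>R ?e i) - \<phi> (x + s *\<^sub>R ?e j) + \<phi> x" for i j
  proof -
    have "\<forall>n. \<exists>\<sigma> \<tau>. 0 < \<sigma> \<and> \<sigma> < 1 / Suc n \<and> 0 < \<tau> \<and> \<tau> < 1 / Suc n \<and>
      \<Delta> (1 / Suc n) = (1 / Suc n) * (1 / Suc n) * partial j (partial i \<phi>) (x + \<sigma> *\<^sub>R ?e i + \<tau> *\<^sub>R ?e j)"
      by (rule allI, rule key[OF _ \<Delta>]) simp
    then obtain \<sigma> \<tau> where *: "\<And>n. 0 < \<sigma> n" "\<And>n. \<sigma> n < 1 / Suc n" "\<And>n. 0 < \<tau> n" "\<And>n. \<tau> n < 1 / Suc n"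
      "\<And>n. \<Delta> (1 / Suc n) = (1 / Suc n) * (1 / Suc n) * partial j (partial i \<phi>) (x + \<sigma> n *\<^sub>R ?e i + \<tau> n *\<^sub>R ?e j)"
      by metis
    have z: "(\<lambda>n. 1 / real (Suc n)) \<longlonglongrightarrow> 0" using LIMSEQ_Suc[OF lim_1_over_n] .
    have "\<sigma> \<longlonglongrightarrow> 0" by (rule tendsto_sandwich[OF _ _ tendsto_const z]) (use * in \<open>auto intro!: always_eventually less_imp_le\<close>)
    moreover have "\<tau> \<longlonglongrightarrow> 0" by (rule tendsto_sandwich[OF _ _ tendsto_const z]) (use * in \<open>auto intro!: always_eventually less_imp_le\<close>)
    ultimately have "(\<lambda>n. x + \<sigma> n *\<^sub>R ?e i + \<tau> n *\<^sub>R ?e j) \<longlonglongrightarrow> x + 0 *\<^sub>R ?e i + 0 *\<^sub>R ?e j"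
      by (intro tendsto_intros)
    then have "(\<lambda>n. x + \<sigma> n *\<^sub>R ?e i + \<tau> n *\<^sub>R ?e j) \<longlonglongrightarrow> x" by simp
    moreover have "isCont (partial j (partial i \<phi>)) x"
      using smooth_continuous[OF smooth_partial[OF smooth_partial[OF assms]], of UNIV]
      by (simp add: continuous_on_eq_continuous_at)
    ultimately have "(\<lambda>n. partial j (partial i \<phi>) (x + \<sigma> n *\<^sub>R ?e i + \<tau> n *\<^sub>R ?e j)) \<longlonglongrightarrow> partial j (partial i \<phi>) x"
      by (rule isCont_tendsto_compose[rotated])
    moreover have "partial j (partial i \<phi>) (x + \<sigma> n *\<^sub>R ?e i + \<tau> n *\<^sub>R ?e j) = \<Delta> (1 / Suc n) / (1 / Suc n)\<^sup>2" for n
      unfolding *(5) by (simp add: power2_eq_square del: of_nat_Suc)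
    ultimately show ?thesis by simp
  qed
  have 1: "(\<lambda>n. \<Delta> (1 / Suc n) / (1 / Suc n)\<^sup>2) \<longlonglongrightarrow> partial j (partial i \<phi>) x"
    by (rule lim) (simp add: \<Delta>_def)
  have 2: "(\<lambda>n. \<Delta> (1 / Suc n) / (1 / Suc n)\<^sup>2) \<longlonglongrightarrow> partial i (partial j \<phi>) x"
    by (rule lim) (simp add: \<Delta>_def algebra_simps)
  show "partial i (partial j \<phi>) x = partial j (partial i \<phi>) x"
    using LIMSEQ_unique[OF 2 1] .
qed

lemma foldr_partial_commute:
  "smooth_fun \<phi> \<Longrightarrow> foldr partial is (partial i \<phi>) = partial i (foldr partial is \<phi>)"
  by (induction "is") (auto simp: partial_commute smooth_foldr_partial)

section \<open>Multi-indices as lists of coordinates\<close>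

definition mi_list :: "('n::finite \<Rightarrow> nat) \<Rightarrow> 'n list" where
  "mi_list \<alpha> = concat (map (\<lambda>i. replicate (\<alpha> i) i) coord_list)"

lemma coord_list: "distinct (coord_list :: 'n::finite list)" "set (coord_list :: 'n list) = UNIV"
proof -
  have "\<exists>is::'n list. distinct is \<and> set is = UNIV" using finite_distinct_list[OF finite[of UNIV]] by blast
  then have "distinct (coord_list :: 'n list) \<and> set (coord_list :: 'n list) = UNIV"
    unfolding coord_list_def by (rule someI_ex)
  then show "distinct (coord_list :: 'n list)" "set (coord_list :: 'n list) = UNIV" by auto
qed

lemma mi_partial_foldr: "mi_partial \<alpha> \<phi> = foldr partial (mi_list \<alpha>) \<phi>"
proof -
  have r: "foldr partial (replicate k i) \<psi> = (partial i ^^ k) \<psi>" for k i and \<psi> :: "real^'a \<Rightarrow> real"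
    by (induction k) auto
  have "foldr (\<lambda>i. partial i ^^ \<alpha> i) xs \<phi> = foldr partial (concat (map (\<lambda>i. replicate (\<alpha> i) i) xs)) \<phi>" for xs
    by (induction xs) (auto simp: r)
  then show ?thesis by (simp add: mi_partial_def mi_list_def)
qed

text \<open>With \<open>c i\<close> the eigenvalue of the operator in direction \<open>i\<close>,
  the product along the list is the monomial that occurs in \<open>symbol\<close>. This links
  iterated operators to the Fourier symbol.\<close>

lemma prod_list_mi_list:
  fixes c :: "'n::finite \<Rightarrow> 'a::comm_monoid_mult"
  shows "prod_list (map c (mi_list \<alpha>)) = (\<Prod>i\<in>UNIV. c i ^ \<alpha> i)"
proof -
  have "prod_list (map c (concat (map (\<lambda>i. replicate (\<alpha> i) i) xs))) = prod_list (map (\<lambda>i. c i ^ \<alpha> i) xs)" for xs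
    by (induction xs) auto
  then have "prod_list (map c (mi_list \<alpha>)) = prod_list (map (\<lambda>i. c i ^ \<alpha> i) coord_list)"
    by (simp add: mi_list_def)
  also have "\<dots> = (\<Prod>i\<in>UNIV. c i ^ \<alpha> i)"
    using coord_list[where 'n='n] by (metis prod.distinct_set_conv_list)
  finally show ?thesis .
qed

lemma length_mi_list: "length (mi_list \<alpha>) = mi_order \<alpha>"
proof -
  have "length (concat (map (\<lambda>i. replicate (\<alpha> i) i) xs)) = sum_list (map \<alpha> xs)" for xs
    by (induction xs) auto
  then have "length (mi_list \<alpha>) = sum_list (map \<alpha> coord_list)" by (simp add: mi_list_def)
  also have "\<dots> = mi_order \<alpha>"
    unfolding mi_order_def using coord_list by (metis sum.distinct_set_conv_list)
  finally show ?thesis .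
qed

lemma mi_list_0: "mi_order \<alpha> = 0 \<Longrightarrow> mi_list \<alpha> = []"
  using length_mi_list[of \<alpha>] by simp

lemma finite_mi_order_le: "finite {\<alpha>::'n::finite \<Rightarrow> nat. mi_order \<alpha> \<le> k}"
proof (rule finite_subset)
  have "\<alpha> i \<le> mi_order \<alpha>" for \<alpha> :: "'n \<Rightarrow> nat" and i
    unfolding mi_order_def by (rule member_le_sum) auto
  then show "{\<alpha>::'n \<Rightarrow> nat. mi_order \<alpha> \<le> k} \<subseteq> PiE UNIV (\<lambda>_. {..k})"
    using order_trans by (fastforce simp: PiE_UNIV_domain)
  show "finite (PiE UNIV (\<lambda>_::'n. {..k}))" by (intro finite_PiE) auto
qed

lemma finite_mi_order_eq: "finite {\<alpha>::'n::finite \<Rightarrow> nat. mi_order \<alpha> = k}"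
  by (rule finite_subset[OF _ finite_mi_order_le[of k]]) auto

section \<open>Supports and test functions\<close>

lemma zero_outside_supp: "x \<notin> supp \<phi> \<Longrightarrow> \<phi> x = 0"
  unfolding supp_def by (metis (mono_tags) closure_subset mem_Collect_eq subsetD)

lemma supp_subset: "closed S \<Longrightarrow> (\<And>x. x \<notin> S \<Longrightarrow> \<phi> x = 0) \<Longrightarrow> supp \<phi> \<subseteq> S"
  unfolding supp_def by (rule closure_minimal) auto

lemma supp_closed: "closed (supp \<phi>)"
  by (simp add: supp_def)

lemma supp_partial: "supp (partial i \<phi>) \<subseteq> supp \<phi>"
proof (rule supp_subset[OF supp_closed])
  fix x assume "x \<notin> supp \<phi>"
  then have "open (- supp \<phi>)" "x \<in> - supp \<phi>" using supp_closed by auto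
  then have "(\<phi> has_derivative (\<lambda>_. 0)) (at x)"
    by (rule has_derivative_transform_within_open[OF has_derivative_const[of 0]])
      (simp add: zero_outside_supp)
  then show "partial i \<phi> x = 0" by (simp add: partialI)
qed

lemma supp_foldr_partial: "supp (foldr partial is \<phi>) \<subseteq> supp \<phi>"
  by (induction "is") (use supp_partial in auto)

lemma test_functionsI:
  assumes "smooth_fun \<phi>" "compact K" "K \<subseteq> \<Omega>" "\<And>x. x \<notin> K \<Longrightarrow> \<phi> x = 0"
  shows "\<phi> \<in> test_functions \<Omega>"
proof -
  have "supp \<phi> \<subseteq> K" using assms by (intro supp_subset) (auto simp: compact_imp_closed)
  then show ?thesis using assms supp_closed unfolding test_functions_def
    by (metis (mono_tags, lifting) compact_Int_closed inf.absorb_iff2 mem_Collect_eq subset_trans)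
qed

lemma test_functionsD:
  assumes "\<phi> \<in> test_functions \<Omega>"
  shows "smooth_fun \<phi>" "compact (supp \<phi>)" "supp \<phi> \<subseteq> \<Omega>" "x \<notin> \<Omega> \<Longrightarrow> \<phi> x = 0"
  using assms zero_outside_supp[of x \<phi>] by (auto simp: test_functions_def)

lemma test_functions_mono: "\<Omega> \<subseteq> \<Omega>' \<Longrightarrow> test_functions \<Omega> \<subseteq> test_functions \<Omega>'"
  by (auto simp: test_functions_def)

lemma test_functions_foldr:
  assumes "\<phi> \<in> test_functions \<Omega>" shows "foldr partial is \<phi> \<in> test_functions \<Omega>"
proof (rule test_functionsI[of _ "supp \<phi>"])
  show "foldr partial is \<phi> x = 0" if "x \<notin> supp \<phi>" for x
    using that supp_foldr_partial[of "is" \<phi>] by (intro zero_outside_supp) auto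
qed (use test_functionsD[OF assms] in \<open>auto intro: smooth_foldr_partial\<close>)

lemma test_functions_partial: "\<phi> \<in> test_functions \<Omega> \<Longrightarrow> partial i \<phi> \<in> test_functions \<Omega>"
  using test_functions_foldr[of \<phi> \<Omega> "[i]"] by simp

lemma test_functions_cmult:
  assumes "\<phi> \<in> test_functions \<Omega>" shows "(\<lambda>x. c * \<phi> x) \<in> test_functions \<Omega>"
proof (rule test_functionsI[of _ "supp \<phi>"])
  show "smooth_fun (\<lambda>x. c * \<phi> x)" using assms by (intro smooth_cmult test_functionsD(1))
qed (use test_functionsD[OF assms] in \<open>auto simp: zero_outside_supp\<close>)

lemma test_functions_add:
  assumes "\<phi> \<in> test_functions \<Omega>" "\<psi> \<in> test_functions \<Omega>"
  shows "(\<lambda>x. \<phi> x + \<psi> x) \<in> test_functions \<Omega>"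
proof (rule test_functionsI[of _ "supp \<phi> \<union> supp \<psi>"])
  show "smooth_fun (\<lambda>x. \<phi> x + \<psi> x)" using assms by (intro smooth_add test_functionsD(1))
  show "supp \<phi> \<union> supp \<psi> \<subseteq> \<Omega>" "compact (supp \<phi> \<union> supp \<psi>)"
    using test_functionsD(2,3)[OF assms(1)] test_functionsD(2,3)[OF assms(2)] by auto
qed (simp add: zero_outside_supp)

lemma test_functions_translate:
  assumes "\<phi> \<in> test_functions UNIV"
  shows "(\<lambda>x. \<phi> (x - a)) \<in> test_functions UNIV"
proof (rule test_functionsI[of _ "(+) a ` supp \<phi>"])
  show "compact ((+) a ` supp \<phi>)" using test_functionsD(2)[OF assms] by (rule compact_translation)
  fix x assume "x \<notin> (+) a ` supp \<phi>"
  then have "x - a \<notin> supp \<phi>" using image_eqI[of x "(+) a" "x - a" "supp \<phi>"] by auto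
  then show "\<phi> (x - a) = 0" by (rule zero_outside_supp)
next
  show "smooth_fun (\<lambda>x. \<phi> (x - a))" using test_functionsD(1)[OF assms] by (rule smooth_translate)
qed auto

lemma test_function_bounded:
  assumes "\<phi> \<in> test_functions \<Omega>"
  obtains B where "B > 0" "\<And>x. \<bar>\<phi> x\<bar> \<le> B"
proof -
  have "compact (\<phi> ` supp \<phi>)"
    using test_functionsD[OF assms] by (intro compact_continuous_image smooth_continuous) auto
  then obtain B where B: "B > 0" "\<And>y. y \<in> \<phi> ` supp \<phi> \<Longrightarrow> norm y \<le> B"
    using compact_imp_bounded bounded_pos by metis
  then have "\<bar>\<phi> x\<bar> \<le> B" for x
    by (cases "x \<in> supp \<phi>") (auto simp: zero_outside_supp)
  then show thesis using B that by blast
qed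

section \<open>Nilpotency on the kernel\<close>

lemma linear_representation_Basis:
  assumes "linear f" shows "f x = (\<Sum>b\<in>Basis. (x \<bullet> b) *\<^sub>R f b)"
proof -
  have "f x = f (\<Sum>b\<in>Basis. (x \<bullet> b) *\<^sub>R b)" by (simp add: euclidean_representation)
  also have "\<dots> = (\<Sum>b\<in>Basis. (x \<bullet> b) *\<^sub>R f b)"
    using assms by (simp add: linear_sum linear_cmul)
  finally show ?thesis .
qed

lemma sum_fun_apply:
  fixes f :: "'i \<Rightarrow> 'a \<Rightarrow> 'b::comm_monoid_add"
  shows "(\<Sum>i\<in>I. f i) x = (\<Sum>i\<in>I. f i x)"
  by (induction I rule: infinite_finite_induct) auto

text \<open>Only multi-indices of order \<open>k\<close> occur, so the sign in
  \<open>dist_deriv\<close> is common to all terms and drops out.\<close>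

lemma dist_kernelD:
  assumes "T \<in> dist_kernel k A" "diff_operator k A" "\<phi> \<in> test_functions UNIV"
  shows "distribution T" "(\<Sum>\<alpha> | mi_order \<alpha> = k. A \<alpha> (T (mi_partial \<alpha> \<phi>))) = 0"
proof -
  show "distribution T" using assms by (simp add: dist_kernel_def)
  have "(\<Sum>\<alpha> | mi_order \<alpha> = k. A \<alpha> (dist_deriv \<alpha> T \<phi>)) = 0"
    using assms by (simp add: dist_kernel_def)
  moreover have "(\<Sum>\<alpha> | mi_order \<alpha> = k. A \<alpha> (dist_deriv \<alpha> T \<phi>)) =
    (\<Sum>\<alpha> | mi_order \<alpha> = k. (-1) ^ k *\<^sub>R A \<alpha> (T (mi_partial \<alpha> \<phi>)))"
    using assms(2) by (intro sum.cong) (auto simp: dist_deriv_def diff_operator_def linear_cmul)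
  ultimately have "(-1) ^ k *\<^sub>R (\<Sum>\<alpha> | mi_order \<alpha> = k. A \<alpha> (T (mi_partial \<alpha> \<phi>))) = 0"
    by (simp add: scaleR_sum_right)
  then show "(\<Sum>\<alpha> | mi_order \<alpha> = k. A \<alpha> (T (mi_partial \<alpha> \<phi>))) = 0" by simp
qed

text \<open>The pair \<open>z l\<close> is the vector of the complexification with complex
  coordinates \<open>l b\<close>. Paired with a real \<open>w\<close>, the two components of its
  image under the symbol are the real and the imaginary part of one complex number, so a single
  complex relation annihilates both.\<close>

lemma symbol_component:
  assumes "diff_operator k A"
  defines "z l \<equiv> (\<Sum>b\<in>Basis. Re (l b) *\<^sub>R b, \<Sum>b\<in>Basis. Im (l b) *\<^sub>R b)"
  shows "fst (symbol k A \<xi> (z l)) \<bullet> w =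
      Re (\<Sum>\<alpha> | mi_order \<alpha> = k. \<Sum>b\<in>Basis. of_real (w \<bullet> A \<alpha> b) * ((\<Prod>i\<in>UNIV. \<xi> $ i ^ \<alpha> i) * l b))"
    "snd (symbol k A \<xi> (z l)) \<bullet> w =
      Im (\<Sum>\<alpha> | mi_order \<alpha> = k. \<Sum>b\<in>Basis. of_real (w \<bullet> A \<alpha> b) * ((\<Prod>i\<in>UNIV. \<xi> $ i ^ \<alpha> i) * l b))"
proof -
  have A: "A \<alpha> (\<Sum>b\<in>Basis. f b *\<^sub>R b) \<bullet> w = (\<Sum>b\<in>Basis. f b * (w \<bullet> A \<alpha> b))" if "mi_order \<alpha> = k" for \<alpha> f
  proof -
    have "linear (A \<alpha>)" using assms(1) that by (simp add: diff_operator_def)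
    then have "A \<alpha> (\<Sum>b\<in>Basis. f b *\<^sub>R b) = (\<Sum>b\<in>Basis. f b *\<^sub>R A \<alpha> b)"
      by (simp add: linear_sum linear_cmul)
    then show ?thesis by (simp add: inner_sum_left inner_commute[of w])
  qed
  show "fst (symbol k A \<xi> (z l)) \<bullet> w =
      Re (\<Sum>\<alpha> | mi_order \<alpha> = k. \<Sum>b\<in>Basis. of_real (w \<bullet> A \<alpha> b) * ((\<Prod>i\<in>UNIV. \<xi> $ i ^ \<alpha> i) * l b))"
    unfolding symbol_def z_def cscale_def fst_sum inner_sum_left Re_sum
    by (intro sum.cong refl)
      (simp add: A inner_diff_left sum_distrib_left flip: sum_subtractf, simp add: algebra_simps)
  show "snd (symbol k A \<xi> (z l)) \<bullet> w =
      Im (\<Sum>\<alpha> | mi_order \<alpha> = k. \<Sum>b\<in>Basis. of_real (w \<bullet> A \<alpha> b) * ((\<Prod>i\<in>UNIV. \<xi> $ i ^ \<alpha> i) * l b))"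
    unfolding symbol_def z_def cscale_def snd_sum inner_sum_left Im_sum
    by (intro sum.cong refl)
      (simp add: A inner_add_left sum_distrib_left flip: sum.distrib, simp add: algebra_simps)
qed

text \<open>The module consists of functions of pairs \<open>(T, \<phi>)\<close>; it is generated by the components
  \<open>b \<bullet> T \<phi>\<close>, and \<open>X i\<close> replaces \<open>\<phi>\<close> by its partial derivative. A character of it would be a
  nonzero complex frequency at which the symbol is not injective.\<close>

lemma kernel_nilpotent_direction:
  fixes A :: "('n::finite \<Rightarrow> nat) \<Rightarrow> 'v::euclidean_space \<Rightarrow> 'w::euclidean_space"
  assumes "diff_operator k A" "C_elliptic k A"
  obtains m where "\<And>T \<phi>. T \<in> dist_kernel k A \<Longrightarrow> \<phi> \<in> test_functions UNIV \<Longrightarrow> T ((partial j ^^ m) \<phi>) = 0"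
proof -
  let ?D = "dist_kernel k A \<times> test_functions UNIV :: (((real^'n \<Rightarrow> real) \<Rightarrow> 'v) \<times> (real^'n \<Rightarrow> real)) set"
  define scale :: "complex \<Rightarrow> (((real^'n \<Rightarrow> real) \<Rightarrow> 'v) \<times> (real^'n \<Rightarrow> real) \<Rightarrow> complex) \<Rightarrow>
      ((real^'n \<Rightarrow> real) \<Rightarrow> 'v) \<times> (real^'n \<Rightarrow> real) \<Rightarrow> complex"
    where "scale c f = (\<lambda>d. c * f d)" for c f
  \<comment> \<open>The value 0 outside \<open>?D\<close> lets the operators commute on all
    functions of pairs: partial derivatives commute on smooth functions, and nothing is known about
    \<open>partial\<close> elsewhere.\<close>
  define X :: "'n \<Rightarrow> (((real^'n \<Rightarrow> real) \<Rightarrow> 'v) \<times> (real^'n \<Rightarrow> real) \<Rightarrow> complex) \<Rightarrow>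
      ((real^'n \<Rightarrow> real) \<Rightarrow> 'v) \<times> (real^'n \<Rightarrow> real) \<Rightarrow> complex"
    where "X i f = (\<lambda>d. if d \<in> ?D then f (fst d, partial i (snd d)) else 0)" for i f
  define e :: "'v \<Rightarrow> ((real^'n \<Rightarrow> real) \<Rightarrow> 'v) \<times> (real^'n \<Rightarrow> real) \<Rightarrow> complex"
    where "e b = (\<lambda>d. if d \<in> ?D then of_real (b \<bullet> fst d (snd d)) else 0)" for b
  interpret commuting_operators scale X
  proof
    fix i j f
    show "X i (X j f) = X j (X i f)"
      by (auto simp: X_def fun_eq_iff test_functions_partial partial_commute test_functionsD(1))
  qed (auto simp: scale_def X_def fun_eq_iff algebra_simps)
  \<comment> \<open>The operators act on the argument of a function, so the outermost one is the
    first to differentiate the test function; hence the reversed list.\<close>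
  have fold_e: "foldr X is (e b) (T, \<phi>) = of_real (b \<bullet> T (foldr partial (rev is) \<phi>))"
    if "T \<in> dist_kernel k A" "\<phi> \<in> test_functions UNIV" for "is" b T \<phi>
    using that(2) by (induction "is" arbitrary: \<phi>) (auto simp: X_def e_def that(1) test_functions_partial)
  have fold_e0: "foldr X is (e b) d = 0" if "d \<notin> ?D" for "is" b d
    by (cases "is") (use that in \<open>auto simp: X_def e_def\<close>)
  have pow_e: "(X i ^^ m) f = foldr X (replicate m i) f" for i m f
    by (induction m) auto
  have sub0: "submodule {0}"
    unfolding submodule_def by (auto simp: subspace_0)
  have fin: "finite (e ` Basis)" by simp
  show thesis
    using fin sub0
  proof (rule nilpotent_or_character[where j = j])
    fix m assume m: "\<And>f. f \<in> e ` Basis \<Longrightarrow> (X j ^^ m) f \<in> {0}"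
    have "T ((partial j ^^ m) \<phi>) = 0" if *: "T \<in> dist_kernel k A" "\<phi> \<in> test_functions UNIV" for T \<phi>
    proof -
      have "b \<bullet> T ((partial j ^^ m) \<phi>) = 0" if "b \<in> Basis" for b
      proof -
        have "(X j ^^ m) (e b) (T, \<phi>) = 0" using m[of "e b"] that by simp
        then show ?thesis unfolding pow_e fold_e[OF *] by simp
      qed
      then show ?thesis by (metis euclidean_eqI inner_commute inner_zero_left)
    qed
    then show thesis by (rule that)
  next
    fix c :: "'n \<Rightarrow> complex" and l
    assume cj: "c j \<noteq> 0" and l: "\<And>u v. l (u + v) = l u + l v" "\<And>a u. l (scale a u) = a * l u"
      "\<And>i u. u \<in> generated (e ` Basis) \<Longrightarrow> l (X i u) = c i * l u" "\<exists>f\<in>e ` Basis. l f \<noteq> 0"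
    have l0: "l 0 = 0" using l(2)[of 0 0] by (simp add: scale_def zero_fun_def)
    have l_sum: "l (\<Sum>i\<in>I. f i) = (\<Sum>i\<in>I. l (f i))" for f and I :: "'i set"
      by (induction I rule: infinite_finite_induct) (simp_all only: sum.infinite sum.empty sum.insert l0 l(1) not_False_eq_True)
    have l_fold: "l (foldr X is (e b)) = prod_list (map c is) * l (e b)" if "b \<in> Basis" for b "is"
    proof (induction "is")
      case (Cons i "is")
      have "foldr X is (e b) \<in> generated (e ` Basis)"
        unfolding generated_def using that by (intro span_base) blast
      then show ?case using Cons l(3) by simp
    qed simp
    define u where "u \<alpha> b = foldr X (rev (mi_list \<alpha>)) (e b)" for \<alpha> b
    have lu: "l (u \<alpha> b) = (\<Prod>i\<in>UNIV. c i ^ \<alpha> i) * l (e b)" if "b \<in> Basis" for \<alpha> b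
      using l_fold[OF that] by (simp add: u_def prod_list_mi_list prod_list.rev flip: rev_map)
    \<comment> \<open>The equation A T = 0, paired with \<open>w\<close>, becomes a linear relation
      between elements of the module itself, valid for all pairs at once. The functional
      \<open>l\<close> can then be applied to it, although \<open>l\<close> need not be an
      evaluation at any pair.\<close>
    have row: "(\<Sum>\<alpha> | mi_order \<alpha> = k. \<Sum>b\<in>Basis. scale (of_real (w \<bullet> A \<alpha> b)) (u \<alpha> b)) = 0" for w
    proof
      fix d :: "((real^'n \<Rightarrow> real) \<Rightarrow> 'v) \<times> (real^'n \<Rightarrow> real)"
      have ev: "(\<Sum>\<alpha> | mi_order \<alpha> = k. \<Sum>b\<in>Basis. scale (of_real (w \<bullet> A \<alpha> b)) (u \<alpha> b)) d
        = (\<Sum>\<alpha> | mi_order \<alpha> = k. \<Sum>b\<in>Basis. of_real (w \<bullet> A \<alpha> b) * u \<alpha> b d)"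
        by (simp add: sum_fun_apply scale_def)
      show "(\<Sum>\<alpha> | mi_order \<alpha> = k. \<Sum>b\<in>Basis. scale (of_real (w \<bullet> A \<alpha> b)) (u \<alpha> b)) d = 0 d"
      proof (cases "d \<in> ?D")
        case False
        then show ?thesis unfolding ev by (simp add: u_def fold_e0)
      next
        case True
        then obtain T \<phi> where d: "d = (T, \<phi>)" "T \<in> dist_kernel k A" "\<phi> \<in> test_functions UNIV" by auto
        have "(\<Sum>\<alpha> | mi_order \<alpha> = k. \<Sum>b\<in>Basis. of_real (w \<bullet> A \<alpha> b) * u \<alpha> b d) =
          (\<Sum>\<alpha> | mi_order \<alpha> = k. of_real (w \<bullet> A \<alpha> (T (mi_partial \<alpha> \<phi>))))"
        proof (intro sum.cong refl)
          fix \<alpha> :: "'n \<Rightarrow> nat" assume "\<alpha> \<in> {\<alpha>. mi_order \<alpha> = k}"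
          then have "linear (A \<alpha>)" using assms(1) by (simp add: diff_operator_def)
          then have "A \<alpha> (T (mi_partial \<alpha> \<phi>)) = (\<Sum>b\<in>Basis. (T (mi_partial \<alpha> \<phi>) \<bullet> b) *\<^sub>R A \<alpha> b)"
            by (rule linear_representation_Basis)
          then show "(\<Sum>b\<in>Basis. of_real (w \<bullet> A \<alpha> b) * u \<alpha> b d) = of_real (w \<bullet> A \<alpha> (T (mi_partial \<alpha> \<phi>)))"
            unfolding d(1) u_def fold_e[OF d(2,3)]
            by (simp add: mi_partial_foldr inner_sum_right inner_commute mult.commute)
        qed
        also have "\<dots> = of_real (w \<bullet> (\<Sum>\<alpha> | mi_order \<alpha> = k. A \<alpha> (T (mi_partial \<alpha> \<phi>))))"
          by (simp add: inner_sum_right)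
        also have "\<dots> = 0" using dist_kernelD(2)[OF d(2) assms(1) d(3)] by simp
        finally show ?thesis unfolding ev by simp
      qed
    qed
    \<comment> \<open>The relation \<open>row\<close>, mapped by \<open>l\<close>, says that the
      symbol at \<open>\<xi>\<close> annihilates \<open>z\<close>. Injectivity forces
      \<open>z\<close> to vanish, hence also \<open>l\<close> on all generators, against the choice
      of \<open>l\<close>.\<close>
    define \<xi> :: "complex^'n" where "\<xi> = (\<chi> i. c i)"
    define z where "z = (\<Sum>b\<in>Basis. Re (l (e b)) *\<^sub>R b, \<Sum>b\<in>Basis. Im (l (e b)) *\<^sub>R b :: 'v)"
    have row0: "(\<Sum>\<alpha> | mi_order \<alpha> = k. \<Sum>b\<in>Basis. of_real (w \<bullet> A \<alpha> b) * ((\<Prod>i\<in>UNIV. \<xi> $ i ^ \<alpha> i) * l (e b))) = 0" for w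
    proof -
      have "0 = l (\<Sum>\<alpha> | mi_order \<alpha> = k. \<Sum>b\<in>Basis. scale (of_real (w \<bullet> A \<alpha> b)) (u \<alpha> b))"
        by (simp only: row l0)
      also have "\<dots> = (\<Sum>\<alpha> | mi_order \<alpha> = k. \<Sum>b\<in>Basis. of_real (w \<bullet> A \<alpha> b) * ((\<Prod>i\<in>UNIV. \<xi> $ i ^ \<alpha> i) * l (e b)))"
        by (simp add: l_sum l(2) lu \<xi>_def)
      finally show ?thesis ..
    qed
    have "fst (symbol k A \<xi> z) \<bullet> w = 0" "snd (symbol k A \<xi> z) \<bullet> w = 0" for w
      unfolding z_def symbol_component[OF assms(1), of \<xi> "\<lambda>b. l (e b)" w] row0 by auto
    then have "fst (symbol k A \<xi> z) = 0" "snd (symbol k A \<xi> z) = 0"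
      by (metis inner_eq_zero_iff)+
    then have "symbol k A \<xi> z = 0" by (simp add: prod_eq_iff)
    also have "symbol k A \<xi> 0 = 0"
      using assms(1) unfolding symbol_def cscale_def
      by (intro sum.neutral) (auto simp: diff_operator_def linear_0 prod_eq_iff)
    finally have "symbol k A \<xi> z = symbol k A \<xi> 0" using \<open>symbol k A \<xi> 0 = 0\<close> by simp
    moreover have "inj (symbol k A \<xi>)"
    proof -
      have "\<xi> $ j \<noteq> 0" using cj by (simp add: \<xi>_def)
      then have "\<xi> \<noteq> 0" by auto
      then show ?thesis using assms(2) by (simp add: C_elliptic_def)
    qed
    ultimately have "z = 0" by (auto dest: injD)
    have "l (e b) = 0" if "b \<in> Basis" for b
    proof -
      have "(\<Sum>b\<in>Basis. Re (l (e b)) *\<^sub>R b) \<bullet> b = 0" "(\<Sum>b\<in>Basis. Im (l (e b)) *\<^sub>R b) \<bullet> b = 0"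
        using \<open>z = 0\<close> by (auto simp: z_def zero_prod_def)
      then show ?thesis using that by (simp add: complex_eq_iff inner_sum_left_Basis)
    qed
    then show thesis using l(4) by auto
  qed
qed

text \<open>The exponent may be raised, because derivatives of test functions are test functions
  again; so the maximum over the finitely many directions works for all of them.\<close>

lemma kernel_nilpotent:
  fixes A :: "('n::finite \<Rightarrow> nat) \<Rightarrow> 'v::euclidean_space \<Rightarrow> 'w::euclidean_space"
  assumes "diff_operator k A" "C_elliptic k A"
  obtains m where "\<And>T \<phi> i. T \<in> dist_kernel k A \<Longrightarrow> \<phi> \<in> test_functions UNIV \<Longrightarrow> T ((partial i ^^ m) \<phi>) = 0"
proof -
  have "\<exists>m. \<forall>T\<in>dist_kernel k A. \<forall>\<phi>\<in>test_functions UNIV. T ((partial i ^^ m) \<phi>) = 0" for i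
    by (rule kernel_nilpotent_direction[OF assms, of i]) blast
  then obtain m where m: "\<And>i T \<phi>. T \<in> dist_kernel k A \<Longrightarrow> \<phi> \<in> test_functions UNIV \<Longrightarrow> T ((partial i ^^ m i) \<phi>) = 0"
    by metis
  have "T ((partial i ^^ Max (range m)) \<phi>) = 0" if "T \<in> dist_kernel k A" "\<phi> \<in> test_functions UNIV" for T \<phi> i
  proof -
    have "Max (range m) = m i + (Max (range m) - m i)" by simp
    then have "(partial i ^^ Max (range m)) \<phi> = (partial i ^^ m i) ((partial i ^^ (Max (range m) - m i)) \<phi>)"
      by (metis comp_apply funpow_add)
    moreover have "(partial i ^^ r) \<phi> \<in> test_functions UNIV" for r
      by (induction r) (use that test_functions_partial in auto)
    ultimately show ?thesis using m that by simp
  qed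
  then show thesis by (rule that)
qed

section \<open>Translates of a distribution\<close>

lemma distribution_linear:
  assumes "distribution T" "\<phi> \<in> test_functions UNIV" "\<psi> \<in> test_functions UNIV"
  shows "T (\<lambda>x. \<phi> x + c * \<psi> x) = T \<phi> + c *\<^sub>R T \<psi>"
  using assms test_functions_cmult[of \<psi> UNIV c] by (simp add: distribution_def)

text \<open>Two mean value estimates, one for the derivative and one for the function, give the
  constant \<open>B\<close> instead of the sharp B/2. Both applications, to translates under a
  distribution and to integrals of derivatives, need only the order h^2.\<close>

lemma second_order_estimate:
  assumes "smooth_fun \<phi>" "\<And>x. \<bar>partial i (partial i \<phi>) x\<bar> \<le> B"
  shows "\<bar>\<phi> (x + h *\<^sub>R axis i 1) - \<phi> x - h * partial i \<phi> x\<bar> \<le> B * h\<^sup>2"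
proof -
  let ?u = "\<lambda>t. \<phi> (x + t *\<^sub>R axis i 1)" and ?u' = "\<lambda>t. partial i \<phi> (x + t *\<^sub>R axis i 1)"
  have d: "(?u has_real_derivative ?u' t) (at t)" for t by (rule smooth_DERIV[OF assms(1)])
  have d': "(?u' has_real_derivative partial i (partial i \<phi>) (x + t *\<^sub>R axis i 1)) (at t)" for t
    by (rule smooth_DERIV[OF smooth_partial[OF assms(1)]])
  have B: "B \<ge> 0" using assms(2)[of x] by linarith
  have u': "\<bar>?u' t - ?u' 0\<bar> \<le> B * \<bar>t\<bar>" for t
    using field_differentiable_bound[of UNIV ?u' "\<lambda>t. partial i (partial i \<phi>) (x + t *\<^sub>R axis i 1)" B t 0]
      d' assms(2) by auto
  let ?S = "closed_segment 0 h"
  have "norm ((?u h - h * ?u' 0) - (?u 0 - 0 * ?u' 0)) \<le> (B * \<bar>h\<bar>) * norm (h - 0)"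
  proof (rule field_differentiable_bound[of ?S])
    fix t assume t: "t \<in> ?S"
    show "((\<lambda>t. ?u t - t * ?u' 0) has_real_derivative (?u' t - ?u' 0)) (at t within ?S)"
      by (rule DERIV_subset[OF _ subset_UNIV]) (auto intro!: derivative_eq_intros d)
    have "\<bar>t\<bar> \<le> \<bar>h\<bar>" using t by (auto simp: closed_segment_eq_real_ivl split: if_splits)
    then have "B * \<bar>t\<bar> \<le> B * \<bar>h\<bar>" using B by (rule mult_left_mono)
    then show "norm (?u' t - ?u' 0) \<le> B * \<bar>h\<bar>" using u'[of t] by simp
  qed auto
  then show ?thesis by (simp add: power2_eq_square algebra_simps)
qed

text \<open>Here the continuity of \<open>T\<close> is exploited. The remainder
  \<open>\<psi> h\<close> of the first-order expansion is supported in one compact set for all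
  \<open>h\<close> of modulus at most 1, and each of its derivatives is of size h^2; the seminorm
  estimate on that set gives T(\<open>\<psi> h\<close>) = O(h^2). The minus sign comes from the
  shift entering as y - x.\<close>

lemma distribution_translate_derivative:
  fixes T :: "(real^'n \<Rightarrow> real) \<Rightarrow> 'v::euclidean_space"
  assumes T: "distribution T" and \<phi>: "\<phi> \<in> test_functions UNIV"
  shows "((\<lambda>t. T (\<lambda>y. \<phi> (y - (x + t *\<^sub>R axis i 1)))) has_vector_derivative
    - T (\<lambda>y. partial i \<phi> (y - (x + t *\<^sub>R axis i 1)))) (at t)"
proof -
  let ?e = "axis i 1 :: real^'n"
  let ?x = "x + t *\<^sub>R ?e"
  define \<psi> where "\<psi> h = (\<lambda>y. (\<phi> (y - (?x + h *\<^sub>R ?e)) + (-1) * \<phi> (y - ?x)) + h * partial i \<phi> (y - ?x))" for h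
  note tr = test_functions_translate and pa = test_functions_partial[OF \<phi>]
  have t1: "(\<lambda>y. \<phi> (y - (?x + h *\<^sub>R ?e)) + (-1) * \<phi> (y - ?x)) \<in> test_functions UNIV" for h
    by (intro test_functions_add test_functions_cmult tr \<phi>)
  have \<psi>_test: "\<psi> h \<in> test_functions UNIV" for h unfolding \<psi>_def
    by (intro test_functions_add test_functions_cmult tr \<phi> pa)
  have T\<psi>: "T (\<psi> h) = T (\<lambda>y. \<phi> (y - (?x + h *\<^sub>R ?e))) - T (\<lambda>y. \<phi> (y - ?x)) + h *\<^sub>R T (\<lambda>y. partial i \<phi> (y - ?x))" for h
    unfolding \<psi>_def distribution_linear[OF T t1 tr[OF pa]] distribution_linear[OF T tr[OF \<phi>] tr[OF \<phi>]]
    by simp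
  \<comment> \<open>The support of \<open>\<phi>\<close> swept along all shifts within distance 1 of
    \<open>?x\<close> in direction \<open>i\<close>; it is compact as a continuous image of a
    product of compact sets.\<close>
  define K where "K = (\<lambda>z. fst z + snd z) ` (supp \<phi> \<times> ((\<lambda>h. ?x + h *\<^sub>R ?e) ` {-1..1}))"
  have K: "compact K" unfolding K_def
    using test_functionsD(2)[OF \<phi>]
    by (intro compact_continuous_image compact_Times continuous_intros) auto
  have supp_K: "supp (\<psi> h) \<subseteq> K" if "\<bar>h\<bar> \<le> 1" for h
  proof (rule supp_subset)
    show "closed K" using K by (rule compact_imp_closed)
    fix y assume y: "y \<notin> K"
    have *: "y - (?x + h' *\<^sub>R ?e) \<notin> supp \<phi>" if "\<bar>h'\<bar> \<le> 1" for h'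
    proof
      assume "y - (?x + h' *\<^sub>R ?e) \<in> supp \<phi>"
      then have "(y - (?x + h' *\<^sub>R ?e), ?x + h' *\<^sub>R ?e) \<in> supp \<phi> \<times> ((\<lambda>h. ?x + h *\<^sub>R ?e) ` {-1..1})"
        using that by (auto intro!: imageI)
      from imageI[OF this, of "\<lambda>z. fst z + snd z"] show False using y by (simp add: K_def)
    qed
    have "y - ?x \<notin> supp \<phi>" using *[of 0] by simp
    moreover have "y - ?x \<notin> supp (partial i \<phi>)" using calculation supp_partial[of i \<phi>] by auto
    ultimately show "\<psi> h y = 0" using *[OF that] by (simp add: \<psi>_def zero_outside_supp)
  qed
  obtain C m where C: "\<And>\<phi>. \<phi> \<in> test_functions UNIV \<Longrightarrow> supp \<phi> \<subseteq> K \<Longrightarrow>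
      norm (T \<phi>) \<le> C * (\<Sum>\<alpha> | mi_order \<alpha> \<le> m. SUP x. \<bar>mi_partial \<alpha> \<phi> x\<bar>)"
    using T K unfolding distribution_def by meson
  have "\<exists>B>0. \<forall>y. \<bar>partial i (partial i (mi_partial \<alpha> \<phi>)) y\<bar> \<le> B" for \<alpha>
    using test_function_bounded[OF test_functions_partial[OF test_functions_partial[OF test_functions_foldr[OF \<phi>]]]]
    unfolding mi_partial_foldr by metis
  then obtain B where B: "\<And>\<alpha>. B \<alpha> > 0" "\<And>\<alpha> y. \<bar>partial i (partial i (mi_partial \<alpha> \<phi>)) y\<bar> \<le> B \<alpha>"
    by metis
  have est: "\<bar>mi_partial \<alpha> (\<psi> h) y\<bar> \<le> B \<alpha> * h\<^sup>2" for \<alpha> h y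
  proof -
    let ?is = "mi_list \<alpha>" and ?g = "foldr partial (mi_list \<alpha>) \<phi>"
    have sm: "smooth_fun \<phi>" "smooth_fun (partial i \<phi>)" "smooth_fun ?g"
      using test_functionsD(1)[OF \<phi>] by (auto intro: smooth_partial smooth_foldr_partial)
    have "foldr partial ?is (\<psi> h) =
      (\<lambda>y. (?g (y - (?x + h *\<^sub>R ?e)) + (-1) * ?g (y - ?x)) + h * foldr partial ?is (partial i \<phi>) (y - ?x))"
    proof -
      have s1: "smooth_fun (\<lambda>y. \<phi> (y - a))" "smooth_fun (\<lambda>y. partial i \<phi> (y - a))" for a
        using sm by (simp_all add: smooth_translate)
      show ?thesis unfolding \<psi>_def
        by (simp only: foldr_partial_add foldr_partial_cmult foldr_partial_translate s1 sm smooth_add smooth_cmult)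
    qed
    then have "mi_partial \<alpha> (\<psi> h) y = ?g ((y - ?x) + (-h) *\<^sub>R ?e) - ?g (y - ?x) - (-h) * partial i ?g (y - ?x)"
      unfolding mi_partial_foldr by (simp add: foldr_partial_commute sm algebra_simps)
    moreover have "\<bar>?g ((y - ?x) + (-h) *\<^sub>R ?e) - ?g (y - ?x) - (-h) * partial i ?g (y - ?x)\<bar> \<le> B \<alpha> * (-h)\<^sup>2"
      using B(2)[of \<alpha>] unfolding mi_partial_foldr by (intro second_order_estimate sm)
    ultimately show ?thesis by simp
  qed
  \<comment> \<open>The sign of \<open>C\<close> is not prescribed by the seminorm estimate, hence
    the absolute value.\<close>
  define M where "M = \<bar>C\<bar> * (\<Sum>\<alpha> | mi_order \<alpha> \<le> m. B \<alpha>)"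
  have bound: "norm (T (\<psi> h)) \<le> M * h\<^sup>2" if "\<bar>h\<bar> \<le> 1" for h
  proof -
    have sup: "(SUP y. \<bar>mi_partial \<alpha> (\<psi> h) y\<bar>) \<le> B \<alpha> * h\<^sup>2" for \<alpha>
      by (rule cSUP_least) (auto intro: est)
    have sup0: "0 \<le> (SUP y. \<bar>mi_partial \<alpha> (\<psi> h) y\<bar>)" for \<alpha>
      by (rule cSUP_upper2[where x = 0]) (auto intro!: bdd_aboveI2[where M = "B \<alpha> * h\<^sup>2"] est)
    have "norm (T (\<psi> h)) \<le> C * (\<Sum>\<alpha> | mi_order \<alpha> \<le> m. SUP x. \<bar>mi_partial \<alpha> (\<psi> h) x\<bar>)"
      by (rule C[OF \<psi>_test supp_K[OF that]])
    also have "\<dots> \<le> \<bar>C\<bar> * (\<Sum>\<alpha> | mi_order \<alpha> \<le> m. SUP x. \<bar>mi_partial \<alpha> (\<psi> h) x\<bar>)"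
      by (intro mult_right_mono sum_nonneg) (auto intro: sup0)
    also have "\<dots> \<le> \<bar>C\<bar> * (\<Sum>\<alpha> | mi_order \<alpha> \<le> m. B \<alpha> * h\<^sup>2)"
      by (intro mult_left_mono sum_mono sup) auto
    finally show ?thesis by (simp add: M_def sum_distrib_right mult.assoc)
  qed
  have "((\<lambda>h. T (\<psi> h) /\<^sub>R norm h) \<longlongrightarrow> 0) (at 0)"
  proof (rule Lim_null_comparison)
    have "eventually (\<lambda>h::real. \<bar>h\<bar> \<le> 1) (at 0)"
      by (auto simp: eventually_at intro!: exI[of _ 1])
    then show "eventually (\<lambda>h. norm (T (\<psi> h) /\<^sub>R norm h) \<le> M * \<bar>h\<bar>) (at 0)"
    proof eventually_elim
      case (elim h)
      show ?case using bound[OF elim]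
        by (cases "h = 0") (auto simp: field_simps power2_eq_square)
    qed
    show "((\<lambda>h. M * \<bar>h\<bar>) \<longlongrightarrow> 0) (at 0)" by (auto intro!: tendsto_eq_intros)
  qed
  then have lim: "((\<lambda>h. (T (\<lambda>y. \<phi> (y - (x + (t + h) *\<^sub>R ?e))) - T (\<lambda>y. \<phi> (y - ?x))
      - h *\<^sub>R (- T (\<lambda>y. partial i \<phi> (y - ?x)))) /\<^sub>R norm h) \<longlongrightarrow> 0) (at 0)"
    by (simp add: T\<psi> algebra_simps)
  show ?thesis unfolding has_vector_derivative_def has_derivative_at
    using tendsto_norm[OF lim] by (simp add: bounded_linear_scaleR_left divide_inverse_commute bounded_linear_minus)
qed

text \<open>The derivative of order \<open>m\<close> vanishes, so the Taylor formula has no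
  remainder. The induction applies the claim to the family shifted by one and compares
  \<open>F 0\<close> with an antiderivative of the resulting polynomial.\<close>

lemma taylor_polynomial:
  fixes F :: "nat \<Rightarrow> real \<Rightarrow> 'v::real_normed_vector"
  assumes "\<And>l t. (F l has_vector_derivative F (Suc l) t) (at t)" "\<And>t. F m t = 0"
  shows "F 0 t = (\<Sum>l<m. (t ^ l / fact l) *\<^sub>R F l 0)"
  using assms
proof (induction m arbitrary: F t)
  case 0
  then show ?case by simp
next
  case (Suc m)
  have IH: "F 1 t = (\<Sum>l<m. (t ^ l / fact l) *\<^sub>R F (Suc l) 0)" for t
    using Suc.IH[of "\<lambda>l. F (Suc l)" t] Suc.prems by simp
  let ?G = "\<lambda>t. F 0 t - (\<Sum>l<m. (t ^ Suc l / fact (Suc l)) *\<^sub>R F (Suc l) 0)"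
  have "(?G has_vector_derivative 0) (at t within UNIV)" for t
  proof -
    have "((\<lambda>t. (t ^ Suc l / fact (Suc l)) *\<^sub>R F (Suc l) 0) has_vector_derivative (t ^ l / fact l) *\<^sub>R F (Suc l) 0) (at t)" for l
    proof -
      have "((\<lambda>t::real. t ^ Suc l / fact (Suc l)) has_real_derivative (t ^ l / fact l)) (at t)"
      proof -
        have "((\<lambda>t::real. t ^ Suc l * inverse (fact (Suc l))) has_real_derivative
            (real (Suc l) * t ^ l) * inverse (fact (Suc l))) (at t)"
          by (rule DERIV_cmult_right) (use DERIV_pow[of "Suc l" t] in simp)
        moreover have "(real (Suc l) * t ^ l) * inverse (fact (Suc l)) = t ^ l / fact l"
          by (simp add: divide_simps fact_Suc del: of_nat_Suc)
        ultimately show ?thesis unfolding divide_inverse by metis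
      qed
      then show ?thesis by (rule has_vector_derivative_scaleR[OF _ has_vector_derivative_const, THEN has_vector_derivative_eq_rhs]) simp
    qed
    then have "((\<lambda>t. \<Sum>l<m. (t ^ Suc l / fact (Suc l)) *\<^sub>R F (Suc l) 0) has_vector_derivative
        (\<Sum>l<m. (t ^ l / fact l) *\<^sub>R F (Suc l) 0)) (at t)"
      by (rule has_vector_derivative_sum)
    from has_vector_derivative_diff[OF Suc.prems(1)[of 0 t] this]
    show ?thesis using IH[of t] by (simp del: fact_Suc power_Suc)
  qed
  then obtain c where c: "\<And>t. ?G t = c"
    using has_vector_derivative_zero_constant[of UNIV ?G] by auto
  have "c = F 0 0" using c[of 0] by simp
  then have "F 0 t = F 0 0 + (\<Sum>l<m. (t ^ Suc l / fact (Suc l)) *\<^sub>R F (Suc l) 0)"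
    using c[of t] by (simp add: algebra_simps)
  then show ?case by (simp add: sum.lessThan_Suc_shift del: sum.lessThan_Suc)
qed

section \<open>Polynomials of bounded degree in each variable\<close>

definition mono_fun :: "('n::finite \<Rightarrow> nat) \<Rightarrow> real^'n \<Rightarrow> real" where
  "mono_fun J x = (\<Prod>i\<in>UNIV. (x $ i) ^ J i)"

text \<open>Degrees are bounded variable by variable, since the nilpotency is known direction by
  direction. The set \<open>I\<close> holds the variables already treated in an induction over the
  coordinates.\<close>

definition mono_box :: "nat \<Rightarrow> 'n set \<Rightarrow> ('n \<Rightarrow> nat) set" where
  "mono_box m I = {J. (\<forall>i\<in>I. J i < m) \<and> (\<forall>i. i \<notin> I \<longrightarrow> J i = 0)}"

lemma finite_mono_box: "finite (mono_box m (I :: 'n::finite set))"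
proof (rule finite_subset)
  show "mono_box m I \<subseteq> PiE UNIV (\<lambda>_. {..m})"
  proof
    fix J assume "J \<in> mono_box m I"
    then have "J i \<le> m" for i by (cases "i \<in> I") (auto simp: mono_box_def less_imp_le)
    then show "J \<in> PiE UNIV (\<lambda>_. {..m})" by (simp add: PiE_UNIV_domain)
  qed
  show "finite (PiE UNIV (\<lambda>_::'n. {..m}))" by (intro finite_PiE) auto
qed

lemma mono_box_insert_sum:
  fixes g :: "('n \<Rightarrow> nat) \<Rightarrow> 'v::comm_monoid_add"
  assumes "j \<notin> I"
  shows "sum g (mono_box m (insert j I)) = (\<Sum>l<m. \<Sum>J\<in>mono_box m I. g (J(j := l)))"
proof -
  have "sum g (mono_box m (insert j I)) = (\<Sum>(l, J)\<in>{..<m} \<times> mono_box m I. g (J(j := l)))"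
    by (rule sum.reindex_bij_witness[of _ "\<lambda>(l, J). J(j := l)" "\<lambda>J. (J j, J(j := 0))"])
      (use assms in \<open>auto simp: mono_box_def fun_eq_iff\<close>)
  then show ?thesis by (simp add: sum.cartesian_product)
qed

abbreviation poly_fun :: "nat \<Rightarrow> (('n::finite \<Rightarrow> nat) \<Rightarrow> 'v::real_vector) \<Rightarrow> real^'n \<Rightarrow> 'v" where
  "poly_fun m c x \<equiv> \<Sum>J\<in>mono_box m UNIV. mono_fun J x *\<^sub>R c J"

text \<open>The coordinates of \<open>x\<close> are set free one at a time, for all test functions
  simultaneously. The Taylor expansion in direction \<open>j\<close> is finite by
  \<open>nil\<close>, and its coefficients are values of \<open>T\<close> at translates of
  derivatives of \<open>\<phi>\<close>, for which the induction hypothesis holds.\<close>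

lemma distribution_translate_polynomial:
  fixes T :: "(real^'n \<Rightarrow> real) \<Rightarrow> 'v::euclidean_space"
  assumes T: "distribution T"
    and nil: "\<And>\<phi> i. \<phi> \<in> test_functions UNIV \<Longrightarrow> T ((partial i ^^ m) \<phi>) = 0"
    and \<phi>: "\<phi> \<in> test_functions UNIV"
  obtains c where "\<And>x. T (\<lambda>y. \<phi> (y - x)) = poly_fun m c x"
proof -
  have "\<exists>c. \<forall>x. (\<forall>i. i \<notin> I \<longrightarrow> x $ i = 0) \<longrightarrow>
      T (\<lambda>y. \<phi> (y - x)) = (\<Sum>J\<in>mono_box m I. mono_fun J x *\<^sub>R c J)"
    if "finite I" "\<phi> \<in> test_functions UNIV" for I \<phi>
    using that
  proof (induction I arbitrary: \<phi> rule: finite_induct)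
    case empty
    have "mono_box m ({} :: 'n set) = {\<lambda>_. 0}" by (auto simp: mono_box_def)
    then show ?case
      by (intro exI[of _ "\<lambda>_. T \<phi>"]) (auto simp: mono_fun_def simp flip: vec_eq_iff[of _ 0, simplified])
  next
    case (insert j I)
    have pt: "(partial j ^^ l) \<phi> \<in> test_functions UNIV" for l
      by (induction l) (use insert.prems test_functions_partial in auto)
    have "\<forall>l. \<exists>c. \<forall>x. (\<forall>i. i \<notin> I \<longrightarrow> x $ i = 0) \<longrightarrow>
      T (\<lambda>y. (partial j ^^ l) \<phi> (y - x)) = (\<Sum>J\<in>mono_box m I. mono_fun J x *\<^sub>R c J)"
      using insert.IH[OF pt] by blast
    then obtain c where c: "\<And>l x. (\<forall>i. i \<notin> I \<longrightarrow> x $ i = 0) \<Longrightarrow>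
      T (\<lambda>y. (partial j ^^ l) \<phi> (y - x)) = (\<Sum>J\<in>mono_box m I. mono_fun J x *\<^sub>R c l J)"
      by metis
    \<comment> \<open>With l = \<open>J j\<close>, the factor collects 1/l! from the Taylor formula
      and the sign (-1)^l from differentiating a translate \<open>l\<close> times.\<close>
    define d where "d J = ((-1) ^ J j / fact (J j)) *\<^sub>R c (J j) (J(j := 0))" for J
    show ?case
    proof (intro exI[of _ d] allI impI)
      fix x :: "real^'n" assume x: "\<forall>i. i \<notin> insert j I \<longrightarrow> x $ i = 0"
      let ?e = "axis j 1 :: real^'n"
      define x' where "x' = x - (x $ j) *\<^sub>R ?e"
      have x'j: "x' $ j = 0" and x'i: "\<And>i. i \<noteq> j \<Longrightarrow> x' $ i = x $ i"
        by (auto simp: x'_def axis_def)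
      have x': "\<forall>i. i \<notin> I \<longrightarrow> x' $ i = 0" using x x'j x'i by (metis insertE)
      define F where "F l t = (-1) ^ l *\<^sub>R T (\<lambda>y. (partial j ^^ l) \<phi> (y - (x' + t *\<^sub>R ?e)))" for l t
      have dF: "(F l has_vector_derivative F (Suc l) t) (at t)" for l t
        unfolding F_def
        using bounded_linear.has_vector_derivative[OF bounded_linear_scaleR_right
            distribution_translate_derivative[OF T pt[of l], of x' j t], of "(-1) ^ l"] by simp
      have Fm: "F m t = 0" for t
      proof -
        have "foldr partial (replicate m j) (\<lambda>y. \<phi> (y - (x' + t *\<^sub>R ?e))) =
          (\<lambda>y. foldr partial (replicate m j) \<phi> (y - (x' + t *\<^sub>R ?e)))"
          by (rule foldr_partial_translate) (rule test_functionsD(1)[OF insert.prems])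
        then have "(\<lambda>y. (partial j ^^ m) \<phi> (y - (x' + t *\<^sub>R ?e))) = (partial j ^^ m) (\<lambda>y. \<phi> (y - (x' + t *\<^sub>R ?e)))"
          by (simp add: foldr_replicate)
        then show ?thesis using nil[OF test_functions_translate[OF insert.prems]] by (simp add: F_def)
      qed
      have mf: "mono_fun (J(j := l)) x = x $ j ^ l * mono_fun J x'" if "J \<in> mono_box m I" for J l
      proof -
        have "J j = 0" using that insert.hyps(2) by (auto simp: mono_box_def)
        then have "mono_fun J x' = (\<Prod>i\<in>UNIV - {j}. x $ i ^ J i)"
          unfolding mono_fun_def by (subst prod.remove[of _ j]) (auto simp: x'i intro!: prod.cong)
        moreover have "mono_fun (J(j := l)) x = x $ j ^ l * (\<Prod>i\<in>UNIV - {j}. x $ i ^ J i)"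
          unfolding mono_fun_def by (subst prod.remove[of _ j]) (auto intro!: prod.cong)
        ultimately show ?thesis by simp
      qed
      have "T (\<lambda>y. \<phi> (y - x)) = F 0 (x $ j)" by (simp add: F_def x'_def)
      also have "\<dots> = (\<Sum>l<m. (x $ j ^ l / fact l) *\<^sub>R F l 0)"
        using dF Fm by (rule taylor_polynomial)
      also have "\<dots> = (\<Sum>l<m. \<Sum>J\<in>mono_box m I. mono_fun (J(j := l)) x *\<^sub>R d (J(j := l)))"
      proof (intro sum.cong refl)
        fix l
        have "F l 0 = (-1) ^ l *\<^sub>R (\<Sum>J\<in>mono_box m I. mono_fun J x' *\<^sub>R c l J)"
          using c[OF x', of l] by (simp add: F_def)
        then have "(x $ j ^ l / fact l) *\<^sub>R F l 0 =
          (\<Sum>J\<in>mono_box m I. (x $ j ^ l / fact l) *\<^sub>R (-1) ^ l *\<^sub>R mono_fun J x' *\<^sub>R c l J)"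
          by (simp add: scaleR_sum_right)
        also have "\<dots> = (\<Sum>J\<in>mono_box m I. mono_fun (J(j := l)) x *\<^sub>R d (J(j := l)))"
        proof (intro sum.cong refl)
          fix J assume J: "J \<in> mono_box m I"
          then have "J(j := 0) = J" using insert.hyps(2) by (auto simp: mono_box_def)
          then show "(x $ j ^ l / fact l) *\<^sub>R (-1) ^ l *\<^sub>R mono_fun J x' *\<^sub>R c l J =
            mono_fun (J(j := l)) x *\<^sub>R d (J(j := l))"
            unfolding mf[OF J] d_def by (simp add: field_simps)
        qed
        finally show "(x $ j ^ l / fact l) *\<^sub>R F l 0 =
          (\<Sum>J\<in>mono_box m I. mono_fun (J(j := l)) x *\<^sub>R d (J(j := l)))" .
      qed
      also have "\<dots> = (\<Sum>J\<in>mono_box m (insert j I). mono_fun J x *\<^sub>R d J)"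
        using mono_box_insert_sum[OF insert.hyps(2), of "\<lambda>J. mono_fun J x *\<^sub>R d J" m] by simp
      finally show "T (\<lambda>y. \<phi> (y - x)) = (\<Sum>J\<in>mono_box m (insert j I). mono_fun J x *\<^sub>R d J)" .
    qed
  qed
  from this[of UNIV \<phi>] \<phi> show thesis using that by auto
qed

section \<open>Smooth bumps and Lebesgue points\<close>

text \<open>The polynomial factor in 1/t makes the family closed under differentiation;
  \<open>q = 1\<close> is the classical flat function exp(-1/t).\<close>

definition bump1 :: "real poly \<Rightarrow> real \<Rightarrow> real" where
  "bump1 q t = (if t > 0 then poly q (1 / t) * exp (- (1 / t)) else 0)"

lemma poly_exp_tendsto_0: "((\<lambda>y::real. poly q y * exp (- y)) \<longlongrightarrow> 0) at_top"
proof -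
  have "((\<lambda>y::real. \<Sum>i\<le>degree q. coeff q i * (y ^ i / exp y)) \<longlongrightarrow> (\<Sum>i\<le>degree q. coeff q i * 0)) at_top"
    by (intro tendsto_sum tendsto_mult tendsto_const tendsto_power_div_exp_0)
  then show ?thesis
    by (simp add: poly_altdef sum_distrib_right exp_minus divide_inverse mult.assoc)
qed

lemma bump1_tendsto_0: "(bump1 q \<longlongrightarrow> 0) (at_right 0)"
proof -
  have "((\<lambda>t::real. poly q (inverse t) * exp (- inverse t)) \<longlongrightarrow> 0) (at_right 0)"
    using filterlim_compose[OF poly_exp_tendsto_0 filterlim_inverse_at_top_right] .
  moreover have "\<forall>\<^sub>F t in at_right 0. poly q (inverse t) * exp (- inverse t) = bump1 q t"
    by (auto simp: eventually_at_right_less bump1_def field_simps intro!: eventually_at_rightI[of 0 1])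
  ultimately show ?thesis by (rule Lim_transform_eventually)
qed

text \<open>With s = 1/t, the derivative of q(s) exp(-s) with respect to \<open>t\<close> is s^2
  (q(s) - q'(s)) exp(-s), which explains the new polynomial. At 0 the right difference quotient is
  again a member of the family, with \<open>q\<close> multiplied by the variable, and tends to
  0.\<close>

lemma bump1_DERIV: "(bump1 q has_real_derivative bump1 ([:0, 0, 1:] * (q - pderiv q)) t) (at t)"
proof -
  consider "t > 0" | "t < 0" | "t = 0" by linarith
  then show ?thesis
  proof cases
    case 1
    have "((\<lambda>t. poly q (1 / t) * exp (- (1 / t))) has_real_derivative
        bump1 ([:0, 0, 1:] * (q - pderiv q)) t) (at t)"
      using 1 by (auto intro!: derivative_eq_intros DERIV_chain2[OF poly_DERIV]
          simp: bump1_def field_simps power2_eq_square)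
    then show ?thesis
      by (rule has_field_derivative_transform_within_open[of _ _ _ "{0<..}"]) (use 1 in \<open>auto simp: bump1_def\<close>)
  next
    case 2
    have "((\<lambda>t. 0) has_real_derivative bump1 ([:0, 0, 1:] * (q - pderiv q)) t) (at t)"
      using 2 by (simp add: bump1_def)
    then show ?thesis
      by (rule has_field_derivative_transform_within_open[of _ _ _ "{..<0}"]) (use 2 in \<open>auto simp: bump1_def\<close>)
  next
    case 3
    have "((\<lambda>h. (bump1 q (0 + h) - bump1 q 0) / h) \<longlongrightarrow> 0) (at 0)"
      unfolding filterlim_at_split
    proof
      show "((\<lambda>h. (bump1 q (0 + h) - bump1 q 0) / h) \<longlongrightarrow> 0) (at_left 0)"
        by (rule tendsto_eventually) (auto simp: bump1_def intro!: eventually_at_leftI[of "-1"])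
      have "\<forall>\<^sub>F h in at_right 0. bump1 ([:0, 1:] * q) h = (bump1 q (0 + h) - bump1 q 0) / h"
        by (rule eventually_at_rightI[of 0 1]) (auto simp: bump1_def)
      then show "((\<lambda>h. (bump1 q (0 + h) - bump1 q 0) / h) \<longlongrightarrow> 0) (at_right 0)"
        by (rule Lim_transform_eventually[OF bump1_tendsto_0])
    qed
    then show ?thesis using 3 by (simp add: has_field_derivative_iff bump1_def)
  qed
qed

lemma smooth_bump1: "smooth_fun (\<lambda>x. bump1 q (c * x $ j + d))"
proof (rule smooth_coinduct[of _ "{\<lambda>x. k * bump1 q (c * x $ j + d) |k q. True}"])
  show "(\<lambda>x. bump1 q (c * x $ j + d)) \<in> {\<lambda>x. k * bump1 q (c * x $ j + d) |k q. True}"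
    by (intro CollectI exI[of _ "1::real"] exI[of _ q]) simp
next
  fix f :: "real^'a \<Rightarrow> real" and i
  assume "f \<in> {\<lambda>x. k * bump1 q (c * x $ j + d) |k q. True}"
  then obtain k q where f: "f = (\<lambda>x. k * bump1 q (c * x $ j + d))" by blast
  define q' where "q' = [:0, 0, 1:] * (q - pderiv q)"
  have d: "(f has_derivative (\<lambda>h. k * (bump1 q' (c * x $ j + d) * (c * h $ j)))) (at x)" for x
  proof -
    have "((\<lambda>x::real^'a. c * x $ j + d) has_derivative (\<lambda>h. c * h $ j)) (at x)"
      by (auto intro!: derivative_eq_intros bounded_linear_imp_has_derivative bounded_linear_vec_nth)
    from has_derivative_compose[OF this bump1_DERIV[of q "c * x $ j + d", unfolded has_field_derivative_def]]
    have "((\<lambda>x. bump1 q (c * x $ j + d)) has_derivative (\<lambda>h. bump1 q' (c * x $ j + d) * (c * h $ j))) (at x)"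
      by (simp add: q'_def)
    then show ?thesis unfolding f by (rule has_derivative_mult_right)
  qed
  show "f differentiable_on UNIV"
    using d by (auto simp: differentiable_on_def differentiable_def)
  have "partial i f = (\<lambda>x. (if i = j then k * c else 0) * bump1 q' (c * x $ j + d))"
    by (rule ext, subst partialI[OF d]) (auto simp: axis_def)
  then show "partial i f \<in> {\<lambda>x. k * bump1 q (c * x $ j + d) |k q. True}" by blast
qed

text \<open>The factor exp(-1/((n+1)s)) tends to 1 for s > 0 and is replaced by 0 for s \<le> 0. The
  limit is therefore the indicator of the open box, with values in [0, 1] throughout and without
  normalisation. As only differences of coordinates occur, the bumps of a shifted box are shifted
  bumps.\<close>

definition box_bump :: "nat \<Rightarrow> real^'n::finite \<Rightarrow> real^'n \<Rightarrow> real^'n \<Rightarrow> real" where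
  "box_bump n a b x =
    (\<Prod>i\<in>UNIV. bump1 1 (real (Suc n) * (x $ i - a $ i)) * bump1 1 (real (Suc n) * (b $ i - x $ i)))"

lemma box_bump_translate: "box_bump n (a + x) (b + x) y = box_bump n a b (y - x)"
  by (simp add: box_bump_def algebra_simps)

lemma bump1_one: "0 \<le> bump1 1 t" "bump1 1 t \<le> 1"
  by (auto simp: bump1_def)

lemma smooth_box_bump: "smooth_fun (box_bump n a b)"
proof -
  have "smooth_fun (\<lambda>x. bump1 1 (real (Suc n) * (x $ i - a $ i)))" for i
    using smooth_bump1[of 1 "real (Suc n)" i "- (real (Suc n) * a $ i)"] by (simp add: algebra_simps)
  moreover have "smooth_fun (\<lambda>x. bump1 1 (real (Suc n) * (b $ i - x $ i)))" for i
    using smooth_bump1[of 1 "- real (Suc n)" i "real (Suc n) * b $ i"] by (simp add: algebra_simps)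
  ultimately show ?thesis unfolding box_bump_def
    by (intro smooth_prod smooth_mult)
qed

lemma box_bump_outside: "x \<notin> box a b \<Longrightarrow> box_bump n a b x = 0"
proof -
  assume "x \<notin> box a b"
  then obtain i where "x $ i \<le> a $ i \<or> b $ i \<le> x $ i" by (auto simp: mem_box_cart not_less)
  then have "bump1 1 (real (Suc n) * (x $ i - a $ i)) * bump1 1 (real (Suc n) * (b $ i - x $ i)) = 0"
    by (auto simp: bump1_def zero_less_mult_iff simp del: of_nat_Suc)
  then show ?thesis unfolding box_bump_def by (intro prod_zero) auto
qed

lemma box_bump_bounds: "0 \<le> box_bump n a b x" "box_bump n a b x \<le> 1"
  unfolding box_bump_def by (auto intro!: prod_nonneg prod_le_1 mult_nonneg_nonneg mult_le_one bump1_one)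

lemma box_bump_tendsto: "(\<lambda>n. box_bump n a b x) \<longlonglongrightarrow> indicator (box a b) x"
proof (cases "x \<in> box a b")
  case True
  have "(\<lambda>n. bump1 1 (real (Suc n) * s)) \<longlonglongrightarrow> 1" if "s > 0" for s
  proof -
    have "(\<lambda>n. exp (- (inverse s * (1 / real (Suc n))))) \<longlonglongrightarrow> exp (- (inverse s * 0))"
      by (intro tendsto_intros LIMSEQ_Suc[OF lim_1_over_n])
    moreover have "exp (- (inverse s * (1 / real (Suc n)))) = bump1 1 (real (Suc n) * s)" for n
      using that by (simp add: bump1_def divide_inverse mult.commute zero_less_mult_iff del: of_nat_Suc)
    ultimately show ?thesis by simp
  qed
  then have "(\<lambda>n. box_bump n a b x) \<longlonglongrightarrow> (\<Prod>i\<in>(UNIV :: 'a set). 1 * 1)"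
    unfolding box_bump_def using True by (intro tendsto_prod tendsto_mult) (auto simp: mem_box_cart)
  then show ?thesis using True by simp
next
  case False
  then show ?thesis by (simp add: box_bump_outside)
qed

lemma box_bump_test:
  assumes "cbox a b \<subseteq> \<Omega>" shows "box_bump n a b \<in> test_functions \<Omega>"
  by (rule test_functionsI[OF smooth_box_bump compact_cbox assms])
    (meson box_bump_outside box_subset_cbox subsetD)

section \<open>Integrals against test functions\<close>

lemma smooth_borel_measurable: "smooth_fun \<phi> \<Longrightarrow> \<phi> \<in> borel_measurable lebesgue"
  by (intro measurable_completion) (simp add: borel_measurable_continuous_onI smooth_continuous)

lemma test_function_integrable:
  assumes "\<phi> \<in> test_functions \<Omega>" "u \<in> L1_loc \<Omega>"
  shows "integrable lebesgue (\<lambda>x. \<phi> x *\<^sub>R u x)"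
proof -
  obtain B where B: "B > 0" "\<And>x. \<bar>\<phi> x\<bar> \<le> B" using test_function_bounded[OF assms(1)] by blast
  let ?K = "supp \<phi>"
  have i: "integrable lebesgue (\<lambda>x. indicator ?K x *\<^sub>R u x)"
    using test_functionsD[OF assms(1)] assms(2) by (auto simp: L1_loc_def set_integrable_def)
  have eq: "\<phi> x *\<^sub>R u x = \<phi> x *\<^sub>R (indicator ?K x *\<^sub>R u x)" for x
    by (cases "x \<in> ?K") (auto simp: zero_outside_supp)
  show ?thesis
  proof (rule Bochner_Integration.integrable_bound[of _ "\<lambda>x. B *\<^sub>R (indicator ?K x *\<^sub>R u x)"])
    show "integrable lebesgue (\<lambda>x. B *\<^sub>R (indicator ?K x *\<^sub>R u x))" by (rule integrable_scaleR_right[OF i])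
    show "(\<lambda>x. \<phi> x *\<^sub>R u x) \<in> borel_measurable lebesgue"
      unfolding eq
      by (rule borel_measurable_scaleR[OF smooth_borel_measurable[OF test_functionsD(1)[OF assms(1)]]
            borel_measurable_integrable[OF i]])
    show "AE x in lebesgue. norm (\<phi> x *\<^sub>R u x) \<le> norm (B *\<^sub>R (indicator ?K x *\<^sub>R u x))"
      unfolding eq norm_scaleR using B by (intro AE_I2 mult_right_mono) auto
  qed
qed

lemma test_function_set_integral:
  assumes "\<phi> \<in> test_functions \<Omega>"
  shows "(LINT x:\<Omega>|lebesgue. \<phi> x *\<^sub>R u x) = (LINT x|lebesgue. \<phi> x *\<^sub>R u x)"
  unfolding set_lebesgue_integral_def
  using test_functionsD(4)[OF assms] by (intro Bochner_Integration.integral_cong) (auto simp: indicator_def)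

text \<open>Dominated convergence with majorant |u| on the closed box, which is a compact subset of
  the domain and so a set on which \<open>u\<close> is integrable; open and closed box give the same
  integral.\<close>

lemma box_bump_integral_tendsto:
  fixes u :: "real^'n \<Rightarrow> 'v::euclidean_space"
  assumes "u \<in> L1_loc \<Omega>" "cbox a b \<subseteq> \<Omega>"
  shows "(\<lambda>n. LINT x:\<Omega>|lebesgue. box_bump n a b x *\<^sub>R u x) \<longlonglongrightarrow> integral (cbox a b) u"
proof -
  have si: "set_integrable lebesgue (cbox a b) u" using assms by (auto simp: L1_loc_def)
  have si': "set_integrable lebesgue (box a b) u"
    by (rule set_integrable_subset[OF si]) (auto simp: box_subset_cbox)
  have "(\<lambda>n. LINT x|lebesgue. box_bump n a b x *\<^sub>R u x) \<longlonglongrightarrow> (LINT x|lebesgue. indicator (box a b) x *\<^sub>R u x)"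
  proof (rule integral_dominated_convergence)
    show "integrable lebesgue (\<lambda>x. norm (indicator (cbox a b) x *\<^sub>R u x))"
      using si by (intro integrable_norm) (simp add: set_integrable_def)
    show "(\<lambda>x. indicator (box a b) x *\<^sub>R u x) \<in> borel_measurable lebesgue"
      using si' by (simp add: set_integrable_def)
    show "(\<lambda>x. box_bump n a b x *\<^sub>R u x) \<in> borel_measurable lebesgue" for n
      using test_function_integrable[OF box_bump_test[OF assms(2)] assms(1)] by simp
    show "AE x in lebesgue. (\<lambda>n. box_bump n a b x *\<^sub>R u x) \<longlonglongrightarrow> indicator (box a b) x *\<^sub>R u x"
      by (intro AE_I2 tendsto_scaleR box_bump_tendsto tendsto_const)
    show "AE x in lebesgue. norm (box_bump n a b x *\<^sub>R u x) \<le> norm (indicator (cbox a b) x *\<^sub>R u x)" for n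
    proof (rule AE_I2)
      fix x :: "real^'n"
      have "\<bar>box_bump n a b x\<bar> \<le> indicator (cbox a b) x"
        using box_bump_bounds[of n a b x] box_bump_outside[of x a b n] box_subset_cbox[of a b]
        by (auto simp: indicator_def)
      then show "norm (box_bump n a b x *\<^sub>R u x) \<le> norm (indicator (cbox a b) x *\<^sub>R u x)"
        by (simp add: mult_right_mono)
    qed
  qed
  moreover have "(LINT x|lebesgue. indicator (box a b) x *\<^sub>R u x) = integral (cbox a b) u"
    using set_lebesgue_integral_eq_integral(2)[OF si'] integral_open_interval[of a b u]
    by (simp add: set_lebesgue_integral_def)
  ultimately show ?thesis by (simp add: test_function_set_integral[OF box_bump_test[OF assms(2)]])
qed

text \<open>A finite-dimensional space of functions is closed under pointwise limits, although the
  coefficients \<open>c j\<close> need not converge, as the functions \<open>b l\<close> may be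
  dependent on \<open>G\<close>. Induction on their number: at a point where \<open>b k\<close> is
  nonzero its coefficient can be solved for, which eliminates \<open>b k\<close>.\<close>

lemma finite_span_limit:
  fixes b :: "'i \<Rightarrow> 'x \<Rightarrow> real" and c :: "nat \<Rightarrow> 'i \<Rightarrow> 'v::real_normed_vector"
  assumes "finite I" "\<And>x. x \<in> G \<Longrightarrow> (\<lambda>j. \<Sum>l\<in>I. b l x *\<^sub>R c j l) \<longlonglongrightarrow> f x"
  obtains d where "\<And>x. x \<in> G \<Longrightarrow> f x = (\<Sum>l\<in>I. b l x *\<^sub>R d l)"
proof -
  have "\<exists>d. \<forall>x\<in>G. f x = (\<Sum>l\<in>I. b l x *\<^sub>R d l)" using assms
  proof (induction I arbitrary: b f rule: finite_induct)
    case empty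
    then show ?case by (auto simp: LIMSEQ_const_iff)
  next
    case (insert k I)
    show ?case
    proof (cases "\<forall>x\<in>G. b k x = 0")
      case True
      have "\<exists>d. \<forall>x\<in>G. f x = (\<Sum>l\<in>I. b l x *\<^sub>R d l)"
        using insert.prems True insert.hyps by (intro insert.IH) auto
      then show ?thesis using True insert.hyps by auto
    next
      case False
      then obtain x0 where x0: "x0 \<in> G" "b k x0 \<noteq> 0" by blast
      define b' where "b' l x = b l x - b k x / b k x0 * b l x0" for l x
      have "\<exists>d. \<forall>x\<in>G. f x - (b k x / b k x0) *\<^sub>R f x0 = (\<Sum>l\<in>I. b' l x *\<^sub>R d l)"
      proof (rule insert.IH)
        fix x assume x: "x \<in> G"
        have "(\<lambda>j. (\<Sum>l\<in>insert k I. b l x *\<^sub>R c j l) - (b k x / b k x0) *\<^sub>R (\<Sum>l\<in>insert k I. b l x0 *\<^sub>R c j l))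
          \<longlonglongrightarrow> f x - (b k x / b k x0) *\<^sub>R f x0"
          by (intro tendsto_diff tendsto_scaleR tendsto_const insert.prems x x0)
        moreover have "(\<Sum>l\<in>insert k I. b l x *\<^sub>R c j l) - (b k x / b k x0) *\<^sub>R (\<Sum>l\<in>insert k I. b l x0 *\<^sub>R c j l)
          = (\<Sum>l\<in>I. b' l x *\<^sub>R c j l)" for j
          using insert.hyps x0(2)
          by (simp add: b'_def scaleR_diff_left sum_subtractf scaleR_sum_right scaleR_add_right)
        ultimately show "(\<lambda>j. \<Sum>l\<in>I. b' l x *\<^sub>R c j l) \<longlonglongrightarrow> f x - (b k x / b k x0) *\<^sub>R f x0" by simp
      qed
      then obtain d where d: "\<And>x. x \<in> G \<Longrightarrow> f x - (b k x / b k x0) *\<^sub>R f x0 = (\<Sum>l\<in>I. b' l x *\<^sub>R d l)" by blast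
      \<comment> \<open>The coefficient of \<open>b k\<close> is the one forced by the equation at
        \<open>x0\<close>.\<close>
      define d' where "d' = d(k := (1 / b k x0) *\<^sub>R (f x0 - (\<Sum>l\<in>I. b l x0 *\<^sub>R d l)))"
      have "f x = (\<Sum>l\<in>insert k I. b l x *\<^sub>R d' l)" if "x \<in> G" for x
      proof -
        have "(\<Sum>l\<in>I. b l x *\<^sub>R d' l) = (\<Sum>l\<in>I. b l x *\<^sub>R d l)"
          using insert.hyps by (intro sum.cong) (auto simp: d'_def)
        moreover have "(\<Sum>l\<in>I. b' l x *\<^sub>R d l) = (\<Sum>l\<in>I. b l x *\<^sub>R d l) - (b k x / b k x0) *\<^sub>R (\<Sum>l\<in>I. b l x0 *\<^sub>R d l)"
          by (simp add: b'_def scaleR_diff_left sum_subtractf scaleR_sum_right)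
        moreover have "f x = (b k x / b k x0) *\<^sub>R f x0 + (\<Sum>l\<in>I. b' l x *\<^sub>R d l)"
          using d[OF that] by (simp add: algebra_simps)
        ultimately show ?thesis using insert.hyps by (simp add: d'_def scaleR_diff_right)
      qed
      then show ?thesis by blast
    qed
  qed
  then show thesis using that by blast
qed

lemma AE_lebesgue_onI:
  assumes "open \<Omega>" "negligible N" "\<And>x. x \<in> \<Omega> \<Longrightarrow> x \<notin> N \<Longrightarrow> P x"
  shows "AE x in lebesgue_on \<Omega>. P x"
proof -
  have "AE x in lebesgue. x \<in> \<Omega> \<longrightarrow> P x"
    using assms(2,3) by (intro AE_I'[of N]) (auto simp: negligible_iff_null_sets)
  then show ?thesis using assms(1) by (simp add: AE_restrict_space_iff)
qed

text \<open>The function is integrable only on compact parts of the domain. It is cut off to each of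
  countably many closed boxes covering the domain, and the boundaries of these boxes join the
  exceptional set: any other point is interior to its box, so that small cubes at this point do not
  notice the cut-off.\<close>

lemma lebesgue_points:
  fixes u :: "real^'n \<Rightarrow> 'v::euclidean_space"
  assumes "open \<Omega>" "u \<in> L1_loc \<Omega>"
  defines "h \<equiv> \<lambda>n. 1 / real (Suc n)"
  shows "\<exists>N. negligible N \<and> (\<forall>x\<in>\<Omega> - N. \<forall>\<^sub>F n in sequentially. cbox x (x + h n *\<^sub>R One) \<subseteq> \<Omega>) \<and>
    (\<forall>x\<in>\<Omega> - N. (\<lambda>n. integral (cbox x (x + h n *\<^sub>R One)) u /\<^sub>R h n ^ DIM(real^'n)) \<longlonglongrightarrow> u x)"
proof -
  obtain D where D: "countable D" "D \<subseteq> Pow \<Omega>" "\<And>X. X \<in> D \<Longrightarrow> \<exists>a b. X = cbox a b" "\<Union>D = \<Omega>"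
    using open_countable_Union_open_cbox[OF assms(1)] by metis
  then obtain a b where ab: "\<And>X. X \<in> D \<Longrightarrow> X = cbox (a X) (b X)" by metis
  define f where "f X = (\<lambda>x. indicator X x *\<^sub>R u x)" for X
  have "\<exists>N. negligible N \<and> (\<forall>x e. x \<notin> N \<and> 0 < e \<longrightarrow> (\<exists>d>0. \<forall>h. 0 < h \<and> h < d \<longrightarrow>
      norm (integral (cbox x (x + h *\<^sub>R One)) (f X) /\<^sub>R h ^ DIM(real^'n) - f X x) < e))" if X: "X \<in> D" for X
  proof -
    have "compact X" using ab[OF X] compact_cbox by metis
    then have "set_integrable lebesgue X u" using assms(2) X D(2) by (auto simp: L1_loc_def)
    then have "integrable lebesgue (f X)" by (simp add: set_integrable_def f_def)
    then have "f X absolutely_integrable_on UNIV" by (simp add: set_integrable_def)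
    then have "f X integrable_on UNIV" by (rule set_lebesgue_integral_eq_integral(1))
    then have "\<And>a b. f X integrable_on cbox a b" by (rule integrable_on_subcbox) auto
    then show ?thesis using integrable_ccontinuous_explicit[of "f X"] by metis
  qed
  then obtain N where N: "\<And>X. X \<in> D \<Longrightarrow> negligible (N X)"
    "\<And>X x e. X \<in> D \<Longrightarrow> x \<notin> N X \<Longrightarrow> 0 < e \<Longrightarrow> \<exists>d>0. \<forall>h. 0 < h \<and> h < d \<longrightarrow>
      norm (integral (cbox x (x + h *\<^sub>R One)) (f X) /\<^sub>R h ^ DIM(real^'n) - f X x) < e"
    by metis
  define M where "M = \<Union>((\<lambda>X. N X \<union> (cbox (a X) (b X) - box (a X) (b X))) ` D)"
  have M: "negligible M" unfolding M_def
    using D(1) N(1) negligible_frontier_interval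
    by (intro negligible_countable_Union) (auto intro!: negligible_Un)
  have small: "\<exists>d>0. \<forall>h. 0 < h \<and> h < d \<longrightarrow> cbox x (x + h *\<^sub>R One) \<subseteq> X" if "X \<in> D" "x \<in> X" "x \<notin> M" for x X
  proof -
    have "x \<in> box (a X) (b X)" using that ab[of X] by (auto simp: M_def)
    then obtain d where d: "d > 0" "ball x d \<subseteq> box (a X) (b X)"
      using open_contains_ball open_box by blast
    define e where "e = d / (1 + norm (One :: real^'n))"
    have pos: "1 + norm (One :: real^'n) > 0" by (simp add: add_pos_nonneg)
    have "cbox x (x + h *\<^sub>R One) \<subseteq> ball x d" if "0 < h" "h < e" for h
    proof
      fix y assume "y \<in> cbox x (x + h *\<^sub>R One)"
      then have "\<And>i. i \<in> Basis \<Longrightarrow> \<bar>(y - x) \<bullet> i\<bar> \<le> \<bar>(h *\<^sub>R One) \<bullet> i\<bar>"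
        using that(1) by (auto simp: mem_box inner_diff_left inner_add_left)
      then have "norm (y - x) \<le> norm (h *\<^sub>R (One :: real^'n))" by (rule norm_le_componentwise)
      also have "\<dots> \<le> h * (1 + norm (One :: real^'n))" using that(1) by (simp add: algebra_simps)
      also have "\<dots> < d" using that(2) pos by (simp add: e_def field_simps)
      finally show "y \<in> ball x d" by (simp add: dist_norm norm_minus_commute)
    qed
    moreover have "e > 0" using d pos by (simp add: e_def)
    moreover have "ball x d \<subseteq> X" using d(2) ab[OF \<open>X \<in> D\<close>] box_subset_cbox by blast
    ultimately show ?thesis by blast
  qed
  have ev: "\<forall>\<^sub>F n in sequentially. h n < d" if "d > 0" for d
    using order_tendstoD(2)[OF LIMSEQ_Suc[OF lim_1_over_n] that] by (simp add: h_def)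
  have point: "(\<forall>\<^sub>F n in sequentially. cbox x (x + h n *\<^sub>R One) \<subseteq> \<Omega>) \<and>
      (\<lambda>n. integral (cbox x (x + h n *\<^sub>R One)) u /\<^sub>R h n ^ DIM(real^'n)) \<longlonglongrightarrow> u x"
    if x: "x \<in> \<Omega>" "x \<notin> M" for x
  proof -
    from x obtain X where X: "X \<in> D" "x \<in> X" using D(4) by blast
    obtain d where d: "d > 0" "\<And>h. 0 < h \<Longrightarrow> h < d \<Longrightarrow> cbox x (x + h *\<^sub>R One) \<subseteq> X"
      using small[OF X x(2)] by blast
    have XO: "X \<subseteq> \<Omega>" using X(1) D(2) by blast
    have "\<forall>\<^sub>F n in sequentially. cbox x (x + h n *\<^sub>R One) \<subseteq> \<Omega>"
      using ev[OF d(1)]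
    proof eventually_elim
      case (elim n)
      show ?case by (rule subset_trans[OF d(2)[OF _ elim] XO]) (simp add: h_def)
    qed
    moreover have "(\<lambda>n. integral (cbox x (x + h n *\<^sub>R One)) u /\<^sub>R h n ^ DIM(real^'n)) \<longlonglongrightarrow> u x"
    proof (rule tendstoI)
      fix e :: real assume e: "e > 0"
      have "x \<notin> N X" using x(2) X(1) by (auto simp: M_def)
      then obtain d' where d': "d' > 0" "\<And>h. 0 < h \<Longrightarrow> h < d' \<Longrightarrow>
        norm (integral (cbox x (x + h *\<^sub>R One)) (f X) /\<^sub>R h ^ DIM(real^'n) - f X x) < e"
        using N(2)[OF X(1) _ e] by blast
      show "\<forall>\<^sub>F n in sequentially. dist (integral (cbox x (x + h n *\<^sub>R One)) u /\<^sub>R h n ^ DIM(real^'n)) (u x) < e"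
        using ev[OF d(1)] ev[OF d'(1)]
      proof eventually_elim
        case (elim n)
        have pos: "0 < h n" by (simp add: h_def)
        have "integral (cbox x (x + h n *\<^sub>R One)) (f X) = integral (cbox x (x + h n *\<^sub>R One)) u"
          using d(2)[OF pos elim(1)] by (intro integral_cong) (auto simp: f_def)
        moreover have "f X x = u x" using X(2) by (simp add: f_def)
        ultimately show ?case using d'(2)[OF pos elim(2)] by (simp only: dist_norm)
      qed
    qed
    ultimately show ?thesis by blast
  qed
  show ?thesis by (intro exI[of _ M] conjI M ballI; use point in blast)
qed

section \<open>Weak derivatives\<close>

text \<open>Two limits, both passing through \<open>finite_span_limit\<close>. For a fixed cube
  size, bump integrals converge to integrals of \<open>r\<close> over cubes, which are thus
  polynomial in the corner, as long as the cube fits into the domain. Division by the volume and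
  shrinking cubes recover \<open>r\<close>. The degree bound survives both limits; no convergence of
  coefficients is claimed.\<close>

lemma polynomial_representation:
  fixes T :: "(real^'n \<Rightarrow> real) \<Rightarrow> 'v::euclidean_space"
  assumes T: "distribution T"
    and nil: "\<And>\<phi> i. \<phi> \<in> test_functions UNIV \<Longrightarrow> T ((partial i ^^ m) \<phi>) = 0"
    and \<Omega>: "open \<Omega>" and r: "r \<in> L1_loc \<Omega>"
    and rep: "\<And>\<phi>. \<phi> \<in> test_functions \<Omega> \<Longrightarrow> T \<phi> = (LINT x:\<Omega>|lebesgue. \<phi> x *\<^sub>R r x)"
  obtains c where "AE x in lebesgue_on \<Omega>. r x = poly_fun m c x"
proof -
  define h where "h n = 1 / real (Suc n)" for n
  let ?Q = "\<lambda>n x::real^'n. cbox x (x + h n *\<^sub>R One)"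
  have "\<exists>d. \<forall>x\<in>{x. ?Q n x \<subseteq> \<Omega>}. integral (?Q n x) r = poly_fun m d x" for n
  proof -
    have bt: "box_bump j 0 (h n *\<^sub>R One) \<in> test_functions UNIV" for j by (rule box_bump_test) simp
    have "\<exists>c. \<forall>x. T (\<lambda>y. box_bump j 0 (h n *\<^sub>R One) (y - x)) = poly_fun m c x" for j
      by (rule distribution_translate_polynomial[OF T nil bt]) blast+
    then obtain c where c: "\<And>j x. T (\<lambda>y. box_bump j 0 (h n *\<^sub>R One) (y - x)) = poly_fun m (c j) x"
      by metis
    have lim: "(\<lambda>j. poly_fun m (c j) x) \<longlonglongrightarrow> integral (?Q n x) r" if "?Q n x \<subseteq> \<Omega>" for x
    proof -
      have "(\<lambda>y. box_bump j 0 (h n *\<^sub>R One) (y - x)) = box_bump j x (x + h n *\<^sub>R One)" for j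
        using box_bump_translate[of j 0 x "h n *\<^sub>R One"] by (auto simp: add.commute)
      then have "poly_fun m (c j) x =
          (LINT y:\<Omega>|lebesgue. box_bump j x (x + h n *\<^sub>R One) y *\<^sub>R r y)" for j
        using rep[OF box_bump_test[OF that]] c[of j x] by simp
      then show ?thesis using box_bump_integral_tendsto[OF r that] by simp
    qed
    show ?thesis
      by (rule finite_span_limit[of "mono_box m UNIV" "{x. ?Q n x \<subseteq> \<Omega>}" mono_fun c "\<lambda>x. integral (?Q n x) r"])
        (use lim finite_mono_box in auto)
  qed
  then have "\<exists>d. \<forall>n. \<forall>x\<in>{x. ?Q n x \<subseteq> \<Omega>}. integral (?Q n x) r = poly_fun m (d n) x"
    by (intro choice allI)
  then obtain d where d: "\<And>n x. ?Q n x \<subseteq> \<Omega> \<Longrightarrow> integral (?Q n x) r = poly_fun m (d n) x"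
    by auto
  have "\<exists>N. negligible N \<and> (\<forall>x\<in>\<Omega> - N. \<forall>\<^sub>F n in sequentially. ?Q n x \<subseteq> \<Omega>) \<and>
    (\<forall>x\<in>\<Omega> - N. (\<lambda>n. integral (?Q n x) r /\<^sub>R (h n) ^ DIM(real^'n)) \<longlonglongrightarrow> r x)"
    unfolding h_def by (rule lebesgue_points[OF \<Omega> r])
  then obtain N where N: "negligible N" "\<forall>x\<in>\<Omega> - N. \<forall>\<^sub>F n in sequentially. ?Q n x \<subseteq> \<Omega>"
    "\<forall>x\<in>\<Omega> - N. (\<lambda>n. integral (?Q n x) r /\<^sub>R (h n) ^ DIM(real^'n)) \<longlonglongrightarrow> r x"
    by (elim exE conjE)
  have lim: "(\<lambda>n. poly_fun m (\<lambda>J. d n J /\<^sub>R (h n) ^ DIM(real^'n)) x) \<longlonglongrightarrow> r x"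
    if "x \<in> \<Omega> - N" for x
  proof (rule Lim_transform_eventually[OF bspec[OF N(3) that]])
    show "\<forall>\<^sub>F n in sequentially. integral (?Q n x) r /\<^sub>R (h n) ^ DIM(real^'n) =
      poly_fun m (\<lambda>J. d n J /\<^sub>R (h n) ^ DIM(real^'n)) x"
      using bspec[OF N(2) that]
    proof eventually_elim
      case (elim n)
      show ?case unfolding d[OF elim] by (simp add: scaleR_sum_right mult.commute)
    qed
  qed
  show thesis
  proof (rule finite_span_limit[OF finite_mono_box lim])
    fix c assume "\<And>x. x \<in> \<Omega> - N \<Longrightarrow> r x = poly_fun m c x"
    then show thesis by (intro that[of c] AE_lebesgue_onI[OF \<Omega> N(1)]) blast
  qed
qed

text \<open>The case \<open>T = 0\<close>, \<open>m = 0\<close> of the previous lemma, where the sum is empty.\<close>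

lemma fundamental_lemma:
  fixes u :: "real^'n \<Rightarrow> 'v::euclidean_space"
  assumes "open \<Omega>" "u \<in> L1_loc \<Omega>"
    "\<And>\<phi>. \<phi> \<in> test_functions \<Omega> \<Longrightarrow> (LINT x:\<Omega>|lebesgue. \<phi> x *\<^sub>R u x) = 0"
  shows "AE x in lebesgue_on \<Omega>. u x = 0"
proof -
  have "distribution (\<lambda>\<phi>::real^'n \<Rightarrow> real. 0 :: 'v)"
    unfolding distribution_def by (auto intro!: exI[of _ 0])
  then show ?thesis
  proof (rule polynomial_representation[of _ 0])
    fix c assume "AE x in lebesgue_on \<Omega>. u x = poly_fun 0 c x"
    moreover have "mono_box 0 (UNIV :: 'n set) = {}" by (auto simp: mono_box_def)
    ultimately show ?thesis by simp
  qed (use assms in auto)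
qed

section \<open>Local integrability and uniqueness of weak derivatives\<close>

lemma L1_loc_add: "u \<in> L1_loc \<Omega> \<Longrightarrow> v \<in> L1_loc \<Omega> \<Longrightarrow> (\<lambda>x. u x + v x) \<in> L1_loc \<Omega>"
  by (auto simp: L1_loc_def intro: set_integral_add)

lemma L1_loc_linear:
  assumes "linear f" "u \<in> L1_loc \<Omega>" shows "(\<lambda>x. f (u x)) \<in> L1_loc \<Omega>"
proof -
  have "set_integrable lebesgue K (\<lambda>x. f (u x))" if "compact K" "K \<subseteq> \<Omega>" for K
  proof -
    have "set_integrable lebesgue K u" using assms that by (auto simp: L1_loc_def)
    moreover have "bounded_linear f" using assms(1) by (simp add: linear_conv_bounded_linear)
    ultimately have "integrable lebesgue (\<lambda>x. f (indicator K x *\<^sub>R u x))"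
      unfolding set_integrable_def by (rule integrable_bounded_linear[rotated])
    then show ?thesis using assms(1) by (simp add: set_integrable_def linear_cmul)
  qed
  then show ?thesis by (simp add: L1_loc_def)
qed

lemma L1_loc_scaleR: "u \<in> L1_loc \<Omega> \<Longrightarrow> (\<lambda>x. c *\<^sub>R u x) \<in> L1_loc \<Omega>"
  by (rule L1_loc_linear[of "\<lambda>x. c *\<^sub>R x"]) auto

lemma L1_loc_zero: "(\<lambda>x. 0) \<in> L1_loc \<Omega>"
  by (simp add: L1_loc_def set_integrable_def)

lemma L1_loc_sum: "(\<And>i. i \<in> I \<Longrightarrow> u i \<in> L1_loc \<Omega>) \<Longrightarrow> (\<lambda>x. \<Sum>i\<in>I. u i x) \<in> L1_loc \<Omega>"
  by (induction I rule: infinite_finite_induct) (auto intro: L1_loc_add L1_loc_zero)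

lemma L1_loc_continuous:
  assumes "continuous_on UNIV u" shows "u \<in> L1_loc \<Omega>"
proof -
  have "set_integrable lebesgue K u" if "compact K" for K
  proof -
    have "integrable lborel (\<lambda>x. indicator K x *\<^sub>R u x)"
      by (rule borel_integrable_compact[OF that]) (use assms continuous_on_subset in blast)
    then show ?thesis unfolding set_integrable_def
      by (subst integrable_completion) auto
  qed
  then show ?thesis by (simp add: L1_loc_def)
qed

lemma integral_linear_test:
  assumes "linear f" "\<phi> \<in> test_functions \<Omega>" "u \<in> L1_loc \<Omega>"
  shows "(LINT x:\<Omega>|lebesgue. \<phi> x *\<^sub>R f (u x)) = f (LINT x:\<Omega>|lebesgue. \<phi> x *\<^sub>R u x)"
proof -
  have "(LINT x|lebesgue. f (\<phi> x *\<^sub>R u x)) = f (LINT x|lebesgue. \<phi> x *\<^sub>R u x)"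
    using assms(1) test_function_integrable[OF assms(2,3)]
    by (intro integral_bounded_linear) (simp_all add: linear_conv_bounded_linear)
  then show ?thesis
    using assms(1) by (simp add: test_function_set_integral[OF assms(2)] linear_cmul)
qed

lemma integral_add_test:
  assumes "\<phi> \<in> test_functions \<Omega>" "u \<in> L1_loc \<Omega>" "v \<in> L1_loc \<Omega>"
  shows "(LINT x:\<Omega>|lebesgue. \<phi> x *\<^sub>R (u x + v x)) =
    (LINT x:\<Omega>|lebesgue. \<phi> x *\<^sub>R u x) + (LINT x:\<Omega>|lebesgue. \<phi> x *\<^sub>R v x)"
  using test_function_integrable[OF assms(1,2)] test_function_integrable[OF assms(1,3)]
  unfolding test_function_set_integral[OF assms(1)] by (simp add: scaleR_add_right)

lemma integral_sum_test:
  assumes "\<phi> \<in> test_functions \<Omega>" "\<And>i. i \<in> I \<Longrightarrow> u i \<in> L1_loc \<Omega>"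
  shows "(LINT x:\<Omega>|lebesgue. \<phi> x *\<^sub>R (\<Sum>i\<in>I. u i x)) = (\<Sum>i\<in>I. LINT x:\<Omega>|lebesgue. \<phi> x *\<^sub>R u i x)"
  unfolding test_function_set_integral[OF assms(1)] unfolding scaleR_sum_right
  by (rule Bochner_Integration.integral_sum) (rule test_function_integrable[OF assms])

lemma mi_partial_test: "\<phi> \<in> test_functions \<Omega> \<Longrightarrow> mi_partial \<alpha> \<phi> \<in> test_functions \<Omega>"
  by (simp add: mi_partial_foldr test_functions_foldr)

lemma has_weak_deriv_add:
  assumes "has_weak_deriv \<Omega> \<alpha> u v" "has_weak_deriv \<Omega> \<alpha> u' v'"
  shows "has_weak_deriv \<Omega> \<alpha> (\<lambda>x. u x + u' x) (\<lambda>x. v x + v' x)"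
  unfolding has_weak_deriv_def
proof (intro conjI ballI)
  have L: "u \<in> L1_loc \<Omega>" "v \<in> L1_loc \<Omega>" "u' \<in> L1_loc \<Omega>" "v' \<in> L1_loc \<Omega>"
    using assms by (auto simp: has_weak_deriv_def)
  show "(\<lambda>x. u x + u' x) \<in> L1_loc \<Omega>" "(\<lambda>x. v x + v' x) \<in> L1_loc \<Omega>"
    using L by (auto intro: L1_loc_add)
  fix \<phi> assume \<phi>: "\<phi> \<in> test_functions \<Omega>"
  show "(LINT x:\<Omega>|lebesgue. mi_partial \<alpha> \<phi> x *\<^sub>R (u x + u' x)) =
    (-1) ^ mi_order \<alpha> *\<^sub>R (LINT x:\<Omega>|lebesgue. \<phi> x *\<^sub>R (v x + v' x))"
    unfolding integral_add_test[OF mi_partial_test[OF \<phi>] L(1,3)] integral_add_test[OF \<phi> L(2,4)]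
    using assms \<phi> by (simp add: has_weak_deriv_def scaleR_add_right)
qed

lemma has_weak_deriv_scaleR:
  assumes "has_weak_deriv \<Omega> \<alpha> u v"
  shows "has_weak_deriv \<Omega> \<alpha> (\<lambda>x. c *\<^sub>R u x) (\<lambda>x. c *\<^sub>R v x)"
  unfolding has_weak_deriv_def
proof (intro conjI ballI)
  have L: "u \<in> L1_loc \<Omega>" "v \<in> L1_loc \<Omega>"
    using assms by (auto simp: has_weak_deriv_def)
  show "(\<lambda>x. c *\<^sub>R u x) \<in> L1_loc \<Omega>" "(\<lambda>x. c *\<^sub>R v x) \<in> L1_loc \<Omega>"
    using L by (auto intro: L1_loc_scaleR)
  fix \<phi> assume \<phi>: "\<phi> \<in> test_functions \<Omega>"
  have lin: "linear (\<lambda>x::'b. c *\<^sub>R x)" by simp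
  show "(LINT x:\<Omega>|lebesgue. mi_partial \<alpha> \<phi> x *\<^sub>R c *\<^sub>R u x) =
    (-1) ^ mi_order \<alpha> *\<^sub>R (LINT x:\<Omega>|lebesgue. \<phi> x *\<^sub>R c *\<^sub>R v x)"
    unfolding integral_linear_test[OF lin mi_partial_test[OF \<phi>] L(1)] integral_linear_test[OF lin \<phi> L(2)]
    using assms \<phi> by (simp add: has_weak_deriv_def mult.commute)
qed

text \<open>The difference of two candidates is a weak derivative of 0, so its integral against
  every test function vanishes.\<close>

lemma has_weak_deriv_unique:
  assumes "open \<Omega>" "has_weak_deriv \<Omega> \<alpha> u v" "has_weak_deriv \<Omega> \<alpha> u w"
  shows "AE x in lebesgue_on \<Omega>. v x = w x"
proof -
  have "has_weak_deriv \<Omega> \<alpha> (\<lambda>x. u x + (-1) *\<^sub>R u x) (\<lambda>x. v x + (-1) *\<^sub>R w x)"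
    by (intro has_weak_deriv_add has_weak_deriv_scaleR assms)
  then have d: "has_weak_deriv \<Omega> \<alpha> (\<lambda>x. 0) (\<lambda>x. v x + (-1) *\<^sub>R w x)" by simp
  have "AE x in lebesgue_on \<Omega>. v x + (-1) *\<^sub>R w x = 0"
  proof (rule fundamental_lemma[OF assms(1)])
    show "(\<lambda>x. v x + (-1) *\<^sub>R w x) \<in> L1_loc \<Omega>" using d by (simp only: has_weak_deriv_def)
    fix \<phi> assume "\<phi> \<in> test_functions \<Omega>"
    then have "(LINT x:\<Omega>|lebesgue. mi_partial \<alpha> \<phi> x *\<^sub>R (0::'b)) =
      (-1) ^ mi_order \<alpha> *\<^sub>R (LINT x:\<Omega>|lebesgue. \<phi> x *\<^sub>R (v x + (-1) *\<^sub>R w x))"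
      using d by (simp only: has_weak_deriv_def)
    then show "(LINT x:\<Omega>|lebesgue. \<phi> x *\<^sub>R (v x + (-1) *\<^sub>R w x)) = 0"
      by (simp add: set_lebesgue_integral_def)
  qed
  then show ?thesis by eventually_elim simp
qed

text \<open>Whatever \<open>SOME\<close> selects differs from any other weak derivative on a null
  set only. Later arguments exhibit a concrete weak derivative and pass to \<open>weak_deriv\<close>
  in this way.\<close>

lemma weak_deriv:
  assumes "open \<Omega>" "has_weak_deriv \<Omega> \<alpha> u v"
  shows "has_weak_deriv \<Omega> \<alpha> u (weak_deriv \<Omega> \<alpha> u)" "AE x in lebesgue_on \<Omega>. weak_deriv \<Omega> \<alpha> u x = v x"
proof -
  show *: "has_weak_deriv \<Omega> \<alpha> u (weak_deriv \<Omega> \<alpha> u)"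
    unfolding weak_deriv_def using assms(2) by (rule someI[of "has_weak_deriv \<Omega> \<alpha> u"])
  show "AE x in lebesgue_on \<Omega>. weak_deriv \<Omega> \<alpha> u x = v x"
    using has_weak_deriv_unique[OF assms(1) * assms(2)] .
qed

lemma has_weak_deriv_cong_AE:
  assumes "open \<Omega>" "has_weak_deriv \<Omega> \<alpha> u v" "u' \<in> L1_loc \<Omega>" "AE x in lebesgue_on \<Omega>. u' x = u x"
  shows "has_weak_deriv \<Omega> \<alpha> u' v"
proof -
  have ae: "AE x in lebesgue. x \<in> \<Omega> \<longrightarrow> u' x = u x"
    using assms(1,4) by (simp add: AE_restrict_space_iff)
  have "(LINT x:\<Omega>|lebesgue. \<psi> x *\<^sub>R u' x) = (LINT x:\<Omega>|lebesgue. \<psi> x *\<^sub>R u x)" if "\<psi> \<in> test_functions \<Omega>" for \<psi>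
    unfolding test_function_set_integral[OF that]
  proof (rule integral_cong_AE)
    show "AE x in lebesgue. \<psi> x *\<^sub>R u' x = \<psi> x *\<^sub>R u x"
      using ae by eventually_elim (use test_functionsD(4)[OF that] in force)
    show "(\<lambda>x. \<psi> x *\<^sub>R u' x) \<in> borel_measurable lebesgue"
      using borel_measurable_integrable[OF test_function_integrable[OF that assms(3)]] .
    show "(\<lambda>x. \<psi> x *\<^sub>R u x) \<in> borel_measurable lebesgue"
      using assms(2) by (intro borel_measurable_integrable[OF test_function_integrable[OF that]]) (simp add: has_weak_deriv_def)
  qed
  then show ?thesis using assms(2,3) by (simp add: has_weak_deriv_def mi_partial_test)
qed

section \<open>Integration by parts and weak derivatives of smooth functions\<close>

lemma test_function_integrable_real: "\<phi> \<in> test_functions \<Omega> \<Longrightarrow> integrable lebesgue \<phi>"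
  using test_function_integrable[of \<phi> \<Omega> "\<lambda>_. 1::real"] L1_loc_continuous[of "\<lambda>_. 1::real" \<Omega>] by simp

lemma lebesgue_integral_translate:
  fixes f :: "'a::euclidean_space \<Rightarrow> real"
  assumes "continuous_on UNIV f"
  shows "(LINT x|lebesgue. f (x - a)) = (LINT x|lebesgue. f x)"
proof -
  have m: "f \<in> borel_measurable borel" "(\<lambda>x. f (x - a)) \<in> borel_measurable borel"
    using assms by (auto intro!: borel_measurable_continuous_onI continuous_on_compose2[OF assms] continuous_intros)
  have "(LINT x|lborel. f x) = (LINT x|distr lborel borel ((+) (-a)). f x)"
    by (simp only: lborel_distr_plus)
  also have "\<dots> = (LINT x|lborel. f (- a + x))"
    by (rule integral_distr) (use m in auto)
  finally show ?thesis using m by (simp add: integral_completion)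
qed

text \<open>By translation invariance the difference quotients of \<open>\<psi>\<close> have integral 0, and they differ
  from the derivative by \<open>O(t)\<close>, uniformly and on a fixed compact set.\<close>

lemma integral_partial_zero:
  fixes \<psi> :: "real^'n \<Rightarrow> real"
  assumes \<psi>: "\<psi> \<in> test_functions UNIV"
  shows "(LINT x|lebesgue. partial i \<psi> x) = 0"
proof -
  let ?e = "axis i 1 :: real^'n"
  obtain B where B: "B > 0" "\<And>x. \<bar>partial i (partial i \<psi>) x\<bar> \<le> B"
    using test_function_bounded[OF test_functions_partial[OF test_functions_partial[OF \<psi>]]] by metis
  define K where "K = (\<lambda>z. fst z + snd z) ` (supp \<psi> \<times> ((\<lambda>h. h *\<^sub>R ?e) ` {-1..1}))"
  have K: "compact K" unfolding K_def
    using test_functionsD(2)[OF \<psi>]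
    by (intro compact_continuous_image compact_Times continuous_intros) auto
  define M where "M = B * measure lebesgue K"
  have Ki: "integrable lebesgue (indicator K :: _ \<Rightarrow> real)"
    using lmeasurable_compact[OF K] by (simp add: lmeasurable_iff_integrable)
  have est: "t * \<bar>LINT x|lebesgue. partial i \<psi> x\<bar> \<le> t\<^sup>2 * M" if t: "0 < t" "t \<le> 1" for t
  proof -
    let ?D = "\<lambda>x. \<psi> (x - (-t) *\<^sub>R ?e) - \<psi> x - t * partial i \<psi> x"
    have 1: "integrable lebesgue (\<lambda>x. \<psi> (x - (-t) *\<^sub>R ?e))"
      by (rule test_function_integrable_real[OF test_functions_translate[OF \<psi>]])
    note 2 = test_function_integrable_real[OF \<psi>]
    note 3 = test_function_integrable_real[OF test_functions_partial[OF \<psi>, of i]]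
    have "(LINT x|lebesgue. ?D x) = (LINT x|lebesgue. \<psi> (x - (-t) *\<^sub>R ?e)) - (LINT x|lebesgue. \<psi> x) - t * (LINT x|lebesgue. partial i \<psi> x)"
      using 1 2 3 by simp
    also have "\<dots> = - t * (LINT x|lebesgue. partial i \<psi> x)"
      using lebesgue_integral_translate[OF smooth_continuous[OF test_functionsD(1)[OF \<psi>]], of "(-t) *\<^sub>R ?e"] by simp
    finally have "t * \<bar>LINT x|lebesgue. partial i \<psi> x\<bar> = \<bar>LINT x|lebesgue. ?D x\<bar>"
      using t by (simp add: abs_mult)
    also have "\<dots> \<le> (LINT x|lebesgue. (B * t\<^sup>2) * indicator K x)"
    proof (rule integral_abs_bound_integral)
      show "integrable lebesgue ?D" using 1 2 3 by simp
      show "integrable lebesgue (\<lambda>x. (B * t\<^sup>2) * indicator K x :: real)" using Ki by (rule integrable_mult_right)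
      fix x
      show "\<bar>?D x\<bar> \<le> (B * t\<^sup>2) * indicator K x"
      proof (cases "x \<in> K")
        case True
        then show ?thesis
          using second_order_estimate[OF test_functionsD(1)[OF \<psi>] B(2), of x t] by simp
      next
        case False
        have *: "x - h *\<^sub>R ?e \<notin> supp \<psi>" if "\<bar>h\<bar> \<le> 1" for h
        proof
          assume "x - h *\<^sub>R ?e \<in> supp \<psi>"
          then have "(x - h *\<^sub>R ?e, h *\<^sub>R ?e) \<in> supp \<psi> \<times> ((\<lambda>h. h *\<^sub>R ?e) ` {-1..1})"
            using that by (auto intro!: imageI)
          from imageI[OF this, of "\<lambda>z. fst z + snd z"] show False using False by (simp add: K_def)
        qed
        have "x \<notin> supp \<psi>" using *[of 0] by simp
        moreover have "x \<notin> supp (partial i \<psi>)" using calculation supp_partial[of i \<psi>] by auto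
        moreover have "x - (-t) *\<^sub>R ?e \<notin> supp \<psi>" using *[of "-t"] t by simp
        ultimately have "\<psi> x = 0" "partial i \<psi> x = 0" "\<psi> (x - (-t) *\<^sub>R ?e) = 0"
          by (simp_all only: zero_outside_supp not_False_eq_True)
        then show ?thesis using False by simp
      qed
    qed
    also have "\<dots> = t\<^sup>2 * M"
      using K by (simp add: M_def lmeasurable_compact fmeasurableD)
    finally show ?thesis .
  qed
  have "(\<lambda>n. 1 / real (Suc n) * M) \<longlonglongrightarrow> 0 * M"
    by (intro tendsto_intros LIMSEQ_Suc[OF lim_1_over_n])
  moreover have "\<bar>LINT x|lebesgue. partial i \<psi> x\<bar> \<le> 1 / real (Suc n) * M" for n
  proof -
    have "(1 / real (Suc n)) * \<bar>LINT x|lebesgue. partial i \<psi> x\<bar> \<le> (1 / real (Suc n)) * (1 / real (Suc n) * M)"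
      using est[of "1 / real (Suc n)"] by (simp add: power2_eq_square)
    then show ?thesis by (rule mult_left_le_imp_le) simp
  qed
  ultimately have "\<bar>LINT x|lebesgue. partial i \<psi> x\<bar> \<le> 0"
    by (intro LIMSEQ_le_const[of "\<lambda>n. 1 / real (Suc n) * M"]) auto
  then show ?thesis by simp
qed

lemma test_functions_mult:
  assumes "\<phi> \<in> test_functions \<Omega>" "smooth_fun f"
  shows "(\<lambda>x. \<phi> x * f x) \<in> test_functions \<Omega>"
proof (rule test_functionsI[of _ "supp \<phi>"])
  show "smooth_fun (\<lambda>x. \<phi> x * f x)" by (rule smooth_mult[OF test_functionsD(1)[OF assms(1)] assms(2)])
qed (use test_functionsD[OF assms(1)] in \<open>auto simp: zero_outside_supp\<close>)

lemma integration_by_parts: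
  assumes "\<phi> \<in> test_functions UNIV" "smooth_fun f"
  shows "(LINT x|lebesgue. partial i \<phi> x * f x) = - (LINT x|lebesgue. \<phi> x * partial i f x)"
proof -
  note d = smooth_differentiable[OF test_functionsD(1)[OF assms(1)]] smooth_differentiable[OF assms(2)]
  have "0 = (LINT x|lebesgue. \<phi> x * partial i f x + partial i \<phi> x * f x)"
    using integral_partial_zero[OF test_functions_mult[OF assms], of i] by (simp add: partial_mult[OF d])
  also have "\<dots> = (LINT x|lebesgue. \<phi> x * partial i f x) + (LINT x|lebesgue. partial i \<phi> x * f x)"
    using test_function_integrable_real[OF test_functions_mult[OF assms(1) smooth_partial[OF assms(2)]]]
      test_function_integrable_real[OF test_functions_mult[OF test_functions_partial[OF assms(1)] assms(2)]]
    by (rule Bochner_Integration.integral_add)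
  finally show ?thesis by simp
qed

text \<open>The outermost derivative of \<open>\<phi>\<close> is moved first and becomes the
  innermost one on \<open>f\<close>, whence the reversed list. The order is left as it is, since
  only smoothness of the result matters later.\<close>

lemma integration_by_parts_list:
  assumes "\<phi> \<in> test_functions UNIV" "smooth_fun f"
  shows "(LINT x|lebesgue. foldr partial is \<phi> x * f x) =
    (-1) ^ length is * (LINT x|lebesgue. \<phi> x * foldr partial (rev is) f x)"
  using assms(2)
proof (induction "is" arbitrary: f)
  case (Cons i "is")
  then show ?case
    using integration_by_parts[OF test_functions_foldr[OF assms(1), of "is"] Cons.prems, of i]
    by (simp add: smooth_partial)
qed simp

text \<open>Real factors with constant vectors cover the vector-valued polynomials of the kernel,
  and integration by parts acts on the real factors alone.\<close>

lemma has_weak_deriv_smooth: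
  fixes c :: "'i \<Rightarrow> 'v::euclidean_space"
  assumes "\<And>l. l \<in> I \<Longrightarrow> smooth_fun (f l)"
  shows "has_weak_deriv \<Omega> \<alpha> (\<lambda>x. \<Sum>l\<in>I. f l x *\<^sub>R c l)
    (\<lambda>x. \<Sum>l\<in>I. foldr partial (rev (mi_list \<alpha>)) (f l) x *\<^sub>R c l)"
proof -
  let ?D = "foldr partial (rev (mi_list \<alpha>))"
  have L1: "(\<lambda>x. g x *\<^sub>R v) \<in> L1_loc \<Omega>" if "smooth_fun g" for g and v :: 'v
    using smooth_continuous[OF that] by (intro L1_loc_continuous continuous_intros)
  have I: "(LINT x:\<Omega>|lebesgue. \<psi> x *\<^sub>R (g x *\<^sub>R v)) = (LINT x|lebesgue. \<psi> x * g x) *\<^sub>R v"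
    if "smooth_fun g" "\<psi> \<in> test_functions \<Omega>" for g \<psi> and v :: 'v
    using test_function_integrable_real[OF test_functions_mult[OF that(2,1)]]
    unfolding test_function_set_integral[OF that(2)] by simp
  show ?thesis unfolding has_weak_deriv_def
  proof (intro conjI ballI)
    show "(\<lambda>x. \<Sum>l\<in>I. f l x *\<^sub>R c l) \<in> L1_loc \<Omega>"
      "(\<lambda>x. \<Sum>l\<in>I. ?D (f l) x *\<^sub>R c l) \<in> L1_loc \<Omega>"
      by (rule L1_loc_sum, rule L1, (rule smooth_foldr_partial)?, erule assms)+
    fix \<phi> assume \<phi>: "\<phi> \<in> test_functions \<Omega>"
    then have \<phi>': "\<phi> \<in> test_functions UNIV" using test_functions_mono[of \<Omega> UNIV] by auto
    have "(LINT x:\<Omega>|lebesgue. mi_partial \<alpha> \<phi> x *\<^sub>R (\<Sum>l\<in>I. f l x *\<^sub>R c l)) =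
      (\<Sum>l\<in>I. (LINT x|lebesgue. mi_partial \<alpha> \<phi> x * f l x) *\<^sub>R c l)"
      using integral_sum_test[OF mi_partial_test[OF \<phi>], of I "\<lambda>l x. f l x *\<^sub>R c l"] L1 I assms mi_partial_test[OF \<phi>]
      by simp
    also have "\<dots> = (\<Sum>l\<in>I. ((-1) ^ mi_order \<alpha> * (LINT x|lebesgue. \<phi> x * ?D (f l) x)) *\<^sub>R c l)"
      using integration_by_parts_list[OF \<phi>'] assms by (simp add: mi_partial_foldr length_mi_list)
    also have "\<dots> = (-1) ^ mi_order \<alpha> *\<^sub>R (\<Sum>l\<in>I. (LINT x|lebesgue. \<phi> x * ?D (f l) x) *\<^sub>R c l)"
      by (simp add: scaleR_sum_right)
    also have "(\<Sum>l\<in>I. (LINT x|lebesgue. \<phi> x * ?D (f l) x) *\<^sub>R c l) =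
      (LINT x:\<Omega>|lebesgue. \<phi> x *\<^sub>R (\<Sum>l\<in>I. ?D (f l) x *\<^sub>R c l))"
      using integral_sum_test[OF \<phi>, of I "\<lambda>l x. ?D (f l) x *\<^sub>R c l"]
        L1 I \<phi> smooth_foldr_partial[OF assms] by simp
    finally show "(LINT x:\<Omega>|lebesgue. mi_partial \<alpha> \<phi> x *\<^sub>R (\<Sum>l\<in>I. f l x *\<^sub>R c l)) =
      (-1) ^ mi_order \<alpha> *\<^sub>R (LINT x:\<Omega>|lebesgue. \<phi> x *\<^sub>R (\<Sum>l\<in>I. ?D (f l) x *\<^sub>R c l))" .
  qed
qed

lemma smooth_mono_fun: "smooth_fun (mono_fun J)"
  unfolding mono_fun_def by (intro smooth_prod smooth_power smooth_coord)

text \<open>Local integrability gives measurability on compact sets; an exhaustion of the open set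
  by compact sets transfers it as a pointwise limit.\<close>

lemma L1_loc_measurable:
  assumes "open \<Omega>" "u \<in> L1_loc \<Omega>"
  shows "u \<in> borel_measurable (lebesgue_on \<Omega>)"
proof -
  obtain C where C: "\<And>n::nat. compact (C n)" "\<And>n. C n \<subseteq> \<Omega>" "\<And>n. C n \<subseteq> interior (C (Suc n))" "\<Union>(range C) = \<Omega>"
    using open_Union_compact_subsets[OF assms(1)] by metis
  have "(\<lambda>x. indicator \<Omega> x *\<^sub>R u x) \<in> borel_measurable lebesgue"
  proof (rule borel_measurable_LIMSEQ_metric)
    show "(\<lambda>x. indicator (C n) x *\<^sub>R u x) \<in> borel_measurable lebesgue" for n
      using assms(2) C(1,2)[of n] by (intro borel_measurable_integrable) (auto simp: L1_loc_def set_integrable_def)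
    fix x
    show "(\<lambda>n. indicator (C n) x *\<^sub>R u x) \<longlonglongrightarrow> indicator \<Omega> x *\<^sub>R u x"
    proof (cases "x \<in> \<Omega>")
      case True
      then obtain n where n: "x \<in> C n" using C(4) by blast
      have "C m \<subseteq> C (Suc m)" for m using C(3)[of m] interior_subset by blast
      then have "x \<in> C m" if "m \<ge> n" for m
        using n lift_Suc_mono_le[of C, OF _ that] by blast
      then have "\<forall>\<^sub>F m in sequentially. indicator (C m) x *\<^sub>R u x = indicator \<Omega> x *\<^sub>R u x"
        using True by (auto simp: eventually_sequentially intro!: exI[of _ n])
      then show ?thesis by (rule tendsto_eventually)
    next
      case False
      then have "x \<notin> C n" for n using C(2) by blast
      then show ?thesis using False by simp
    qed
  qed
  then show ?thesis using assms(1) by (subst borel_measurable_restrict_space_iff) auto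
qed

section \<open>Banach function norms and the kernel\<close>

locale bf_norm =
  fixes \<Omega> :: "(real^'n) set" and \<rho> :: "(real^'n \<Rightarrow> ennreal) \<Rightarrow> ennreal"
  assumes open_dom: "open \<Omega>" and bounded_dom: "bounded \<Omega>" and bfn: "banach_function_norm \<Omega> \<rho>"
begin

abbreviation meas :: "(real^'n \<Rightarrow> 'a::topological_space) \<Rightarrow> bool" where
  "meas u \<equiv> u \<in> borel_measurable (lebesgue_on \<Omega>)"

lemma rho_zero: "meas u \<Longrightarrow> \<rho> u = 0 \<Longrightarrow> AE x in lebesgue_on \<Omega>. u x = 0"
  using bfn unfolding banach_function_norm_def by (elim conjE) blast

lemma rho_scale: "meas u \<Longrightarrow> 0 \<le> c \<Longrightarrow> \<rho> (\<lambda>x. ennreal c * u x) = ennreal c * \<rho> u"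
  using bfn unfolding banach_function_norm_def by (elim conjE) blast

lemma rho_add: "meas u \<Longrightarrow> meas v \<Longrightarrow> \<rho> (\<lambda>x. u x + v x) \<le> \<rho> u + \<rho> v"
  using bfn unfolding banach_function_norm_def by (elim conjE) blast

lemma rho_mono: "meas u \<Longrightarrow> meas v \<Longrightarrow>
    AE x in lebesgue_on \<Omega>. u x \<le> v x \<Longrightarrow> \<rho> u \<le> \<rho> v"
  using bfn unfolding banach_function_norm_def by (elim conjE) blast

lemma rho_indicator: "\<rho> (indicator \<Omega>) < \<infinity>"
proof -
  have "\<Omega> \<in> lmeasurable" using open_dom bounded_dom by (simp add: lmeasurable_open)
  then have "\<Omega> \<in> sets lebesgue" "emeasure lebesgue \<Omega> < \<infinity>" by (auto simp: fmeasurable_def)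
  moreover have "\<forall>S\<in>sets lebesgue. S \<subseteq> \<Omega> \<longrightarrow> emeasure lebesgue S < \<infinity> \<longrightarrow> \<rho> (indicator S) < \<infinity>"
    using bfn unfolding banach_function_norm_def by (elim conjE)
  ultimately show ?thesis by blast
qed

lemma norm_measurable: "meas u \<Longrightarrow> meas (\<lambda>x. ennreal (norm (u x :: 'v::euclidean_space)))"
  by measurable

lemma vnorm_mono:
  fixes u :: "real^'n \<Rightarrow> 'v::euclidean_space" and v :: "real^'n \<Rightarrow> 'w::euclidean_space"
  assumes "meas u" "meas v" "AE x in lebesgue_on \<Omega>. norm (u x) \<le> norm (v x)"
  shows "vnorm \<rho> u \<le> vnorm \<rho> v"
  unfolding vnorm_def
proof (rule rho_mono)
  show "AE x in lebesgue_on \<Omega>. ennreal (norm (u x)) \<le> ennreal (norm (v x))"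
    using assms(3) by eventually_elim (simp add: ennreal_leI)
qed (use assms norm_measurable in auto)

lemma vnorm_cong_AE:
  fixes u v :: "real^'n \<Rightarrow> 'v::euclidean_space"
  assumes "meas u" "meas v" "AE x in lebesgue_on \<Omega>. u x = v x"
  shows "vnorm \<rho> u = vnorm \<rho> v"
proof (rule antisym)
  show "vnorm \<rho> u \<le> vnorm \<rho> v" by (rule vnorm_mono[OF assms(1,2)]) (use assms(3) in \<open>eventually_elim, simp\<close>)
  show "vnorm \<rho> v \<le> vnorm \<rho> u" by (rule vnorm_mono[OF assms(2,1)]) (use assms(3) in \<open>eventually_elim, simp\<close>)
qed

lemma vnorm_scaleR:
  fixes u :: "real^'n \<Rightarrow> 'v::euclidean_space"
  assumes "meas u"
  shows "vnorm \<rho> (\<lambda>x. c *\<^sub>R u x) = ennreal \<bar>c\<bar> * vnorm \<rho> u"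
  using rho_scale[OF norm_measurable[OF assms], of "\<bar>c\<bar>"] by (simp add: vnorm_def ennreal_mult)

lemma vnorm_0 [simp]: "vnorm \<rho> (\<lambda>x. 0 :: 'v::euclidean_space) = 0"
  using vnorm_scaleR[of "\<lambda>x. 0 :: 'v" 0] by simp

lemma vnorm_add:
  fixes u v :: "real^'n \<Rightarrow> 'v::euclidean_space"
  assumes "meas u" "meas v"
  shows "vnorm \<rho> (\<lambda>x. u x + v x) \<le> vnorm \<rho> u + vnorm \<rho> v"
proof -
  have "vnorm \<rho> (\<lambda>x. u x + v x) \<le> \<rho> (\<lambda>x. ennreal (norm (u x)) + ennreal (norm (v x)))"
    unfolding vnorm_def
  proof (rule rho_mono)
    show "AE x in lebesgue_on \<Omega>. ennreal (norm (u x + v x)) \<le> ennreal (norm (u x)) + ennreal (norm (v x))"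
      by (intro AE_I2) (simp add: norm_triangle_ineq ennreal_leI flip: ennreal_plus)
  qed (use assms in measurable)
  also have "\<dots> \<le> vnorm \<rho> u + vnorm \<rho> v"
    unfolding vnorm_def by (intro rho_add norm_measurable assms)
  finally show ?thesis .
qed

lemma vnorm_sum:
  fixes u :: "'i \<Rightarrow> real^'n \<Rightarrow> 'v::euclidean_space"
  assumes "\<And>i. i \<in> I \<Longrightarrow> meas (u i)"
  shows "vnorm \<rho> (\<lambda>x. \<Sum>i\<in>I. u i x) \<le> (\<Sum>i\<in>I. vnorm \<rho> (u i))"
  using assms
proof (induction I rule: infinite_finite_induct)
  case (insert i I)
  have "vnorm \<rho> (\<lambda>x. u i x + (\<Sum>i\<in>I. u i x)) \<le> vnorm \<rho> (u i) + vnorm \<rho> (\<lambda>x. \<Sum>i\<in>I. u i x)"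
    using insert.prems by (intro vnorm_add borel_measurable_sum) auto
  also have "\<dots> \<le> vnorm \<rho> (u i) + (\<Sum>i\<in>I. vnorm \<rho> (u i))"
    using insert by (intro add_left_mono) auto
  finally show ?case using insert.hyps by simp
qed auto

lemma vnorm_zero_AE:
  fixes u :: "real^'n \<Rightarrow> 'v::euclidean_space"
  assumes "meas u" "vnorm \<rho> u = 0"
  shows "AE x in lebesgue_on \<Omega>. u x = 0"
  using rho_zero[OF norm_measurable[OF assms(1)]] assms(2)
  unfolding vnorm_def by (auto elim!: eventually_mono)

text \<open>The bounded domain has finite measure, so (B4) makes the norm of its indicator finite,
  and monotonicity compares \<open>u\<close> with a multiple of it.\<close>

lemma vnorm_bounded:
  fixes u :: "real^'n \<Rightarrow> 'v::euclidean_space"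
  assumes "meas u" "\<And>x. x \<in> \<Omega> \<Longrightarrow> norm (u x) \<le> M"
  shows "vnorm \<rho> u < \<infinity>"
proof -
  have ind: "meas (indicator \<Omega> :: _ \<Rightarrow> ennreal)"
    using open_dom by (intro borel_measurable_indicator) (simp add: sets_restrict_space_iff)
  have "vnorm \<rho> u \<le> \<rho> (\<lambda>x. ennreal \<bar>M\<bar> * indicator \<Omega> x)"
    unfolding vnorm_def
  proof (rule rho_mono[OF norm_measurable[OF assms(1)]])
    show "meas (\<lambda>x. ennreal \<bar>M\<bar> * indicator \<Omega> x :: ennreal)" using ind by measurable
    show "AE x in lebesgue_on \<Omega>. ennreal (norm (u x)) \<le> ennreal \<bar>M\<bar> * indicator \<Omega> x"
    proof (rule AE_I2)
      fix x assume "x \<in> space (lebesgue_on \<Omega>)"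
      then have "x \<in> \<Omega>" by (simp add: space_restrict_space)
      then show "ennreal (norm (u x)) \<le> ennreal \<bar>M\<bar> * indicator \<Omega> x"
        using assms(2)[of x] by (auto intro!: ennreal_leI)
    qed
  qed
  also have "\<dots> = ennreal \<bar>M\<bar> * \<rho> (indicator \<Omega>)" by (rule rho_scale[OF ind]) simp
  also have "\<dots> < \<infinity>" using rho_indicator by (simp add: ennreal_mult_less_top)
  finally show ?thesis .
qed

lemma linear_measurable:
  fixes f :: "'v::euclidean_space \<Rightarrow> 'w::euclidean_space"
  assumes "linear f" "meas u" shows "meas (\<lambda>x. f (u x))"
  using assms by (intro measurable_compose[OF assms(2)] borel_measurable_continuous_onI linear_continuous_on)
    (simp add: linear_conv_bounded_linear)

lemma vnorm_linear_finite:
  fixes f :: "'v::euclidean_space \<Rightarrow> 'w::euclidean_space"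
  assumes "linear f" "meas u" "vnorm \<rho> u < \<infinity>"
  shows "vnorm \<rho> (\<lambda>x. f (u x)) < \<infinity>"
proof -
  obtain K where K: "K > 0" "\<And>x. norm (f x) \<le> norm x * K"
    using assms(1) bounded_linear.pos_bounded[of f] by (auto simp: linear_conv_bounded_linear)
  have "vnorm \<rho> (\<lambda>x. f (u x)) \<le> vnorm \<rho> (\<lambda>x. K *\<^sub>R u x)"
    using assms(2) K by (intro vnorm_mono[OF linear_measurable[OF assms(1,2)]] AE_I2) (auto simp: mult.commute)
  also have "\<dots> < \<infinity>" using assms(3) by (simp add: vnorm_scaleR[OF assms(2)] ennreal_mult_less_top)
  finally show ?thesis .
qed

lemma weak_deriv_measurable: "has_weak_deriv \<Omega> \<alpha> u v \<Longrightarrow> meas v"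
  by (rule L1_loc_measurable[OF open_dom]) (simp add: has_weak_deriv_def)

text \<open>Membership may be checked on concrete weak derivatives: the chosen ones differ from them
  on null sets, which \<open>vnorm\<close> does not see.\<close>

lemma sob_spaceI:
  fixes u :: "real^'n \<Rightarrow> 'v::euclidean_space"
  assumes "\<And>\<alpha>. mi_order \<alpha> \<le> k \<Longrightarrow> has_weak_deriv \<Omega> \<alpha> u (v \<alpha>)"
    "\<And>\<alpha>. mi_order \<alpha> \<le> k \<Longrightarrow> vnorm \<rho> (v \<alpha>) < \<infinity>"
  shows "u \<in> sob_space \<Omega> k \<rho>"
proof -
  have "vnorm \<rho> (weak_deriv \<Omega> \<alpha> u) < \<infinity>" if "mi_order \<alpha> \<le> k" for \<alpha>
  proof -
    note w = weak_deriv[OF open_dom assms(1)[OF that]]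
    have "vnorm \<rho> (weak_deriv \<Omega> \<alpha> u) = vnorm \<rho> (v \<alpha>)"
      by (rule vnorm_cong_AE[OF weak_deriv_measurable[OF w(1)] weak_deriv_measurable[OF assms(1)[OF that]] w(2)])
    then show ?thesis using assms(2)[OF that] by simp
  qed
  then have "sob_norm \<Omega> k \<rho> u < \<infinity>"
    unfolding sob_norm_def by (simp add: finite_mi_order_le)
  then show ?thesis using assms(1) unfolding sob_space_def by blast
qed

lemma sob_spaceD:
  fixes u :: "real^'n \<Rightarrow> 'v::euclidean_space"
  assumes "u \<in> sob_space \<Omega> k \<rho>" "mi_order \<alpha> \<le> k"
  shows "has_weak_deriv \<Omega> \<alpha> u (weak_deriv \<Omega> \<alpha> u)" "meas (weak_deriv \<Omega> \<alpha> u)"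
    "vnorm \<rho> (weak_deriv \<Omega> \<alpha> u) < \<infinity>"
proof -
  show *: "has_weak_deriv \<Omega> \<alpha> u (weak_deriv \<Omega> \<alpha> u)"
  proof -
    obtain v where "has_weak_deriv \<Omega> \<alpha> u v" using assms by (auto simp: sob_space_def)
    then show ?thesis by (rule weak_deriv(1)[OF open_dom])
  qed
  then show "meas (weak_deriv \<Omega> \<alpha> u)" by (rule weak_deriv_measurable)
  show "vnorm \<rho> (weak_deriv \<Omega> \<alpha> u) < \<infinity>"
    using assms by (simp add: sob_space_def sob_norm_def finite_mi_order_le)
qed

lemma sob_space_L1_loc: "u \<in> sob_space \<Omega> k \<rho> \<Longrightarrow> u \<in> L1_loc \<Omega>"
  using sob_spaceD(1)[of u k "\<lambda>_. 0"] by (auto simp: has_weak_deriv_def mi_order_def)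

lemma sob_space_measurable: "u \<in> sob_space \<Omega> k \<rho> \<Longrightarrow> meas u"
  using sob_space_L1_loc L1_loc_measurable[OF open_dom] by blast

text \<open>The derivative of order 0 is one of the summands of \<open>sob_norm\<close>; as chosen
  by \<open>weak_deriv\<close> it agrees with \<open>u\<close> almost everywhere.\<close>

lemma vnorm_le_sob_norm:
  fixes u :: "real^'n \<Rightarrow> 'v::euclidean_space"
  assumes "u \<in> L1_loc \<Omega>" shows "vnorm \<rho> u \<le> sob_norm \<Omega> k \<rho> u"
proof -
  have "has_weak_deriv \<Omega> (\<lambda>_. 0) u u"
    using assms by (simp add: has_weak_deriv_def mi_partial_foldr mi_list_0 mi_order_def)
  note w = weak_deriv[OF open_dom this]
  have "vnorm \<rho> u = vnorm \<rho> (weak_deriv \<Omega> (\<lambda>_. 0) u)"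
    using vnorm_cong_AE[OF weak_deriv_measurable[OF w(1)] L1_loc_measurable[OF open_dom assms] w(2)] by simp
  also have "\<dots> \<le> sob_norm \<Omega> k \<rho> u"
    unfolding sob_norm_def by (rule member_le_sum) (auto simp: finite_mi_order_le, simp add: mi_order_def)
  finally show ?thesis .
qed

lemma sob_space_vnorm_finite: "u \<in> sob_space \<Omega> k \<rho> \<Longrightarrow> vnorm \<rho> u < \<infinity>"
  using vnorm_le_sob_norm[OF sob_space_L1_loc, of u k k] by (auto simp: sob_space_def)

lemma sob_space_add_scaleR:
  fixes u r :: "real^'n \<Rightarrow> 'v::euclidean_space"
  assumes "u \<in> sob_space \<Omega> k \<rho>" "r \<in> sob_space \<Omega> k \<rho>"
  shows "(\<lambda>x. u x + c *\<^sub>R r x) \<in> sob_space \<Omega> k \<rho>"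
proof (rule sob_spaceI)
  fix \<alpha> :: "'n \<Rightarrow> nat" assume \<alpha>: "mi_order \<alpha> \<le> k"
  note U = sob_spaceD[OF assms(1) \<alpha>] and R = sob_spaceD[OF assms(2) \<alpha>]
  show "has_weak_deriv \<Omega> \<alpha> (\<lambda>x. u x + c *\<^sub>R r x) (\<lambda>x. weak_deriv \<Omega> \<alpha> u x + c *\<^sub>R weak_deriv \<Omega> \<alpha> r x)"
    by (intro has_weak_deriv_add has_weak_deriv_scaleR U R)
  have "vnorm \<rho> (\<lambda>x. weak_deriv \<Omega> \<alpha> u x + c *\<^sub>R weak_deriv \<Omega> \<alpha> r x) \<le>
      vnorm \<rho> (weak_deriv \<Omega> \<alpha> u) + vnorm \<rho> (\<lambda>x. c *\<^sub>R weak_deriv \<Omega> \<alpha> r x)"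
    using U(2) R(2) by (intro vnorm_add) auto
  also have "\<dots> < \<infinity>"
    using U(3) R(3) by (simp add: vnorm_scaleR[OF R(2)] ennreal_mult_less_top)
  finally show "vnorm \<rho> (\<lambda>x. weak_deriv \<Omega> \<alpha> u x + c *\<^sub>R weak_deriv \<Omega> \<alpha> r x) < \<infinity>" .
qed

lemma op_apply_measurable:
  assumes "diff_operator k A" "u \<in> sob_space \<Omega> k \<rho>"
  shows "meas (op_apply \<Omega> k A u)"
proof -
  have "meas (\<lambda>x. \<Sum>\<alpha> | mi_order \<alpha> = k. A \<alpha> (weak_deriv \<Omega> \<alpha> u x))"
  proof (rule borel_measurable_sum)
    fix \<alpha> :: "'n \<Rightarrow> nat" assume "\<alpha> \<in> {\<alpha>. mi_order \<alpha> = k}"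
    then show "meas (\<lambda>x. A \<alpha> (weak_deriv \<Omega> \<alpha> u x))"
      using assms(1) by (intro linear_measurable[OF _ sob_spaceD(2)[OF assms(2)]]) (auto simp: diff_operator_def)
  qed
  then show ?thesis by (simp add: op_apply_def[abs_def])
qed

lemma vnorm_op_apply_finite:
  assumes "diff_operator k A" "u \<in> sob_space \<Omega> k \<rho>"
  shows "vnorm \<rho> (op_apply \<Omega> k A u) < \<infinity>"
proof -
  have "vnorm \<rho> (\<lambda>x. \<Sum>\<alpha> | mi_order \<alpha> = k. A \<alpha> (weak_deriv \<Omega> \<alpha> u x)) \<le>
      (\<Sum>\<alpha> | mi_order \<alpha> = k. vnorm \<rho> (\<lambda>x. A \<alpha> (weak_deriv \<Omega> \<alpha> u x)))"
  proof (rule vnorm_sum)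
    fix \<alpha> :: "'n \<Rightarrow> nat" assume "\<alpha> \<in> {\<alpha>. mi_order \<alpha> = k}"
    then show "meas (\<lambda>x. A \<alpha> (weak_deriv \<Omega> \<alpha> u x))"
      using assms(1) by (intro linear_measurable[OF _ sob_spaceD(2)[OF assms(2)]]) (auto simp: diff_operator_def)
  qed
  also have "\<dots> < \<infinity>"
  proof -
    have "vnorm \<rho> (\<lambda>x. A \<alpha> (weak_deriv \<Omega> \<alpha> u x)) < \<infinity>" if "mi_order \<alpha> = k" for \<alpha>
      using assms(1) that by (intro vnorm_linear_finite[OF _ sob_spaceD(2,3)[OF assms(2)]]) (auto simp: diff_operator_def)
    then show ?thesis by (simp add: finite_mi_order_eq)
  qed
  finally show ?thesis by (simp add: op_apply_def[abs_def])
qed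

text \<open>The chosen derivative of a combination need not be the combination of the chosen
  derivatives, so linearity holds almost everywhere only; there are finitely many multi-indices, and
  the exceptional sets add up to a null set.\<close>

lemma op_apply_add_scaleR:
  assumes "diff_operator k A" "u \<in> sob_space \<Omega> k \<rho>" "r \<in> sob_space \<Omega> k \<rho>"
  shows "AE x in lebesgue_on \<Omega>. op_apply \<Omega> k A (\<lambda>x. u x + c *\<^sub>R r x) x = op_apply \<Omega> k A u x + c *\<^sub>R op_apply \<Omega> k A r x"
proof -
  let ?w = "\<lambda>x. u x + c *\<^sub>R r x"
  have "AE x in lebesgue_on \<Omega>. \<forall>\<alpha>\<in>{\<alpha>. mi_order \<alpha> = k}.
      weak_deriv \<Omega> \<alpha> ?w x = weak_deriv \<Omega> \<alpha> u x + c *\<^sub>R weak_deriv \<Omega> \<alpha> r x"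
  proof (rule AE_finite_allI[OF finite_mi_order_eq])
    fix \<alpha> :: "'n \<Rightarrow> nat" assume "\<alpha> \<in> {\<alpha>. mi_order \<alpha> = k}"
    then have \<alpha>: "mi_order \<alpha> \<le> k" by simp
    show "AE x in lebesgue_on \<Omega>. weak_deriv \<Omega> \<alpha> ?w x = weak_deriv \<Omega> \<alpha> u x + c *\<^sub>R weak_deriv \<Omega> \<alpha> r x"
      by (rule weak_deriv(2)[OF open_dom])
        (rule has_weak_deriv_add[OF sob_spaceD(1)[OF assms(2) \<alpha>] has_weak_deriv_scaleR[OF sob_spaceD(1)[OF assms(3) \<alpha>]]])
  qed
  then show ?thesis
  proof eventually_elim
    case (elim x)
    have "op_apply \<Omega> k A ?w x = (\<Sum>\<alpha> | mi_order \<alpha> = k. A \<alpha> (weak_deriv \<Omega> \<alpha> u x) + c *\<^sub>R A \<alpha> (weak_deriv \<Omega> \<alpha> r x))"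
      unfolding op_apply_def using elim assms(1)
      by (intro sum.cong) (auto simp: diff_operator_def linear_add linear_cmul)
    then show ?case by (simp add: op_apply_def sum.distrib scaleR_sum_right)
  qed
qed

end

section \<open>The kernel as a space of functions on the domain\<close>

lemma kernel_onD:
  assumes "r \<in> kernel_on \<Omega> k A"
  obtains T where "r \<in> L1_loc \<Omega>" "T \<in> dist_kernel k A"
    "\<And>\<phi>. \<phi> \<in> test_functions \<Omega> \<Longrightarrow> T \<phi> = (LINT x:\<Omega>|lebesgue. \<phi> x *\<^sub>R r x)"
  using assms unfolding kernel_on_def by blast

lemma kernel_on_polynomial:
  fixes A :: "('n::finite \<Rightarrow> nat) \<Rightarrow> 'v::euclidean_space \<Rightarrow> 'w::euclidean_space"
  assumes "open \<Omega>" "diff_operator k A" "C_elliptic k A"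
  obtains m where "\<And>r. r \<in> kernel_on \<Omega> k A \<Longrightarrow>
    \<exists>c. AE x in lebesgue_on \<Omega>. r x = poly_fun m c x"
proof (rule kernel_nilpotent[OF assms(2,3)])
  fix m assume m: "\<And>T \<phi> i. T \<in> dist_kernel k A \<Longrightarrow> \<phi> \<in> test_functions UNIV \<Longrightarrow> T ((partial i ^^ m) \<phi>) = 0"
  have "\<exists>c. AE x in lebesgue_on \<Omega>. r x = poly_fun m c x"
    if r: "r \<in> kernel_on \<Omega> k A" for r
  proof (rule kernel_onD[OF r])
    fix T assume T: "r \<in> L1_loc \<Omega>" "T \<in> dist_kernel k A"
      "\<And>\<phi>. \<phi> \<in> test_functions \<Omega> \<Longrightarrow> T \<phi> = (LINT x:\<Omega>|lebesgue. \<phi> x *\<^sub>R r x)"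
    have "distribution T" using T(2) by (simp add: dist_kernel_def)
    from polynomial_representation[OF this m[OF T(2)] assms(1) T(1,3)] show ?thesis by blast
  qed
  then show thesis by (rule that)
qed

lemma kernel_on_cong_AE:
  assumes "open \<Omega>" "r \<in> kernel_on \<Omega> k A" "s \<in> L1_loc \<Omega>" "AE x in lebesgue_on \<Omega>. s x = r x"
  shows "s \<in> kernel_on \<Omega> k A"
proof (rule kernel_onD[OF assms(2)])
  fix T assume T: "r \<in> L1_loc \<Omega>" "T \<in> dist_kernel k A"
    "\<And>\<phi>. \<phi> \<in> test_functions \<Omega> \<Longrightarrow> T \<phi> = (LINT x:\<Omega>|lebesgue. \<phi> x *\<^sub>R r x)"
  \<comment> \<open>A function is its own weak derivative of order 0; in this guise the congruence
    lemma for weak derivatives yields equal integrals against test functions.\<close>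
  have "has_weak_deriv \<Omega> (\<lambda>_. 0) r r"
    using T(1) by (simp add: has_weak_deriv_def mi_partial_foldr mi_list_0 mi_order_def)
  from has_weak_deriv_cong_AE[OF assms(1) this assms(3,4)]
  have "(LINT x:\<Omega>|lebesgue. \<phi> x *\<^sub>R s x) = (LINT x:\<Omega>|lebesgue. \<phi> x *\<^sub>R r x)" if "\<phi> \<in> test_functions \<Omega>" for \<phi>
    using that by (simp add: has_weak_deriv_def mi_partial_foldr mi_list_0 mi_order_def)
  then show ?thesis unfolding kernel_on_def using T assms(3) by auto
qed

text \<open>The seminorm estimates of \<open>T\<close> and \<open>S\<close> may have different
  orders. Both are dominated by the one of order \<open>m + m'\<close>, once the constants are
  replaced by their absolute values.\<close>

lemma distribution_add_scaleR:
  fixes T S :: "(real^'n \<Rightarrow> real) \<Rightarrow> 'v::euclidean_space"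
  assumes "distribution T" "distribution S"
  shows "distribution (\<lambda>\<phi>. T \<phi> + c *\<^sub>R S \<phi>)"
  unfolding distribution_def
proof (intro conjI allI ballI impI)
  fix K :: "(real^'n) set" assume K: "compact K"
  let ?N = "\<lambda>m \<phi>. \<Sum>\<alpha> | mi_order \<alpha> \<le> m. SUP x. \<bar>mi_partial \<alpha> \<phi> x\<bar>"
  obtain C m where C: "\<And>\<phi>. \<phi> \<in> test_functions UNIV \<Longrightarrow> supp \<phi> \<subseteq> K \<Longrightarrow> norm (T \<phi>) \<le> C * ?N m \<phi>"
    using assms(1) K unfolding distribution_def by meson
  obtain C' m' where C': "\<And>\<phi>. \<phi> \<in> test_functions UNIV \<Longrightarrow> supp \<phi> \<subseteq> K \<Longrightarrow> norm (S \<phi>) \<le> C' * ?N m' \<phi>"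
    using assms(2) K unfolding distribution_def by meson
  have sup0: "0 \<le> (SUP y. \<bar>mi_partial \<alpha> \<phi> y\<bar>)" if \<phi>: "\<phi> \<in> test_functions UNIV" for \<phi> \<alpha>
  proof -
    obtain B where "\<And>x. \<bar>mi_partial \<alpha> \<phi> x\<bar> \<le> B"
      using test_function_bounded[OF mi_partial_test[OF \<phi>, of \<alpha>]] by blast
    then show ?thesis by (intro cSUP_upper2[where x = 0] bdd_aboveI2[where M = B]) auto
  qed
  have mono: "?N l \<phi> \<le> ?N (m + m') \<phi>" "0 \<le> ?N l \<phi>" if "\<phi> \<in> test_functions UNIV" "l \<le> m + m'" for \<phi> l
    using that sup0[OF that(1)] by (auto intro!: sum_mono2 finite_mi_order_le sum_nonneg)
  show "\<exists>C l. \<forall>\<phi>\<in>test_functions UNIV. supp \<phi> \<subseteq> K \<longrightarrow> norm (T \<phi> + c *\<^sub>R S \<phi>) \<le> C * ?N l \<phi>"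
  proof (intro exI ballI impI)
    fix \<phi> :: "real^'n \<Rightarrow> real" assume \<phi>: "\<phi> \<in> test_functions UNIV" "supp \<phi> \<subseteq> K"
    have "norm (T \<phi>) \<le> \<bar>C\<bar> * ?N (m + m') \<phi>"
      using C[OF \<phi>] mono[OF \<phi>(1), of m] by (meson abs_ge_self le_add1 mult_mono order_trans abs_ge_zero)
    moreover have "norm (S \<phi>) \<le> \<bar>C'\<bar> * ?N (m + m') \<phi>"
      using C'[OF \<phi>] mono[OF \<phi>(1), of m'] by (meson abs_ge_self le_add2 mult_mono order_trans abs_ge_zero)
    then have "\<bar>c\<bar> * norm (S \<phi>) \<le> \<bar>c\<bar> * (\<bar>C'\<bar> * ?N (m + m') \<phi>)" by (rule mult_left_mono) simp
    ultimately have "norm (T \<phi>) + norm (c *\<^sub>R S \<phi>) \<le> (\<bar>C\<bar> + \<bar>c\<bar> * \<bar>C'\<bar>) * ?N (m + m') \<phi>"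
      by (simp add: distrib_right mult.assoc)
    then show "norm (T \<phi> + c *\<^sub>R S \<phi>) \<le> (\<bar>C\<bar> + \<bar>c\<bar> * \<bar>C'\<bar>) * ?N (m + m') \<phi>"
      using norm_triangle_ineq[of "T \<phi>" "c *\<^sub>R S \<phi>"] by linarith
  qed
qed (use assms in \<open>auto simp: distribution_def algebra_simps\<close>)

lemma kernel_on_add_scaleR:
  fixes A :: "('n::finite \<Rightarrow> nat) \<Rightarrow> 'v::euclidean_space \<Rightarrow> 'w::euclidean_space"
  assumes A: "diff_operator k A" and "r \<in> kernel_on \<Omega> k A" "s \<in> kernel_on \<Omega> k A"
  shows "(\<lambda>x. r x + c *\<^sub>R s x) \<in> kernel_on \<Omega> k A"
proof (rule kernel_onD[OF assms(2)], rule kernel_onD[OF assms(3)])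
  fix T S assume T: "r \<in> L1_loc \<Omega>" "T \<in> dist_kernel k A"
      "\<And>\<phi>. \<phi> \<in> test_functions \<Omega> \<Longrightarrow> T \<phi> = (LINT x:\<Omega>|lebesgue. \<phi> x *\<^sub>R r x)"
    and S: "s \<in> L1_loc \<Omega>" "S \<in> dist_kernel k A"
      "\<And>\<phi>. \<phi> \<in> test_functions \<Omega> \<Longrightarrow> S \<phi> = (LINT x:\<Omega>|lebesgue. \<phi> x *\<^sub>R s x)"
  let ?T = "\<lambda>\<phi>. T \<phi> + c *\<^sub>R S \<phi>"
  have L: "(\<lambda>x. c *\<^sub>R s x) \<in> L1_loc \<Omega>" using S(1) by (rule L1_loc_scaleR)
  have kern: "?T \<in> dist_kernel k A"
    unfolding dist_kernel_def
  proof (intro CollectI conjI ballI)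
    show "distribution ?T" using T(2) S(2) by (intro distribution_add_scaleR) (auto simp: dist_kernel_def)
    fix \<phi> :: "real^'n \<Rightarrow> real" assume \<phi>: "\<phi> \<in> test_functions UNIV"
    have "(\<Sum>\<alpha> | mi_order \<alpha> = k. A \<alpha> (dist_deriv \<alpha> ?T \<phi>)) =
        (\<Sum>\<alpha> | mi_order \<alpha> = k. A \<alpha> (dist_deriv \<alpha> T \<phi>) + c *\<^sub>R A \<alpha> (dist_deriv \<alpha> S \<phi>))"
    proof (intro sum.cong refl)
      fix \<alpha> :: "'n \<Rightarrow> nat" assume "\<alpha> \<in> {\<alpha>. mi_order \<alpha> = k}"
      then have lin: "linear (A \<alpha>)" using A by (simp add: diff_operator_def)
      have "dist_deriv \<alpha> ?T \<phi> = dist_deriv \<alpha> T \<phi> + c *\<^sub>R dist_deriv \<alpha> S \<phi>"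
        by (simp add: dist_deriv_def scaleR_add_right mult.commute)
      then show "A \<alpha> (dist_deriv \<alpha> ?T \<phi>) = A \<alpha> (dist_deriv \<alpha> T \<phi>) + c *\<^sub>R A \<alpha> (dist_deriv \<alpha> S \<phi>)"
        using lin by (simp add: linear_add linear_cmul)
    qed
    also have "\<dots> = 0"
      using T(2) S(2) \<phi> by (simp add: dist_kernel_def sum.distrib flip: scaleR_sum_right)
    finally show "(\<Sum>\<alpha> | mi_order \<alpha> = k. A \<alpha> (dist_deriv \<alpha> ?T \<phi>)) = 0" .
  qed
  have rep: "?T \<phi> = (LINT x:\<Omega>|lebesgue. \<phi> x *\<^sub>R (r x + c *\<^sub>R s x))" if \<phi>: "\<phi> \<in> test_functions \<Omega>" for \<phi>
  proof -
    have lin: "linear (\<lambda>x::'v. c *\<^sub>R x)" by simp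
    show ?thesis
      unfolding integral_add_test[OF \<phi> T(1) L] integral_linear_test[OF lin \<phi> S(1)] T(3)[OF \<phi>] S(3)[OF \<phi>] ..
  qed
  show ?thesis unfolding kernel_on_def
    by (intro CollectI conjI bexI[OF _ kern] ballI L1_loc_add T(1) L rep)
qed

lemma zero_in_kernel_on:
  fixes A :: "('n::finite \<Rightarrow> nat) \<Rightarrow> 'v::euclidean_space \<Rightarrow> 'w::euclidean_space"
  assumes "diff_operator k A" shows "(\<lambda>x. 0) \<in> kernel_on \<Omega> k A"
proof -
  have "(\<lambda>\<phi>. 0) \<in> dist_kernel k A"
    using assms by (auto simp: dist_kernel_def distribution_def dist_deriv_def diff_operator_def linear_0
        intro!: sum.neutral exI[of _ 0])
  then show ?thesis unfolding kernel_on_def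
    by (auto simp: L1_loc_zero set_lebesgue_integral_def intro!: bexI[of _ "\<lambda>\<phi>. 0"])
qed

context bf_norm
begin

text \<open>Kernel elements are polynomials almost everywhere, and all derivatives of a polynomial
  are bounded on a bounded domain. Hence the order \<open>l\<close> is arbitrary.\<close>

lemma kernel_on_sob_space:
  fixes A :: "('n \<Rightarrow> nat) \<Rightarrow> 'v::euclidean_space \<Rightarrow> 'w::euclidean_space"
  assumes "diff_operator k A" "C_elliptic k A" "r \<in> kernel_on \<Omega> k A"
  shows "r \<in> sob_space \<Omega> l \<rho>"
proof (rule kernel_on_polynomial[OF open_dom assms(1,2)])
  fix m assume "\<And>r. r \<in> kernel_on \<Omega> k A \<Longrightarrow>
    \<exists>c. AE x in lebesgue_on \<Omega>. r x = poly_fun m c x"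
  then obtain c where c: "AE x in lebesgue_on \<Omega>. r x = poly_fun m c x"
    using assms(3) by blast
  define v where "v \<alpha> x = (\<Sum>J\<in>mono_box m UNIV. foldr partial (rev (mi_list \<alpha>)) (mono_fun J) x *\<^sub>R c J)" for \<alpha> x
  have rL: "r \<in> L1_loc \<Omega>" using assms(3) by (simp add: kernel_on_def)
  have w: "has_weak_deriv \<Omega> \<alpha> r (v \<alpha>)" for \<alpha>
    unfolding v_def by (rule has_weak_deriv_cong_AE[OF open_dom has_weak_deriv_smooth[OF smooth_mono_fun] rL c])
  show ?thesis
  proof (rule sob_spaceI[OF w])
    fix \<alpha> :: "'n \<Rightarrow> nat"
    have cont: "continuous_on (closure \<Omega>) (v \<alpha>)" unfolding v_def
      by (intro continuous_on_sum continuous_on_scaleR continuous_on_const smooth_continuous smooth_foldr_partial smooth_mono_fun)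
    have "compact (closure \<Omega>)" using bounded_dom by (simp add: compact_closure)
    then have "bounded (v \<alpha> ` closure \<Omega>)" using cont compact_continuous_image compact_imp_bounded by blast
    then obtain M where "\<And>x. x \<in> \<Omega> \<Longrightarrow> norm (v \<alpha> x) \<le> M"
      using closure_subset unfolding bounded_iff by blast
    then show "vnorm \<rho> (v \<alpha>) < \<infinity>" by (rule vnorm_bounded[OF weak_deriv_measurable[OF w]])
  qed
qed

text \<open>For test functions in the domain \<open>T\<close> is integration against
  \<open>r\<close>. Moving the derivatives onto the weak derivatives of \<open>r\<close> turns the
  distributional equation, up to the sign (-1)^k, into the vanishing of all integrals of
  \<open>op_apply\<close> against test functions.\<close>

lemma op_apply_kernel_on:
  fixes A :: "('n \<Rightarrow> nat) \<Rightarrow> 'v::euclidean_space \<Rightarrow> 'w::euclidean_space"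
  assumes "diff_operator k A" "C_elliptic k A" "r \<in> kernel_on \<Omega> k A"
  shows "AE x in lebesgue_on \<Omega>. op_apply \<Omega> k A r x = 0"
proof (rule kernel_onD[OF assms(3)])
  fix T assume T: "r \<in> L1_loc \<Omega>" "T \<in> dist_kernel k A"
    "\<And>\<phi>. \<phi> \<in> test_functions \<Omega> \<Longrightarrow> T \<phi> = (LINT x:\<Omega>|lebesgue. \<phi> x *\<^sub>R r x)"
  let ?w = "\<lambda>\<alpha>. weak_deriv \<Omega> \<alpha> r"
  have w: "has_weak_deriv \<Omega> \<alpha> r (?w \<alpha>)" if "mi_order \<alpha> = k" for \<alpha>
    using sob_spaceD(1)[OF kernel_on_sob_space[OF assms, of k]] that by simp
  have L: "(\<lambda>x. A \<alpha> (?w \<alpha> x)) \<in> L1_loc \<Omega>" if "mi_order \<alpha> = k" for \<alpha>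
    using w[OF that] assms(1) that by (intro L1_loc_linear[of "A \<alpha>" "?w \<alpha>"]) (auto simp: has_weak_deriv_def diff_operator_def)
  have "AE x in lebesgue_on \<Omega>. (\<Sum>\<alpha> | mi_order \<alpha> = k. A \<alpha> (?w \<alpha> x)) = 0"
  proof (rule fundamental_lemma[OF open_dom])
    show "(\<lambda>x. \<Sum>\<alpha> | mi_order \<alpha> = k. A \<alpha> (?w \<alpha> x)) \<in> L1_loc \<Omega>"
      by (rule L1_loc_sum) (use L in auto)
    fix \<phi> assume \<phi>: "\<phi> \<in> test_functions \<Omega>"
    have "(LINT x:\<Omega>|lebesgue. \<phi> x *\<^sub>R (\<Sum>\<alpha> | mi_order \<alpha> = k. A \<alpha> (?w \<alpha> x))) =
        (\<Sum>\<alpha> | mi_order \<alpha> = k. LINT x:\<Omega>|lebesgue. \<phi> x *\<^sub>R A \<alpha> (?w \<alpha> x))"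
      by (rule integral_sum_test[OF \<phi>]) (use L in auto)
    also have "\<dots> = (\<Sum>\<alpha> | mi_order \<alpha> = k. (-1) ^ k *\<^sub>R A \<alpha> (T (mi_partial \<alpha> \<phi>)))"
    proof (intro sum.cong refl)
      fix \<alpha> :: "'n \<Rightarrow> nat" assume "\<alpha> \<in> {\<alpha>. mi_order \<alpha> = k}"
      then have \<alpha>: "mi_order \<alpha> = k" by simp
      then have lin: "linear (A \<alpha>)" using assms(1) by (simp add: diff_operator_def)
      have "T (mi_partial \<alpha> \<phi>) = (-1) ^ k *\<^sub>R (LINT x:\<Omega>|lebesgue. \<phi> x *\<^sub>R ?w \<alpha> x)"
        using w[OF \<alpha>] \<phi> T(3)[OF mi_partial_test[OF \<phi>]] \<alpha> by (simp add: has_weak_deriv_def)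
      then have "(-1) ^ k *\<^sub>R T (mi_partial \<alpha> \<phi>) = (LINT x:\<Omega>|lebesgue. \<phi> x *\<^sub>R ?w \<alpha> x)"
        by (simp add: power_mult_distrib[symmetric])
      then show "(LINT x:\<Omega>|lebesgue. \<phi> x *\<^sub>R A \<alpha> (?w \<alpha> x)) = (-1) ^ k *\<^sub>R A \<alpha> (T (mi_partial \<alpha> \<phi>))"
        using integral_linear_test[OF lin \<phi>, of "?w \<alpha>"] w[OF \<alpha>] lin
        by (simp add: has_weak_deriv_def flip: linear_cmul)
    qed
    also have "\<dots> = (-1) ^ k *\<^sub>R (\<Sum>\<alpha> | mi_order \<alpha> = k. A \<alpha> (T (mi_partial \<alpha> \<phi>)))"
      by (simp add: scaleR_sum_right)
    also have "\<dots> = 0"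
      using dist_kernelD(2)[OF T(2) assms(1), of \<phi>] \<phi> test_functions_mono[of \<Omega> UNIV] by auto
    finally show "(LINT x:\<Omega>|lebesgue. \<phi> x *\<^sub>R (\<Sum>\<alpha> | mi_order \<alpha> = k. A \<alpha> (?w \<alpha> x))) = 0" .
  qed
  then show ?thesis by (simp add: op_apply_def)
qed

end

section \<open>Equivalence of the three conditions\<close>

text \<open>\<open>P\<close> attains a positive minimum on the sphere \<open>(\<Sum>i\<in>B. \<bar>a i\<bar>) = 1\<close>, which is compact in the
  product topology.\<close>

lemma coefficient_bound:
  fixes P :: "('i \<Rightarrow> real) \<Rightarrow> real"
  assumes fin: "finite B"
    and cong: "\<And>a a'. (\<And>i. i \<in> B \<Longrightarrow> a i = a' i) \<Longrightarrow> P a = P a'"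
    and add: "\<And>a a'. P (\<lambda>i. a i + a' i) \<le> P a + P a'"
    and scale: "\<And>c a. P (\<lambda>i. c * a i) = \<bar>c\<bar> * P a"
    and inj: "\<And>a i. P a = 0 \<Longrightarrow> i \<in> B \<Longrightarrow> a i = 0"
  obtains c where "c \<ge> 0" "\<And>a. (\<Sum>i\<in>B. \<bar>a i\<bar>) \<le> c * P a"
proof (cases "B = {}")
  case True
  then show thesis by (intro that[of 0]) auto
next
  case False
  have P0: "P (\<lambda>i. 0) = 0" using scale[of 0 "\<lambda>i. 0"] by simp
  have nonneg: "0 \<le> P a" for a
    using add[of a "\<lambda>i. -1 * a i"] scale[of "-1" a] P0 by simp
  define \<delta> where "\<delta> j = (\<lambda>i. if i = j then 1 else 0 :: real)" for j :: 'i
  \<comment> \<open>Decomposition into coordinate vectors, where \<open>cong\<close> discards the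
    coordinates outside \<open>B\<close>. Applied to differences, this bound makes \<open>P\<close>
    continuous.\<close>
  have upper: "P a \<le> (\<Sum>i\<in>B. \<bar>a i\<bar> * P (\<delta> i))" for a
  proof -
    have "P (\<lambda>i. if i \<in> F then a i else 0) \<le> (\<Sum>i\<in>F. \<bar>a i\<bar> * P (\<delta> i))" if "finite F" for F
      using that
    proof induction
      case empty
      then show ?case by (simp add: P0)
    next
      case (insert j F)
      have "P (\<lambda>i. if i \<in> insert j F then a i else 0) = P (\<lambda>i. a j * \<delta> j i + (if i \<in> F then a i else 0))"
        using insert.hyps by (intro arg_cong[of _ _ P]) (auto simp: \<delta>_def)
      also have "\<dots> \<le> P (\<lambda>i. a j * \<delta> j i) + P (\<lambda>i. if i \<in> F then a i else 0)" by (rule add)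
      also have "\<dots> \<le> \<bar>a j\<bar> * P (\<delta> j) + (\<Sum>i\<in>F. \<bar>a i\<bar> * P (\<delta> i))"
        using insert.IH by (simp add: scale)
      finally show ?case using insert.hyps by simp
    qed
    from this[OF fin] show ?thesis using cong[of a "\<lambda>i. if i \<in> B then a i else 0"] by simp
  qed
  \<comment> \<open>Coordinates outside \<open>B\<close> are frozen at 0. The sphere thus lies in a
    product of compact sets even if the index type is infinite, and Tychonoff's theorem
    applies.\<close>
  let ?Q = "PiE UNIV (\<lambda>i. if i \<in> B then {-1..1::real} else {0})"
  define S where "S = {a \<in> ?Q. (\<Sum>i\<in>B. \<bar>a i\<bar>) = 1}"
  have "compact ?Q"
    using compactin_PiE[of "\<lambda>_. euclidean :: real topology" UNIV "\<lambda>i. if i \<in> B then {-1..1::real} else {0}"]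
    by (auto simp: euclidean_product_topology)
  moreover have "closed {a :: 'i \<Rightarrow> real. (\<Sum>i\<in>B. \<bar>a i\<bar>) = 1}"
    by (intro closed_Collect_eq continuous_intros continuous_on_product_coordinates)
  ultimately have cS: "compact S"
    unfolding S_def using compact_Int_closed[of ?Q "{a. (\<Sum>i\<in>B. \<bar>a i\<bar>) = 1}"]
    by (simp add: Int_def)
  have neS: "S \<noteq> {}"
  proof -
    obtain j where "j \<in> B" using False by blast
    moreover have "\<bar>\<delta> j i\<bar> = (if i = j then 1 else 0)" for i by (simp add: \<delta>_def)
    ultimately have "(\<Sum>i\<in>B. \<bar>\<delta> j i\<bar>) = 1" using fin by (simp add: sum.delta)
    moreover have "\<delta> j \<in> ?Q" using \<open>j \<in> B\<close> by (auto simp: \<delta>_def PiE_UNIV_domain)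
    ultimately show ?thesis by (auto simp: S_def)
  qed
  have cont: "continuous_on S P"
    unfolding continuous_on_def
  proof
    fix a assume "a \<in> S"
    have diff: "\<bar>P a' - P a\<bar> \<le> (\<Sum>i\<in>B. \<bar>a' i - a i\<bar> * P (\<delta> i))" for a'
    proof -
      have "P a' \<le> P a + P (\<lambda>i. a' i - a i)" using add[of a "\<lambda>i. a' i - a i"] by simp
      moreover have "P a \<le> P a' + P (\<lambda>i. a' i - a i)"
        using add[of a' "\<lambda>i. -1 * (a' i - a i)"] scale[of "-1" "\<lambda>i. a' i - a i"] by simp
      ultimately have "\<bar>P a' - P a\<bar> \<le> P (\<lambda>i. a' i - a i)" by linarith
      also have "\<dots> \<le> (\<Sum>i\<in>B. \<bar>a' i - a i\<bar> * P (\<delta> i))" by (rule upper)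
      finally show ?thesis .
    qed
    have "((\<lambda>a'. \<Sum>i\<in>B. \<bar>a' i - a i\<bar> * P (\<delta> i)) \<longlongrightarrow> (\<Sum>i\<in>B. \<bar>a i - a i\<bar> * P (\<delta> i))) (at a within S)"
    proof (intro tendsto_intros)
      fix i
      show "((\<lambda>a'. a' i) \<longlongrightarrow> a i) (at a within S)"
        using continuous_on_subset[OF continuous_on_product_coordinates, of S i] \<open>a \<in> S\<close>
        by (simp add: continuous_on_def)
    qed
    then have lim: "((\<lambda>a'. \<Sum>i\<in>B. \<bar>a' i - a i\<bar> * P (\<delta> i)) \<longlongrightarrow> 0) (at a within S)" by simp
    have "((\<lambda>a'. P a' - P a) \<longlongrightarrow> 0) (at a within S)"
      by (rule Lim_null_comparison[OF _ lim]) (use diff in \<open>auto intro!: always_eventually\<close>)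
    then show "(P \<longlongrightarrow> P a) (at a within S)" by (simp add: LIM_zero_iff)
  qed
  obtain a0 where a0: "a0 \<in> S" "\<And>a. a \<in> S \<Longrightarrow> P a0 \<le> P a"
    using continuous_attains_inf[OF cS neS cont] by blast
  have pos: "P a0 > 0"
  proof (rule ccontr)
    assume "\<not> P a0 > 0"
    then have "P a0 = 0" using nonneg[of a0] by simp
    then have "(\<Sum>i\<in>B. \<bar>a0 i\<bar>) = 0" using inj[of a0] by simp
    then show False using a0(1) by (simp add: S_def)
  qed
  have "(\<Sum>i\<in>B. \<bar>a i\<bar>) \<le> (1 / P a0) * P a" for a
  proof (cases "(\<Sum>i\<in>B. \<bar>a i\<bar>) = 0")
    case True
    then show ?thesis using nonneg[of a] pos by simp
  next
    case False
    define s where "s = (\<Sum>i\<in>B. \<bar>a i\<bar>)"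
    have s: "s > 0" using False by (simp add: s_def less_le sum_nonneg)
    \<comment> \<open>The normalised coefficients are also reset to 0 outside \<open>B\<close>, in
      order to lie in \<open>?Q\<close>; by \<open>cong\<close> this does not change the value of
      \<open>P\<close>.\<close>
    define a1 where "a1 i = (if i \<in> B then a i / s else 0)" for i
    have "\<bar>a i\<bar> \<le> s" if "i \<in> B" for i unfolding s_def by (rule member_le_sum) (use fin that in auto)
    then have "\<bar>a1 i\<bar> \<le> 1" for i using s by (simp add: a1_def abs_divide)
    then have "-1 \<le> a1 i" "a1 i \<le> 1" for i by (simp_all add: abs_le_iff minus_le_iff)
    moreover have "a1 i = 0" if "i \<notin> B" for i using that by (simp add: a1_def)
    ultimately have "a1 \<in> ?Q" by (simp add: PiE_UNIV_domain Pi_iff)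
    moreover have "(\<Sum>i\<in>B. \<bar>a1 i\<bar>) = 1" using s by (simp add: a1_def abs_divide s_def flip: sum_divide_distrib)
    ultimately have "P a0 \<le> P a1" using a0(2) by (simp add: S_def)
    also have "P a1 = P (\<lambda>i. (1 / s) * a i)" by (rule cong) (simp add: a1_def)
    also have "\<dots> = (1 / s) * P a" unfolding scale using s by simp
    finally show ?thesis using s pos by (simp add: s_def field_simps)
  qed
  then show thesis using pos by (intro that[of "1 / P a0"]) auto
qed

text \<open>The set where a continuous function does not vanish is open, and a nonempty open set is
  not a null set.\<close>

lemma continuous_zero_AE:
  fixes u :: "real^'n \<Rightarrow> 'v::euclidean_space"
  assumes "open \<Omega>" "continuous_on \<Omega> u" "AE x in lebesgue_on \<Omega>. u x = 0" "x \<in> \<Omega>"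
  shows "u x = 0"
proof -
  let ?S = "{x \<in> \<Omega>. u x \<noteq> 0}"
  have "?S = \<Omega> \<inter> u -` (- {0})" by auto
  then have "open ?S" using continuous_open_preimage[OF assms(2,1), of "- {0}"] by auto
  have "AE x in lebesgue. x \<in> \<Omega> \<longrightarrow> u x = 0" using assms(1,3) by (simp add: AE_restrict_space_iff)
  then obtain N where N: "N \<in> null_sets lebesgue" "{x \<in> space lebesgue. \<not> (x \<in> \<Omega> \<longrightarrow> u x = 0)} \<subseteq> N"
    by (auto simp: eventually_ae_filter)
  have "negligible N" using N(1) by (simp add: negligible_iff_null_sets)
  then have "negligible ?S" by (rule negligible_subset) (use N(2) in auto)
  then have "?S = {}" using \<open>open ?S\<close> open_not_negligible by blast
  then show ?thesis using assms(4) by blast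
qed


lemma seminorm_onD:
  assumes "seminorm_on \<Omega> S p"
  shows "u \<in> S \<Longrightarrow> v \<in> S \<Longrightarrow> AE x in lebesgue_on \<Omega>. u x = v x \<Longrightarrow> p u = p v"
    "u \<in> S \<Longrightarrow> v \<in> S \<Longrightarrow> p (\<lambda>x. u x + v x) \<le> p u + p v"
    "u \<in> S \<Longrightarrow> p (\<lambda>x. c *\<^sub>R u x) = \<bar>c\<bar> * p u"
proof -
  note H = assms[unfolded seminorm_on_def]
  note H1 = H[THEN conjunct1] and H2 = H[THEN conjunct2, THEN conjunct1] and H3 = H[THEN conjunct2, THEN conjunct2]
  show "p u = p v" if "u \<in> S" "v \<in> S" "AE x in lebesgue_on \<Omega>. u x = v x"
    by (rule mp[OF bspec[OF bspec[OF H1 that(1)] that(2)] that(3)])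
  show "p (\<lambda>x. u x + v x) \<le> p u + p v" if "u \<in> S" "v \<in> S"
    by (rule bspec[OF bspec[OF H2 that(1)] that(2)])
  show "p (\<lambda>x. c *\<^sub>R u x) = \<bar>c\<bar> * p u" if "u \<in> S"
    by (rule bspec[OF spec[OF H3] that])
qed

lemma seminorm_on_subset:
  assumes "seminorm_on \<Omega> S p" "K \<subseteq> S" shows "seminorm_on \<Omega> K p"
  unfolding seminorm_on_def
  by (intro conjI ballI allI impI seminorm_onD[OF assms(1)]; (rule subsetD[OF assms(2)])?; assumption)

text \<open>A norm on a finite-dimensional space dominates every other seminorm there. In terms of a
  basis, \<open>coefficient_bound\<close> controls the coefficients by \<open>p\<close>, and the
  triangle inequality controls \<open>vnorm\<close> by the coefficients.\<close>

lemma (in bf_norm) kernel_norm_bound: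
  fixes A :: "('n \<Rightarrow> nat) \<Rightarrow> 'v::euclidean_space \<Rightarrow> 'w::euclidean_space"
  assumes A: "diff_operator k A" "C_elliptic k A" and p: "norm_on \<Omega> (kernel_on \<Omega> k A) p"
  obtains c where "c \<ge> 0" "\<And>r. r \<in> kernel_on \<Omega> k A \<Longrightarrow> vnorm \<rho> r \<le> ennreal (c * p r)"
proof (rule kernel_on_polynomial[OF open_dom A])
  fix m assume poly: "\<And>r. r \<in> kernel_on \<Omega> k A \<Longrightarrow>
    \<exists>c. AE x in lebesgue_on \<Omega>. r x = poly_fun m c x"
  let ?K = "kernel_on \<Omega> k A"
  let ?box = "mono_box m (UNIV :: 'n set)"
  have sem: "seminorm_on \<Omega> ?K p" and zero: "\<forall>u\<in>?K. p u = 0 \<longrightarrow> (AE x in lebesgue_on \<Omega>. u x = 0)"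
    using p unfolding norm_on_def by (rule conjunct1, rule conjunct2)
  note p_AE = seminorm_onD(1)[OF sem] and p_add = seminorm_onD(2)[OF sem] and p_scale = seminorm_onD(3)[OF sem]
  have p_zero: "AE x in lebesgue_on \<Omega>. u x = 0" if "u \<in> ?K" "p u = 0" for u
    by (rule mp[OF bspec[OF zero that(1)] that(2)])
  have K_meas: "meas u" "vnorm \<rho> u < \<infinity>" if "u \<in> ?K" for u
    using sob_space_measurable sob_space_vnorm_finite kernel_on_sob_space[OF A that, of k] by auto
  \<comment> \<open>Truncation to \<open>\<Omega>\<close> turns equality almost everywhere on \<open>\<Omega>\<close> into equality of functions.\<close>
  define cut :: "(('n \<Rightarrow> nat) \<Rightarrow> 'v) \<Rightarrow> real^'n \<Rightarrow> 'v"
    where "cut c x = (if x \<in> \<Omega> then poly_fun m c x else 0)" for c x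
  have cut_L1: "cut c \<in> L1_loc \<Omega>" for c
  proof -
    have "(\<lambda>x. poly_fun m c x) \<in> L1_loc \<Omega>"
      by (intro L1_loc_continuous continuous_on_sum continuous_on_scaleR continuous_on_const smooth_continuous smooth_mono_fun)
    moreover have "set_integrable lebesgue K (cut c) \<longleftrightarrow> set_integrable lebesgue K (\<lambda>x. poly_fun m c x)"
      if "K \<subseteq> \<Omega>" for K
      unfolding cut_def by (rule set_integrable_cong) (use that in auto)
    ultimately show ?thesis by (auto simp: L1_loc_def)
  qed
  have cut_cont: "continuous_on \<Omega> (cut c)" for c
  proof -
    have "continuous_on \<Omega> (\<lambda>x. poly_fun m c x)"
      by (intro continuous_on_sum continuous_on_scaleR continuous_on_const smooth_continuous smooth_mono_fun)
    then show ?thesis by (rule continuous_on_eq) (simp add: cut_def)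
  qed
  define scale :: "real \<Rightarrow> (real^'n \<Rightarrow> 'v) \<Rightarrow> real^'n \<Rightarrow> 'v" where "scale c f = (\<lambda>x. c *\<^sub>R f x)" for c f
  interpret fv: vector_space scale
    by unfold_locales (auto simp: scale_def fun_eq_iff algebra_simps)
  \<comment> \<open>The truncated polynomials in the kernel form a genuine subspace of functions;
    each kernel element agrees almost everywhere with one of them.\<close>
  define K0 where "K0 = ?K \<inter> range cut"
  have K0: "fv.subspace K0"
  proof (rule fv.subspaceI)
    have "(0 :: real^'n \<Rightarrow> 'v) = cut (\<lambda>_. 0)" by (auto simp: cut_def fun_eq_iff)
    then show "0 \<in> K0" using zero_in_kernel_on[OF A(1), of \<Omega>] by (auto simp: K0_def zero_fun_def)
  next
    fix u v assume "u \<in> K0" "v \<in> K0"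
    then obtain c d where cd: "u = cut c" "v = cut d" "u \<in> ?K" "v \<in> ?K" by (auto simp: K0_def)
    have "u + v = cut (\<lambda>J. c J + d J)" by (auto simp: cd cut_def fun_eq_iff scaleR_add_right sum.distrib)
    moreover have "u + v \<in> ?K" using kernel_on_add_scaleR[OF A(1) cd(3,4), of 1] by (simp add: plus_fun_def)
    ultimately show "u + v \<in> K0" by (auto simp: K0_def)
  next
    fix a u assume "u \<in> K0"
    then obtain c where c: "u = cut c" "u \<in> ?K" by (auto simp: K0_def)
    have "scale a u = cut (\<lambda>J. a *\<^sub>R c J)" by (auto simp: c scale_def cut_def fun_eq_iff scaleR_sum_right mult.commute)
    moreover have "scale a u \<in> ?K"
      using kernel_on_add_scaleR[OF A(1) zero_in_kernel_on[OF A(1)] c(2), of a] by (simp add: scale_def)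
    ultimately show "scale a u \<in> K0" by (auto simp: K0_def)
  qed
  \<comment> \<open>Truncated monomials times basis vectors: finitely many functions spanning all
    truncated polynomials, which makes every independent subset of \<open>K0\<close> finite.\<close>
  define g where "g = (\<lambda>(J, e) x. if x \<in> \<Omega> then mono_fun J x *\<^sub>R e else (0 :: 'v))"
  let ?G = "g ` (?box \<times> Basis)"
  have fG: "finite ?G" by (intro finite_imageI finite_cartesian_product finite_mono_box finite_Basis)
  have "cut c \<in> fv.span ?G" for c
  proof -
    have "cut c = (\<Sum>J\<in>?box. \<Sum>e\<in>Basis. scale (c J \<bullet> e) (g (J, e)))"
    proof
      fix x
      have "mono_fun J x *\<^sub>R c J = (\<Sum>e\<in>Basis. (c J \<bullet> e) *\<^sub>R (mono_fun J x *\<^sub>R e))" for J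
      proof -
        have "mono_fun J x *\<^sub>R c J = mono_fun J x *\<^sub>R (\<Sum>e\<in>Basis. (c J \<bullet> e) *\<^sub>R e)"
          by (simp only: euclidean_representation)
        then show ?thesis by (simp add: scaleR_sum_right mult.commute)
      qed
      then show "cut c x = (\<Sum>J\<in>?box. \<Sum>e\<in>Basis. scale (c J \<bullet> e) (g (J, e))) x"
        by (simp add: sum_fun_apply cut_def g_def scale_def)
    qed
    also have "\<dots> \<in> fv.span ?G"
      by (intro fv.span_sum fv.span_scale fv.span_base) auto
    finally show ?thesis .
  qed
  then have K0G: "K0 \<subseteq> fv.span ?G" by (auto simp: K0_def)
  obtain B where B: "B \<subseteq> K0" "fv.independent B" "K0 \<subseteq> fv.span B"
    using fv.maximal_independent_subset by blast
  have fB: "finite B" using fv.independent_span_bound[OF fG B(2)] B(1) K0G by blast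
  define U where "U a = (\<lambda>x. \<Sum>b\<in>B. a b *\<^sub>R b x)" for a
  have U: "U a = (\<Sum>b\<in>B. scale (a b) b)" for a
    by (auto simp: U_def fun_eq_iff sum_fun_apply scale_def)
  have UK0: "U a \<in> K0" for a
    unfolding U using B(1) by (intro fv.subspace_sum[OF K0] fv.subspace_scale[OF K0]) auto
  then have UK: "U a \<in> ?K" for a by (auto simp: K0_def)
  obtain c where c: "c \<ge> 0" "\<And>a. (\<Sum>b\<in>B. \<bar>a b\<bar>) \<le> c * p (U a)"
  proof (rule coefficient_bound[OF fB, of "\<lambda>a. p (U a)"])
    fix a a' :: "(real^'n \<Rightarrow> 'v) \<Rightarrow> real"
    show "p (U a) = p (U a')" if "\<And>b. b \<in> B \<Longrightarrow> a b = a' b"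
      using that by (simp add: U_def)
    have "U (\<lambda>b. a b + a' b) = (\<lambda>x. U a x + U a' x)" by (simp add: U_def scaleR_add_left sum.distrib)
    then show "p (U (\<lambda>b. a b + a' b)) \<le> p (U a) + p (U a')" using p_add[OF UK UK] by simp
  next
    fix t and a :: "(real^'n \<Rightarrow> 'v) \<Rightarrow> real"
    have "U (\<lambda>b. t * a b) = (\<lambda>x. t *\<^sub>R U a x)" by (simp add: U_def scaleR_sum_right)
    then show "p (U (\<lambda>b. t * a b)) = \<bar>t\<bar> * p (U a)" using p_scale[OF UK] by simp
  next
    fix a b assume a: "p (U a) = 0" "b \<in> B"
    obtain d where d: "U a = cut d" using UK0[of a] by (auto simp: K0_def)
    \<comment> \<open>A vanishing value of \<open>p\<close> gives \<open>U a = 0\<close> almost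
      everywhere only. Continuity on the domain and the value 0 outside turn this into an identity
      of functions, to which the independence of \<open>B\<close> applies.\<close>
    have "U a x = 0" for x
    proof (cases "x \<in> \<Omega>")
      case True
      then show ?thesis
        using continuous_zero_AE[OF open_dom cut_cont[of d] p_zero[OF UK a(1), unfolded d]] unfolding d by simp
    qed (simp add: d cut_def)
    then have "(\<Sum>b\<in>B. scale (a b) b) = 0" unfolding U[symmetric] by (simp add: fun_eq_iff)
    then show "a b = 0" by (rule fv.independentD[OF B(2) fB subset_refl _ a(2)])
  qed (rule that)
  \<comment> \<open>The sum of the norms of the basis elements, a crude common bound for all of
    them.\<close>
  define D where "D = (\<Sum>b\<in>B. enn2real (vnorm \<rho> b))"
  have D: "D \<ge> 0" "\<And>b. b \<in> B \<Longrightarrow> vnorm \<rho> b \<le> ennreal D"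
  proof -
    show "D \<ge> 0" by (simp add: D_def sum_nonneg)
    fix b assume b: "b \<in> B"
    then have "vnorm \<rho> b < \<infinity>" using K_meas B(1) by (auto simp: K0_def)
    then have "vnorm \<rho> b = ennreal (enn2real (vnorm \<rho> b))" by simp
    also have "\<dots> \<le> ennreal D" unfolding D_def
      by (intro ennreal_leI member_le_sum) (use b fB in auto)
    finally show "vnorm \<rho> b \<le> ennreal D" .
  qed
  have bound: "vnorm \<rho> r \<le> ennreal ((D * c) * p r)" if r: "r \<in> ?K" for r
  proof -
    obtain d where "AE x in lebesgue_on \<Omega>. r x = poly_fun m d x"
      using poly[OF r] by blast
    then have "AE x in lebesgue_on \<Omega>. x \<in> \<Omega> \<longrightarrow> cut d x = r x"
      by eventually_elim (simp add: cut_def)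
    moreover have "AE x in lebesgue_on \<Omega>. x \<in> \<Omega>" by (rule AE_I2) (simp add: space_restrict_space)
    ultimately have ae: "AE x in lebesgue_on \<Omega>. cut d x = r x" by eventually_elim simp
    have cK: "cut d \<in> ?K" by (rule kernel_on_cong_AE[OF open_dom r cut_L1 ae])
    then have "cut d \<in> K0" by (auto simp: K0_def)
    then have "cut d \<in> range (\<lambda>a. \<Sum>b\<in>B. scale (a b) b)"
      using subsetD[OF B(3)] unfolding fv.span_finite[OF fB] by simp
    then obtain a where a: "cut d = U a" unfolding U by (rule rangeE)
    have "vnorm \<rho> r = vnorm \<rho> (U a)"
      using vnorm_cong_AE[OF K_meas(1)[OF cK] K_meas(1)[OF r] ae] by (simp add: a)
    also have "\<dots> \<le> (\<Sum>b\<in>B. vnorm \<rho> (\<lambda>x. a b *\<^sub>R b x))"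
      unfolding U_def
    proof (rule vnorm_sum)
      fix b assume "b \<in> B"
      then have "meas b" using K_meas(1) B(1) by (auto simp: K0_def)
      then show "meas (\<lambda>x. a b *\<^sub>R b x)" by measurable
    qed
    also have "\<dots> \<le> (\<Sum>b\<in>B. ennreal (\<bar>a b\<bar> * D))"
    proof (rule sum_mono)
      fix b assume b: "b \<in> B"
      then have "meas b" using K_meas(1) B(1) by (auto simp: K0_def)
      then have "vnorm \<rho> (\<lambda>x. a b *\<^sub>R b x) = ennreal \<bar>a b\<bar> * vnorm \<rho> b" by (rule vnorm_scaleR)
      also have "\<dots> \<le> ennreal \<bar>a b\<bar> * ennreal D" using D(2)[OF b] by (rule mult_left_mono) simp
      finally show "vnorm \<rho> (\<lambda>x. a b *\<^sub>R b x) \<le> ennreal (\<bar>a b\<bar> * D)" using D(1) by (simp add: ennreal_mult)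
    qed
    also have "\<dots> = ennreal (D * (\<Sum>b\<in>B. \<bar>a b\<bar>))"
      using D(1) by (subst sum_ennreal) (auto simp: sum_distrib_left mult.commute)
    also have "\<dots> \<le> ennreal (D * (c * p (U a)))"
      by (intro ennreal_leI mult_left_mono c(2) D(1))
    also have "p (U a) = p r" using p_AE[OF cK r ae] by (simp add: a)
    finally show ?thesis by (simp add: mult.assoc)
  qed
  show thesis by (rule that[OF _ bound]) (use c(1) D(1) in auto)
qed

text \<open>\<open>p_continuous\<close> is assumed in addition to the English statement; it bounds
  \<open>p\<close> by the norm ||u||_X + ||A u||_X and serves the passage from (a) to (b), where p(u
  - r) has to be estimated. Being a norm on the kernel does not imply such a bound. For the gradient
  of scalar functions, take p = |l| with a linear functional l that is discontinuous for this norm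
  and has the value 1 at the constant 1: then p is a norm on the constants, but vanishes on
  functions 1 + d with d arbitrarily small, which is incompatible with (b).\<close>

theorem theorem1p1:
  fixes \<Omega> :: "(real^'n) set"
    and k :: nat
    and A :: "('n \<Rightarrow> nat) \<Rightarrow> 'v::euclidean_space \<Rightarrow> 'w::euclidean_space"
    and \<rho>X \<rho>Y :: "(real^'n \<Rightarrow> ennreal) \<Rightarrow> ennreal"
    and C :: real
    and p :: "(real^'n \<Rightarrow> 'v) \<Rightarrow> real"
  assumes "CARD('n) \<ge> 2" and "k \<ge> 1"
    and "open \<Omega>" and "bounded \<Omega>"
    and "diff_operator k A" and "C_elliptic k A"
    and "banach_function_norm \<Omega> \<rho>X" and "banach_function_norm \<Omega> \<rho>Y"
    and "infinite_dimensional \<Omega> (bf_space \<Omega> \<rho>X :: (real^'n \<Rightarrow> 'v) set)"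
    and "infinite_dimensional \<Omega> (bf_space \<Omega> \<rho>Y :: (real^'n \<Rightarrow> 'v) set)"
    and "(bf_space \<Omega> \<rho>X :: (real^'n \<Rightarrow> 'v) set) \<subseteq> L1_loc \<Omega>"
    and "(bf_space \<Omega> \<rho>Y :: (real^'n \<Rightarrow> 'v) set) \<subseteq> L1_loc \<Omega>"
    and "C > 0"
    and "\<And>u. u \<in> sob_space \<Omega> k \<rho>X \<Longrightarrow>
           sob_norm \<Omega> k \<rho>Y u \<le> ennreal C * (vnorm \<rho>X u + vnorm \<rho>X (op_apply \<Omega> k A u))"
    and "\<And>u. u \<in> sob_space \<Omega> k \<rho>X \<Longrightarrow>
           (INF r\<in>kernel_on \<Omega> k A. vnorm \<rho>X (\<lambda>x. u x - r x))
             \<le> ennreal C * vnorm \<rho>X (op_apply \<Omega> k A u)"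
    and "seminorm_on \<Omega> (sob_space \<Omega> k \<rho>X) p"
    and p_continuous: "\<exists>M::real. \<forall>u\<in>sob_space \<Omega> k \<rho>X.
           ennreal (p u) \<le> ennreal M * (vnorm \<rho>X u + vnorm \<rho>X (op_apply \<Omega> k A u))"
  defines "cond_a \<equiv> norm_on \<Omega> (kernel_on \<Omega> k A) p"
    and "cond_b \<equiv> (\<exists>c::real. c > 0 \<and> (\<forall>u\<in>sob_space \<Omega> k \<rho>X.
           sob_norm \<Omega> k \<rho>Y u \<le> ennreal c * (ennreal (p u) + vnorm \<rho>X (op_apply \<Omega> k A u))))"
    and "cond_c \<equiv> (\<exists>c::real. c > 0 \<and> (\<forall>u\<in>sob_space \<Omega> k \<rho>X. p u = 0 \<longrightarrow>
           sob_norm \<Omega> k \<rho>Y u \<le> ennreal c * vnorm \<rho>X (op_apply \<Omega> k A u)))"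
  shows "(cond_a \<longleftrightarrow> cond_b) \<and> (cond_b \<longleftrightarrow> cond_c)"
proof -
  note A = assms(5,6) and hypY = assms(14) and hypK = assms(15) and p_sem = assms(16)
  interpret X: bf_norm \<Omega> \<rho>X using assms(3,4,7) by unfold_locales
  interpret Y: bf_norm \<Omega> \<rho>Y using assms(3,4,8) by unfold_locales
  let ?S = "sob_space \<Omega> k \<rho>X :: (real^'n \<Rightarrow> 'v) set" and ?K = "kernel_on \<Omega> k A"
  let ?A = "op_apply \<Omega> k A"
  have K_S: "?K \<subseteq> ?S" using X.kernel_on_sob_space[OF A] by blast
  have K_L1: "r \<in> L1_loc \<Omega>" if "r \<in> ?K" for r using that by (simp add: kernel_on_def)
  note p_add = seminorm_onD(2)[OF p_sem] and p_scale = seminorm_onD(3)[OF p_sem]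
  have p_nonneg: "0 \<le> p u" if "u \<in> ?S" for u
  proof -
    have m: "(\<lambda>x. 0 *\<^sub>R u x + (-1) *\<^sub>R u x) \<in> ?S"
      using X.sob_space_add_scaleR[OF subsetD[OF K_S zero_in_kernel_on[OF A(1)]] that, of "-1"] by simp
    have "p (\<lambda>x. 0 *\<^sub>R u x) = 0" using p_scale[OF that, of 0] by simp
    moreover have "p (\<lambda>x. (-1) *\<^sub>R u x) = p u" using p_scale[OF that, of "-1"] by simp
    moreover have "p (\<lambda>x. u x + (-1) *\<^sub>R u x) \<le> p u + p (\<lambda>x. (-1) *\<^sub>R u x)"
      using m by (intro p_add that) simp
    ultimately show ?thesis by simp
  qed
  have A_kernel: "vnorm \<rho>X (?A r) = 0" if "r \<in> ?K" for r
  proof -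
    have "vnorm \<rho>X (?A r) = vnorm \<rho>X (\<lambda>x. 0 :: 'w)"
      by (rule X.vnorm_cong_AE[OF X.op_apply_measurable[OF A(1) subsetD[OF K_S that]] _ X.op_apply_kernel_on[OF A that]])
        simp
    then show ?thesis by simp
  qed
  \<comment> \<open>Kernel elements are annihilated almost everywhere, so subtracting one does not
    change the X-norm of \<open>?A u\<close>.\<close>
  have A_diff: "vnorm \<rho>X (?A (\<lambda>x. u x + (-1) *\<^sub>R r x)) = vnorm \<rho>X (?A u)" if u: "u \<in> ?S" and r: "r \<in> ?K" for u r
  proof (rule X.vnorm_cong_AE)
    have rS: "r \<in> ?S" using r K_S by blast
    show "?A (\<lambda>x. u x + (-1) *\<^sub>R r x) \<in> borel_measurable (lebesgue_on \<Omega>)"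
      by (rule X.op_apply_measurable[OF A(1) X.sob_space_add_scaleR[OF u rS]])
    show "?A u \<in> borel_measurable (lebesgue_on \<Omega>)" by (rule X.op_apply_measurable[OF A(1) u])
    show "AE x in lebesgue_on \<Omega>. ?A (\<lambda>x. u x + (-1) *\<^sub>R r x) x = ?A u x"
      using X.op_apply_add_scaleR[OF A(1) u rS, of "-1"] X.op_apply_kernel_on[OF A r]
      by eventually_elim simp
  qed
  have a_b: cond_b if "cond_a"
  proof -
    obtain c0 where c0: "c0 \<ge> 0" "\<And>r. r \<in> ?K \<Longrightarrow> vnorm \<rho>X r \<le> ennreal (c0 * p r)"
      using X.kernel_norm_bound[OF A] \<open>cond_a\<close> unfolding cond_a_def by metis
    obtain M0 where M0: "\<forall>u\<in>?S. ennreal (p u) \<le> ennreal M0 * (vnorm \<rho>X u + vnorm \<rho>X (?A u))"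
      using p_continuous by blast
    \<comment> \<open>A negative \<open>M0\<close> would be read as 0 by \<open>ennreal\<close>; the
      real estimates below need a nonnegative constant.\<close>
    define M where "M = max 0 M0"
    have M: "M \<ge> 0" "\<And>u. u \<in> ?S \<Longrightarrow> ennreal (p u) \<le> ennreal M * (vnorm \<rho>X u + vnorm \<rho>X (?A u))"
    proof -
      show "M \<ge> 0" by (simp add: M_def)
      fix u assume "u \<in> ?S"
      then have "ennreal (p u) \<le> ennreal M0 * (vnorm \<rho>X u + vnorm \<rho>X (?A u))" by (rule bspec[OF M0])
      also have "\<dots> \<le> ennreal M * (vnorm \<rho>X u + vnorm \<rho>X (?A u))"
        by (intro mult_right_mono ennreal_leI) (auto simp: M_def)
      finally show "ennreal (p u) \<le> ennreal M * (vnorm \<rho>X u + vnorm \<rho>X (?A u))" .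
    qed
    \<comment> \<open>Write y for the X-norm of u - r and a for that of A u. The X-norm of u is at
      most y + c0 p(r), and p(r) is at most p(u) + M (y + a); together y and a receive the factor 1
      + c0 M.\<close>
    define L where "L = 1 + c0 * M"
    have L: "L \<ge> 1" using c0(1) M(1) by (simp add: L_def)
    \<comment> \<open>Inserting the bound C a + \<epsilon> for y gives C (L C + L) a + C c0 p(u) + C
      L \<epsilon>; \<open>c\<close> majorises the coefficients of a and of p(u).\<close>
    define c where "c = C * (L * C + L + c0)"
    have cpos: "c > 0" using \<open>C > 0\<close> L c0(1) by (simp add: c_def add_pos_nonneg)
    have "sob_norm \<Omega> k \<rho>Y u \<le> ennreal c * (ennreal (p u) + vnorm \<rho>X (?A u))" if u: "u \<in> ?S" for u
    proof (rule ennreal_le_epsilon)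
      fix e :: real assume e: "0 < e"
      \<comment> \<open>The excess over the infimum picks up the factor \<open>C * L\<close> on its
        way through the estimates and ends as exactly \<open>e\<close>.\<close>
      define \<epsilon> where "\<epsilon> = e / (C * L)"
      have \<epsilon>: "\<epsilon> > 0" using e \<open>C > 0\<close> L by (simp add: \<epsilon>_def)
      define a where "a = enn2real (vnorm \<rho>X (?A u))"
      have a: "vnorm \<rho>X (?A u) = ennreal a" "a \<ge> 0"
        using X.vnorm_op_apply_finite[OF A(1) u] by (simp_all add: a_def)
      have "(INF r\<in>?K. vnorm \<rho>X (\<lambda>x. u x - r x)) \<le> ennreal (C * a)"
        using hypK[OF u] a \<open>C > 0\<close> by (simp add: ennreal_mult)
      also have "\<dots> < ennreal (C * a + \<epsilon>)" using \<epsilon> a(2) \<open>C > 0\<close> by (intro ennreal_lessI) (auto simp: add_nonneg_pos)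
      finally obtain r where r: "r \<in> ?K" "vnorm \<rho>X (\<lambda>x. u x - r x) < ennreal (C * a + \<epsilon>)"
        by (auto simp: INF_less_iff)
      have rS: "r \<in> ?S" using r(1) K_S by blast
      let ?d = "\<lambda>x. u x + (-1) *\<^sub>R r x"
      have dS: "?d \<in> ?S" by (rule X.sob_space_add_scaleR[OF u rS])
      define y where "y = enn2real (vnorm \<rho>X ?d)"
      have y: "vnorm \<rho>X ?d = ennreal y" "y \<ge> 0"
        using X.sob_space_vnorm_finite[OF dS] by (simp_all add: y_def)
      have "ennreal y < ennreal (C * a + \<epsilon>)" using r(2) unfolding y(1)[symmetric] by simp
      then have y_le: "y \<le> C * a + \<epsilon>" using y(2) by (simp add: ennreal_less_iff)
      have "ennreal (p ?d) \<le> ennreal (M * (y + a))"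
        using M(2)[OF dS] M(1) y a unfolding A_diff[OF u r(1)] by (simp add: ennreal_mult flip: ennreal_plus)
      then have pd: "p ?d \<le> M * (y + a)" using M(1) y a by (simp add: ennreal_le_iff)
      \<comment> \<open>As r = u - d with d denoting \<open>?d\<close>, the triangle inequality
        moves the estimate from \<open>r\<close> to \<open>u\<close> at the price of
        \<open>p ?d\<close>, which the continuity of \<open>p\<close> has bounded in
        \<open>pd\<close>.\<close>
      have "p r \<le> p u + p ?d"
      proof -
        have mS: "(\<lambda>x. (-1) *\<^sub>R ?d x) \<in> ?S"
          using X.sob_space_add_scaleR[OF subsetD[OF K_S zero_in_kernel_on[OF A(1)]] dS, of "-1"] by simp
        have "p (\<lambda>x. u x + (-1) *\<^sub>R ?d x) \<le> p u + p (\<lambda>x. (-1) *\<^sub>R ?d x)" by (rule p_add[OF u mS])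
        moreover have "p (\<lambda>x. (-1) *\<^sub>R ?d x) = p ?d" using p_scale[OF dS, of "-1"] by simp
        moreover have "(\<lambda>x. u x + (-1) *\<^sub>R ?d x) = r" by auto
        ultimately show ?thesis by simp
      qed
      with pd have pr: "p r \<le> p u + M * (y + a)" by linarith
      have "vnorm \<rho>X u = vnorm \<rho>X (\<lambda>x. ?d x + r x)" by simp
      also have "\<dots> \<le> vnorm \<rho>X ?d + vnorm \<rho>X r"
        by (rule X.vnorm_add[OF X.sob_space_measurable[OF dS] X.sob_space_measurable[OF rS]])
      also have "\<dots> \<le> ennreal y + ennreal (c0 * p r)" unfolding y(1) by (intro add_left_mono c0(2) r(1))
      also have "\<dots> = ennreal (y + c0 * p r)" using y(2) c0(1) p_nonneg[OF rS] by simp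
      finally have xu: "vnorm \<rho>X u \<le> ennreal (y + c0 * p r)" .
      have "sob_norm \<Omega> k \<rho>Y u \<le> ennreal C * (vnorm \<rho>X u + vnorm \<rho>X (?A u))" by (rule hypY[OF u])
      also have "\<dots> \<le> ennreal C * (ennreal (y + c0 * p r) + ennreal a)"
        unfolding a(1) by (intro mult_left_mono add_right_mono xu) simp
      also have "\<dots> = ennreal (C * (y + c0 * p r + a))"
        using \<open>C > 0\<close> y(2) a(2) c0(1) p_nonneg[OF rS] by (simp add: ennreal_mult flip: ennreal_plus)
      also have "\<dots> \<le> ennreal (c * (p u + a) + e)"
      proof (rule ennreal_leI)
        have "c0 * p r \<le> c0 * (p u + M * (y + a))" by (rule mult_left_mono[OF pr c0(1)])
        then have "y + c0 * p r + a \<le> L * y + c0 * p u + L * a" by (simp add: L_def algebra_simps)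
        also have "\<dots> \<le> L * (C * a + \<epsilon>) + c0 * p u + L * a" using y_le L by simp
        finally have "C * (y + c0 * p r + a) \<le> C * (L * (C * a + \<epsilon>) + c0 * p u + L * a)"
          using \<open>C > 0\<close> by simp
        also have "\<dots> = C * (L * C + L) * a + C * c0 * p u + e"
          using \<open>C > 0\<close> L by (simp add: \<epsilon>_def field_simps)
        also have "\<dots> \<le> c * a + c * p u + e"
        proof -
          have "C * (L * C + L) \<le> c" "C * c0 \<le> c" using \<open>C > 0\<close> L c0(1) by (simp_all add: c_def)
          then have "C * (L * C + L) * a \<le> c * a" "C * c0 * p u \<le> c * p u"
            using a(2) p_nonneg[OF u] by (auto intro: mult_right_mono)
          then show ?thesis by simp
        qed
        finally show "C * (y + c0 * p r + a) \<le> c * (p u + a) + e" by (simp add: algebra_simps)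
      qed
      also have "\<dots> = ennreal c * (ennreal (p u) + vnorm \<rho>X (?A u)) + ennreal e"
        using cpos a p_nonneg[OF u] e by (simp add: ennreal_mult)
      finally show "sob_norm \<Omega> k \<rho>Y u \<le> ennreal c * (ennreal (p u) + vnorm \<rho>X (?A u)) + ennreal e" .
    qed
    then show ?thesis unfolding cond_b_def using cpos by blast
  qed
  have b_c: cond_c if cond_b
  proof -
    obtain c where "c > 0" and c: "\<forall>u\<in>?S. sob_norm \<Omega> k \<rho>Y u \<le> ennreal c * (ennreal (p u) + vnorm \<rho>X (?A u))"
      using \<open>cond_b\<close> unfolding cond_b_def by blast
    have "\<forall>u\<in>?S. p u = 0 \<longrightarrow> sob_norm \<Omega> k \<rho>Y u \<le> ennreal c * vnorm \<rho>X (?A u)"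
    proof (intro ballI impI)
      fix u assume "u \<in> ?S" "p u = 0"
      with bspec[OF c \<open>u \<in> ?S\<close>] show "sob_norm \<Omega> k \<rho>Y u \<le> ennreal c * vnorm \<rho>X (?A u)" by simp
    qed
    with \<open>c > 0\<close> show ?thesis unfolding cond_c_def by blast
  qed
  have c_a: cond_a if cond_c
  proof -
    obtain c where c: "\<forall>u\<in>?S. p u = 0 \<longrightarrow> sob_norm \<Omega> k \<rho>Y u \<le> ennreal c * vnorm \<rho>X (?A u)"
      using \<open>cond_c\<close> unfolding cond_c_def by blast
    show ?thesis unfolding cond_a_def norm_on_def
    proof (intro conjI ballI impI)
      show "seminorm_on \<Omega> ?K p" by (rule seminorm_on_subset[OF p_sem K_S])
      fix r assume r: "r \<in> ?K" "p r = 0"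
      \<comment> \<open>For a kernel element the right-hand side is 0, so the Y-norm of
        \<open>r\<close> vanishes and (B1) for Y finishes.\<close>
      have "sob_norm \<Omega> k \<rho>Y r \<le> ennreal c * vnorm \<rho>X (?A r)"
        by (rule mp[OF bspec[OF c subsetD[OF K_S r(1)]] r(2)])
      then have "sob_norm \<Omega> k \<rho>Y r = 0" using A_kernel[OF r(1)] by simp
      then have "vnorm \<rho>Y r = 0" using Y.vnorm_le_sob_norm[OF K_L1[OF r(1)], of k] by simp
      then show "AE x in lebesgue_on \<Omega>. r x = 0"
        by (rule Y.vnorm_zero_AE[OF L1_loc_measurable[OF assms(3) K_L1[OF r(1)]]])
    qed
  qed
  show ?thesis using a_b b_c c_a by blast
qed

end
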